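(* Let $k,l,m$ be integers with $k\le l$. The coefficients (rational functions of $a,b,c,q,x$) of the three term relation $$\phi(aq^{k},bq^{l};cq^{m};q,x)=Q\cdot\phi(aq,bq;cq;q,x)+R\cdot\phi(a,b;c;q,x)$$ can be expressed as $$Q=Q(k,l,m)=-\lambda\,\frac{(1-a)(1-b)c}{(q-c)(1-c)}\,\frac{x^{1-\max\{m,0\}}}{(abqx/c)_{\max\{k+l-m,0\}-1}}\,\tilde P_{k,l,m}(a,b,c;x),$$ $$R=R(k,l,m)=-\lambda'\,\frac{x^{-\max\{m-1,0\}}}{(abqx/c)_{\max\{k+l-m-1,0\}}}\,\tilde P_{k-1,l-1,m-1}(aq,bq,cq;x),$$ where $$\lambda=(-1)^{k+l-m-1+M}q^{\{k(k-1)+l(l-1)-m(m-1)+M(M-1)\}/2}\,\frac{(q-c)a^kb^l}{(b-a)c^m}\left(\frac{ab}{c}\right)^{M}\frac{(c)_m}{(a)_k(b)_l},\qquad M=\max\{k+l-m,0\},$$ $$\lambda'=(-1)^{k+l-m+M'}q^{\{k(k-1)+l(l-1)-m(m-1)+M'(M'+1)\}/2}\,\frac{a^kb^l}{(b-a)c^m}\left(\frac{ab}{c}\right)^{M'-1}\frac{(c)_m}{(aq)_{k-1}(bq)_{l-1}},\qquad M'=\max\{k+l-m-1,0\},$$ and $\tilde P_{k,l,m}(a,b,c;x)$ is the polynomial in $x$ defined in the context.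
   Context: Here $q$ is a complex number with $0<|q|<1$, and $a,b,c$ are nonzero complex parameters satisfying E1: $c,\ a/b\notin q^{\mathbb{Z}}$ and E2: $a,\ b,\ c/a,\ c/b\notin q^{\mathbb{Z}}$. Put $(u)_\infty=\prod_{n\ge 0}(1-uq^n)$ and $(u)_n=(u)_\infty/(uq^n)_\infty$ for $n\in\mathbb{Z}$; i.e. $(u)_n=\prod_{j=0}^{n-1}(1-uq^j)$ for $n\ge0$ and $(u)_{-n}=\prod_{j=1}^{n}(1-uq^{-j})^{-1}$ for $n>0$. Define $$\phi(a,b;c;q,x)=\sum_{n\ge0}\frac{(a)_n(b)_n}{(q)_n(c)_n}x^n,\qquad {}_4\phi_3(a_0,a_1,a_2,a_3;b_1,b_2,b_3;q,z)=\sum_{i\ge0}\frac{(a_0)_i(a_1)_i(a_2)_i(a_3)_i}{(q)_i(b_1)_i(b_2)_i(b_3)_i}z^i .$$ Rational functions of $a,b,c,q,x$ are elements of $\mathbb{Q}(a,b,c,q,x)$; the relation is an identity for $|x|<1$ wherever both sides are defined. (The pair $(Q,R)$ of such rational functions is uniquely determined by $(k,l,m)$.) For integers $k\le l$ and $m$, the polynomial $\tilde P_{k,l,m}(a,b,c;x)$ is $$\tilde P_{k,l,m}(a,b,c;x)=\begin{cases}\sum_{n=0}^{l-1}(C_n-D_{n+k-l})x^{l-1-n} & (m\ge0,\ k+l-m\ge0),\\ \sum_{n=0}^{m-k-1}(\tilde C_n-\tilde D_{n+k-l})x^{m-k-1-n} & (m\ge0,\ k+l-m<0),\\ \sum_{n=0}^{l-m-1}(C_n-D_{n+k-l})x^{l-m-1-n}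 & (m<0,\ k+l-m\ge0),\\ \sum_{n=0}^{-k-1}(\tilde C_n-\tilde D_{n+k-l})x^{-k-1-n} & (m<0,\ k+l-m<0),\end{cases}$$ where $D_n=\tilde D_n=0$ for $n<0$, and for $n\ge0$ (all depending on $k,l,m,a,b,c,q$) $$C_n=\mu_1\frac{(b)_n(bq/c)_n}{(q)_n(bq/a)_n}\left(\frac{cq}{ab}\right)^n{}_4\phi_3\!\left(q^{-n},aq^{-n}/b,q^{1-l}/b,cq^{m-l}/b;\,aq^{k-l+1}/b,q^{1-n}/b,cq^{-n}/b;\,q,q\right),$$ $$D_n=\mu_2\frac{(q^{1-k}/a)_n(cq^{m-k}/a)_n}{(q)_n(bq^{l-k+1}/a)_n}q^n\,{}_4\phi_3\!\left(q^{-n},aq^{k-l-n}/b,a,aq/c;\,aq/b,aq^{k-n},aq^{k-m-n+1}/c;\,q,q^{k+l-m+1}\right),$$ $$\tilde C_n=\mu_1\frac{(aq^k)_n(aq^{k-m+1}/c)_n}{(q)_n(aq^{k-l+1}/b)_n}\left(\frac{cq^{m-k-l+1}}{ab}\right)^n{}_4\phi_3\!\left(q^{-n},bq^{l-k-n}/a,q/a,c/a;\,bq/a,q^{1-k-n}/a,cq^{m-k-n}/a;\,q,q\right),$$ $$\tilde D_n=\mu_2\frac{(q/b)_n(c/b)_n}{(q)_n(aq/b)_n}q^n\,{}_4\phi_3\!\left(q^{-n},bq^{-n}/a,bq^l,bq^{l-m+1}/c;\,bq^{l-k+1}/a,bq^{-n},bq^{1-n}/c;\,q,q^{m-k-l+1}\right),$$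 with $$\mu_1=a^{m-k-l}\left(\frac{c}{ab}\right)^kq^{k(m-k-l+1)}\frac{(a)_k(aq/c)_{k-m}}{(aq/b)_{k-l}},\qquad \mu_2=b^{m-k-l}\left(\frac{c}{ab}\right)^lq^{l(m-k-l+1)}\frac{(b)_l(bq/c)_{l-m}}{(bq/a)_{l-k}}.$$ An empty sum is $0$. $\tilde P_{k-1,l-1,m-1}(aq,bq,cq;x)$ means: replace $(k,l,m)$ by $(k-1,l-1,m-1)$ and $(a,b,c)$ by $(aq,bq,cq)$ throughout (including in the case distinction). *)

theory Defs
  imports "HOL-Analysis.Analysis" "HOL-Computational_Algebra.Polynomial"
    "HOL-Computational_Algebra.Fraction_Field"
begin

section \<open>Basic hypergeometric series\<close>

definition qpoch :: "complex \<Rightarrow> complex \<Rightarrow> int \<Rightarrow> complex" where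
  "qpoch q u n =
     (if n \<ge> 0 then \<Prod>j=0..<nat n. 1 - u * q ^ j
      else \<Prod>j=1..nat (- n). inverse (1 - u * q powi (- int j)))"

definition phi21 :: "complex \<Rightarrow> complex \<Rightarrow> complex \<Rightarrow> complex \<Rightarrow> complex \<Rightarrow> complex" where
  "phi21 a b c q x =
     (\<Sum>n. qpoch q a (int n) * qpoch q b (int n) /
           (qpoch q q (int n) * qpoch q c (int n)) * x ^ n)"

definition phi43 :: "complex \<Rightarrow> complex \<Rightarrow> complex \<Rightarrow> complex \<Rightarrow>
    complex \<Rightarrow> complex \<Rightarrow> complex \<Rightarrow> complex \<Rightarrow> complex \<Rightarrow> complex" where
  "phi43 a0 a1 a2 a3 b1 b2 b3 q z =
     (\<Sum>i. qpoch q a0 (int i) * qpoch q a1 (int i) * qpoch q a2 (int i) * qpoch q a3 (int i) /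
           (qpoch q q (int i) * qpoch q b1 (int i) * qpoch q b2 (int i) * qpoch q b3 (int i)) * z ^ i)"

definition qpowers :: "complex \<Rightarrow> complex set" where
  "qpowers q = range (\<lambda>n::int. q powi n)"

definition admissible :: "complex \<Rightarrow> complex \<Rightarrow> complex \<Rightarrow> complex \<Rightarrow> bool" where
  "admissible a b c q \<longleftrightarrow>
     0 < norm q \<and> norm q < 1 \<and> a \<noteq> 0 \<and> b \<noteq> 0 \<and> c \<noteq> 0 \<and>
     c \<notin> qpowers q \<and> a / b \<notin> qpowers q \<and>
     a \<notin> qpowers q \<and> b \<notin> qpowers q \<and> c / a \<notin> qpowers q \<and> c / b \<notin> qpowers q"

section \<open>Rational functions of a, b, c, q, x over the rationals\<close>

text \<open>The innermost polynomial variable is \<open>a\<close>, followed by \<open>b\<close>, \<open>c\<close>, \<open>q\<close>, and \<open>x\<close> outermost.\<close>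

type_synonym poly5 = "rat poly poly poly poly poly"
type_synonym ratfun = "poly5 fract"

definition eval5 ::
  "poly5 \<Rightarrow> complex \<Rightarrow> complex \<Rightarrow> complex \<Rightarrow> complex \<Rightarrow> complex \<Rightarrow> complex" where
  "eval5 p a b c q x =
     poly (map_poly (\<lambda>p4.
       poly (map_poly (\<lambda>p3.
         poly (map_poly (\<lambda>p2.
           poly (map_poly (\<lambda>p1.
             poly (map_poly of_rat p1) a) p2) b) p3) c) p4) q) p) x"

text \<open>\<open>has_value f a b c q x v\<close>: the rational function \<open>f\<close> is defined at the point, i.e.\ some
  representation of \<open>f\<close> as a quotient has a denominator that does not vanish there, and its value
  is \<open>v\<close>. The value does not depend on the representation.\<close>

definition has_value ::
  "ratfun \<Rightarrow> complex \<Rightarrow> complex \<Rightarrow> complex \<Rightarrow> complex \<Rightarrow> complex \<Rightarrow> complex \<Rightarrow> bool" where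
  "has_value f a b c q x v \<longleftrightarrow>
     (\<exists>n d. f = Fract n d \<and> eval5 d a b c q x \<noteq> 0 \<and> v = eval5 n a b c q x / eval5 d a b c q x)"

section \<open>The three term relation\<close>

definition three_term :: "int \<Rightarrow> int \<Rightarrow> int \<Rightarrow> ratfun \<Rightarrow> ratfun \<Rightarrow> bool" where
  "three_term k l m Q R \<longleftrightarrow>
     (\<forall>a b c q x u v. admissible a b c q \<longrightarrow> norm x < 1 \<longrightarrow>
        has_value Q a b c q x u \<longrightarrow> has_value R a b c q x v \<longrightarrow>
        phi21 (a * q powi k) (b * q powi l) (c * q powi m) q x =
          u * phi21 (a * q) (b * q) (c * q) q x + v * phi21 a b c q x)"

section \<open>The explicit coefficients\<close>

definition mu1 :: "int \<Rightarrow> int \<Rightarrow> int \<Rightarrow> complex \<Rightarrow> complex \<Rightarrow> complex \<Rightarrow> complex \<Rightarrow> complex" where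
  "mu1 k l m a b c q =
     a powi (m - k - l) * (c / (a * b)) powi k * q powi (k * (m - k - l + 1)) *
     (qpoch q a k * qpoch q (a * q / c) (k - m) / qpoch q (a * q / b) (k - l))"

definition mu2 :: "int \<Rightarrow> int \<Rightarrow> int \<Rightarrow> complex \<Rightarrow> complex \<Rightarrow> complex \<Rightarrow> complex \<Rightarrow> complex" where
  "mu2 k l m a b c q =
     b powi (m - k - l) * (c / (a * b)) powi l * q powi (l * (m - k - l + 1)) *
     (qpoch q b l * qpoch q (b * q / c) (l - m) / qpoch q (b * q / a) (l - k))"

definition C_coeff :: "int \<Rightarrow> int \<Rightarrow> int \<Rightarrow> complex \<Rightarrow> complex \<Rightarrow> complex \<Rightarrow> complex \<Rightarrow> int \<Rightarrow> complex" where
  "C_coeff k l m a b c q n =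
     mu1 k l m a b c q *
     (qpoch q b n * qpoch q (b * q / c) n / (qpoch q q n * qpoch q (b * q / a) n)) *
     (c * q / (a * b)) powi n *
     phi43 (q powi (- n)) (a * q powi (- n) / b) (q powi (1 - l) / b) (c * q powi (m - l) / b)
           (a * q powi (k - l + 1) / b) (q powi (1 - n) / b) (c * q powi (- n) / b) q q"

definition D_coeff :: "int \<Rightarrow> int \<Rightarrow> int \<Rightarrow> complex \<Rightarrow> complex \<Rightarrow> complex \<Rightarrow> complex \<Rightarrow> int \<Rightarrow> complex" where
  "D_coeff k l m a b c q n =
     (if n < 0 then 0 else
       mu2 k l m a b c q *
       (qpoch q (q powi (1 - k) / a) n * qpoch q (c * q powi (m - k) / a) n /
         (qpoch q q n * qpoch q (b * q powi (l - k + 1) / a) n)) *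
       q powi n *
       phi43 (q powi (- n)) (a * q powi (k - l - n) / b) a (a * q / c)
             (a * q / b) (a * q powi (k - n)) (a * q powi (k - m - n + 1) / c)
             q (q powi (k + l - m + 1)))"

definition C'_coeff :: "int \<Rightarrow> int \<Rightarrow> int \<Rightarrow> complex \<Rightarrow> complex \<Rightarrow> complex \<Rightarrow> complex \<Rightarrow> int \<Rightarrow> complex" where
  "C'_coeff k l m a b c q n =
     mu1 k l m a b c q *
     (qpoch q (a * q powi k) n * qpoch q (a * q powi (k - m + 1) / c) n /
       (qpoch q q n * qpoch q (a * q powi (k - l + 1) / b) n)) *
     (c * q powi (m - k - l + 1) / (a * b)) powi n *
     phi43 (q powi (- n)) (b * q powi (l - k - n) / a) (q / a) (c / a)
           (b * q / a) (q powi (1 - k - n) / a) (c * q powi (m - k - n) / a) q q"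

definition D'_coeff :: "int \<Rightarrow> int \<Rightarrow> int \<Rightarrow> complex \<Rightarrow> complex \<Rightarrow> complex \<Rightarrow> complex \<Rightarrow> int \<Rightarrow> complex" where
  "D'_coeff k l m a b c q n =
     (if n < 0 then 0 else
       mu2 k l m a b c q *
       (qpoch q (q / b) n * qpoch q (c / b) n / (qpoch q q n * qpoch q (a * q / b) n)) *
       q powi n *
       phi43 (q powi (- n)) (b * q powi (- n) / a) (b * q powi l) (b * q powi (l - m + 1) / c)
             (b * q powi (l - k + 1) / a) (b * q powi (- n)) (b * q powi (1 - n) / c)
             q (q powi (m - k - l + 1)))"

definition P_poly :: "int \<Rightarrow> int \<Rightarrow> int \<Rightarrow> complex \<Rightarrow> complex \<Rightarrow> complex \<Rightarrow> complex \<Rightarrow> complex \<Rightarrow> complex" where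
  "P_poly k l m a b c q x =
     (if m \<ge> 0 \<and> k + l - m \<ge> 0 then
        \<Sum>n\<in>{0..l - 1}.
          (C_coeff k l m a b c q n - D_coeff k l m a b c q (n + k - l)) * x ^ nat (l - 1 - n)
      else if m \<ge> 0 \<and> k + l - m < 0 then
        \<Sum>n\<in>{0..m - k - 1}.
          (C'_coeff k l m a b c q n - D'_coeff k l m a b c q (n + k - l)) * x ^ nat (m - k - 1 - n)
      else if m < 0 \<and> k + l - m \<ge> 0 then
        \<Sum>n\<in>{0..l - m - 1}.
          (C_coeff k l m a b c q n - D_coeff k l m a b c q (n + k - l)) * x ^ nat (l - m - 1 - n)
      else
        \<Sum>n\<in>{0..- k - 1}.
          (C'_coeff k l m a b c q n - D'_coeff k l m a b c q (n + k - l)) * x ^ nat (- k - 1 - n))"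

text \<open>The exponents divided by 2 in \<open>lambda_Q\<close> and \<open>lambda_R\<close> are sums of products of consecutive
  integers, so the integer division is exact.\<close>

definition lambda_Q :: "int \<Rightarrow> int \<Rightarrow> int \<Rightarrow> complex \<Rightarrow> complex \<Rightarrow> complex \<Rightarrow> complex \<Rightarrow> complex" where
  "lambda_Q k l m a b c q =
     (let M = max (k + l - m) 0 in
       (- 1) powi (k + l - m - 1 + M) *
       q powi ((k * (k - 1) + l * (l - 1) - m * (m - 1) + M * (M - 1)) div 2) *
       ((q - c) * a powi k * b powi l / ((b - a) * c powi m)) *
       (a * b / c) powi M *
       (qpoch q c m / (qpoch q a k * qpoch q b l)))"

definition lambda_R :: "int \<Rightarrow> int \<Rightarrow> int \<Rightarrow> complex \<Rightarrow> complex \<Rightarrow> complex \<Rightarrow> complex \<Rightarrow> complex" where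
  "lambda_R k l m a b c q =
     (let M' = max (k + l - m - 1) 0 in
       (- 1) powi (k + l - m + M') *
       q powi ((k * (k - 1) + l * (l - 1) - m * (m - 1) + M' * (M' + 1)) div 2) *
       (a powi k * b powi l / ((b - a) * c powi m)) *
       (a * b / c) powi (M' - 1) *
       (qpoch q c m / (qpoch q (a * q) (k - 1) * qpoch q (b * q) (l - 1))))"

definition Q_expr :: "int \<Rightarrow> int \<Rightarrow> int \<Rightarrow> complex \<Rightarrow> complex \<Rightarrow> complex \<Rightarrow> complex \<Rightarrow> complex \<Rightarrow> complex" where
  "Q_expr k l m a b c q x =
     - lambda_Q k l m a b c q * ((1 - a) * (1 - b) * c / ((q - c) * (1 - c))) *
     (x powi (1 - max m 0) / qpoch q (a * b * q * x / c) (max (k + l - m) 0 - 1)) *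
     P_poly k l m a b c q x"

definition R_expr :: "int \<Rightarrow> int \<Rightarrow> int \<Rightarrow> complex \<Rightarrow> complex \<Rightarrow> complex \<Rightarrow> complex \<Rightarrow> complex \<Rightarrow> complex" where
  "R_expr k l m a b c q x =
     - lambda_R k l m a b c q *
     (x powi (- max (m - 1) 0) / qpoch q (a * b * q * x / c) (max (k + l - m - 1) 0)) *
     P_poly (k - 1) (l - 1) (m - 1) (a * q) (b * q) (c * q) q x"

text \<open>For admissible parameters the only denominators in \<open>Q_expr\<close> and \<open>R_expr\<close> that can vanish are
  the power of \<open>x\<close> (whose exponent is negative exactly if \<open>m > 1\<close>) and the shifted factorial of
  \<open>abqx/c\<close>. As inversion is total, a shifted factorial with negative index that has a zero
  denominator is \<open>0\<close> and hence excluded as well.\<close>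

definition Q_expr_defined ::
  "int \<Rightarrow> int \<Rightarrow> int \<Rightarrow> complex \<Rightarrow> complex \<Rightarrow> complex \<Rightarrow> complex \<Rightarrow> complex \<Rightarrow> bool" where
  "Q_expr_defined k l m a b c q x \<longleftrightarrow>
     (x \<noteq> 0 \<or> m \<le> 1) \<and> qpoch q (a * b * q * x / c) (max (k + l - m) 0 - 1) \<noteq> 0"

definition R_expr_defined ::
  "int \<Rightarrow> int \<Rightarrow> int \<Rightarrow> complex \<Rightarrow> complex \<Rightarrow> complex \<Rightarrow> complex \<Rightarrow> complex \<Rightarrow> bool" where
  "R_expr_defined k l m a b c q x \<longleftrightarrow>
     (x \<noteq> 0 \<or> m \<le> 1) \<and> qpoch q (a * b * q * x / c) (max (k + l - m - 1) 0) \<noteq> 0"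

end

theory Submission
  imports Defs "HOL-Computational_Algebra.Formal_Laurent_Series"
    "HOL-Computational_Algebra.Field_as_Ring" "HOL-Computational_Algebra.Polynomial_Factorial"
begin

text \<open>Normalised by \<open>G k l m = (a)\<^sub>k (b)\<^sub>l / (c)\<^sub>m \<phi>(aq\<^sup>k, bq\<^sup>l; cq\<^sup>m; x)\<close>, Heine's series satisfy
  relations of first order between neighbours in the lattice of shifts (\<open>contiguous\<close>). The same
  relations hold for the two formal solutions at infinity, which are series in \<open>1/x\<close>. Walking through
  the lattice, \<open>G k l m = A G 1 1 1 + B G 0 0 0\<close> with coefficients that do not depend on the solution
  \<open>G\<close>, and each step controls the denominator of \<open>A\<close>: it is a polynomial in \<open>x\<close> times
  \<open>x\<^bsup>1 - max m 0\<^esup> / (abqx/c)\<^bsub>max s 0 - 1\<^esub>\<close>, where \<open>s = k + l - m\<close> (\<open>reducible_all\<close>).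

  This polynomial can be read off from the solutions \<open>G\<close>, \<open>H\<close> at infinity: eliminating \<open>B\<close> gives
  \<open>A (G 1 1 1 H 0 0 0 - H 1 1 1 G 0 0 0) = G k l m H 0 0 0 - H k l m G 0 0 0\<close>.
  The first bracket satisfies a \<open>q\<close>-difference equation of order one and is an explicit product
  (\<open>casoratian\<close>). On the right, Euler's transformation \<open>euler_transformation\<close> applied to one factor of
  each product extracts the same kind of product, common to both terms. What is left are products of
  two series of type \<open>\<^sub>2\<phi>\<^sub>1\<close>, with coefficients that are terminating \<open>\<^sub>4\<phi>\<^sub>3\<close> (\<open>hyp_mult_nth\<close>): these are
  \<open>C\<^sub>n\<close>, \<open>D\<^sub>n\<close> if \<open>s \<ge> 0\<close> and \<open>C'\<^sub>n\<close>, \<open>D'\<^sub>n\<close> if \<open>s < 0\<close>. Thus \<open>A\<close> is the prefactor times an infinite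
  series in \<open>1/x\<close>, but it is also the prefactor times a polynomial in \<open>x\<close>; so the terms with negative
  powers of \<open>x\<close> vanish, and the series is the sum that defines \<open>P_poly\<close> (\<open>coefficient_polynomial\<close>).

  For \<open>B\<close>, the parameters \<open>aq, bq, cq\<close> with the shifts \<open>k - 1, l - 1, m - 1\<close> describe the same function
  in terms of \<open>G 2 2 2\<close> and \<open>G 1 1 1\<close>; the explicit relation between \<open>G 2 2 2\<close>, \<open>G 1 1 1\<close> and \<open>G 0 0 0\<close>
  turns the coefficient of \<open>G 2 2 2\<close> into \<open>B\<close> (\<open>second_coefficient\<close>).

  The coefficients are unique because \<open>\<phi>(x)/\<phi>(qx)\<close> is not a rational function of \<open>x\<close>: it would be a
  rational solution of a Riccati equation that has none for admissible parameters
  (\<open>phi21_independent\<close>), and a polynomial in the parameters that vanishes at all admissible ones is \<open>0\<close>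
  (\<open>eval5_nonzero_somewhere\<close>). The identity at all points at which the coefficients have values follows by
  continuity in \<open>x\<close> from those \<open>x\<close> at which no denominator vanishes.\<close>

section \<open>Integer shifted factorials\<close>

definition unit_disc :: "complex \<Rightarrow> bool" where
  "unit_disc q \<longleftrightarrow> 0 < norm q \<and> norm q < 1"

lemma unit_disc_nonzero: "unit_disc q \<Longrightarrow> q \<noteq> 0"
  by (auto simp: unit_disc_def)

lemma qpowersI: "q powi n \<in> qpowers q"
  by (simp add: qpowers_def)

lemma one_in_qpowers: "1 \<in> qpowers q"
  using qpowersI[of q 0] by simp

lemma qpowers_mult_powi_iff:
  assumes "q \<noteq> 0"
  shows "u * q powi n \<in> qpowers q \<longleftrightarrow> u \<in> qpowers q"
proof
  assume "u * q powi n \<in> qpowers q"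
  then obtain j where "u * q powi n = q powi j" by (auto simp: qpowers_def)
  hence "u = q powi (j - n)"
    using assms by (simp add: power_int_diff field_simps)
  thus "u \<in> qpowers q" by (simp add: qpowersI)
next
  assume "u \<in> qpowers q"
  then obtain j where "u = q powi j" by (auto simp: qpowers_def)
  hence "u * q powi n = q powi (j + n)"
    using assms by (simp add: power_int_add)
  thus "u * q powi n \<in> qpowers q" by (simp add: qpowersI)
qed

lemma qpowers_inverse_iff:
  assumes "q \<noteq> 0"
  shows "inverse u \<in> qpowers q \<longleftrightarrow> u \<in> qpowers q"
proof -
  have *: "inverse v \<in> qpowers q" if "v \<in> qpowers q" for v
  proof -
    from that obtain j where "v = q powi j" by (auto simp: qpowers_def)
    hence "inverse v = q powi (- j)" by (simp add: power_int_minus)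
    thus ?thesis by (simp add: qpowersI)
  qed
  show ?thesis using *[of u] *[of "inverse u"] by auto
qed

lemma qpoch_0 [simp]: "qpoch q u 0 = 1"
  by (simp add: qpoch_def)

lemma qpoch_nat: "qpoch q u (int n) = (\<Prod>j<n. 1 - u * q ^ j)"
  by (simp add: qpoch_def atLeast0LessThan)

lemma qpoch_nat_Suc: "qpoch q u (int (Suc n)) = qpoch q u (int n) * (1 - u * q ^ n)"
  by (simp only: qpoch_nat prod.lessThan_Suc)

lemma qpoch_neg: "qpoch q u (- int n) = (\<Prod>j=1..n. inverse (1 - u * q powi (- int j)))"
  by (cases "n = 0") (auto simp: qpoch_def)

lemma qpoch_plus1:
  assumes "n \<ge> 0 \<or> 1 - u * q powi n \<noteq> 0"
  shows "qpoch q u (n + 1) = qpoch q u n * (1 - u * q powi n)"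
proof (cases "n \<ge> 0")
  case True
  then obtain m where n: "n = int m" using nonneg_eq_int by blast
  have "qpoch q u (n + 1) = qpoch q u (int (Suc m))" by (simp add: n add.commute)
  also have "\<dots> = qpoch q u n * (1 - u * q powi n)"
    by (simp only: qpoch_nat_Suc n power_int_of_nat)
  finally show ?thesis .
next
  case False
  define m where "m = nat (- n - 1)"
  have n: "n = - int (Suc m)" using False by (simp add: m_def)
  have nz: "1 - u * q powi (- int (Suc m)) \<noteq> 0"
    using assms False unfolding n by (auto simp del: of_nat_Suc)
  have "qpoch q u n = (\<Prod>j=1..Suc m. inverse (1 - u * q powi (- int j)))"
    unfolding n by (rule qpoch_neg)
  also have "\<dots> = (\<Prod>j=1..m. inverse (1 - u * q powi (- int j))) *
                   inverse (1 - u * q powi (- int (Suc m)))"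
    by (rule prod.cl_ivl_Suc[THEN trans]) (simp add: mult.commute)
  also have "(\<Prod>j=1..m. inverse (1 - u * q powi (- int j))) = qpoch q u (n + 1)"
    using qpoch_neg[of q u m] by (simp add: n)
  finally show ?thesis using nz unfolding n by (simp add: field_simps del: of_nat_Suc)
qed

lemma one_minus_qpow_nonzero:
  assumes "q \<noteq> 0" "u \<notin> qpowers q"
  shows "1 - u * q powi n \<noteq> 0"
proof
  assume "1 - u * q powi n = 0"
  hence "u = q powi (- n)" using assms(1) by (simp add: power_int_minus field_simps)
  with assms(2) show False by (simp add: qpowersI)
qed

lemma qpoch_nonzero:
  assumes "q \<noteq> 0" "u \<notin> qpowers q"
  shows "qpoch q u n \<noteq> 0"
proof -
  have "1 - u * q ^ j \<noteq> 0" "1 - u * q powi (- int j) \<noteq> 0" for j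
    using one_minus_qpow_nonzero[OF assms, of "int j"] one_minus_qpow_nonzero[OF assms, of "- int j"]
    by auto
  thus ?thesis by (auto simp: qpoch_def)
qed

lemma qpoch_rec:
  assumes "q \<noteq> 0" "u \<notin> qpowers q"
  shows "qpoch q u (n + 1) = qpoch q u n * (1 - u * q powi n)"
  by (rule qpoch_plus1) (use one_minus_qpow_nonzero[OF assms] in blast)

lemma qpoch_rec_minus:
  assumes "q \<noteq> 0" "u \<notin> qpowers q"
  shows "qpoch q u (n - 1) = qpoch q u n / (1 - u * q powi (n - 1))"
  using qpoch_rec[OF assms, of "n - 1"] one_minus_qpow_nonzero[OF assms, of "n - 1"]
  by (simp add: field_simps)

lemma qpoch_add:
  assumes "q \<noteq> 0" "u \<notin> qpowers q"
  shows "qpoch q u (m + n) = qpoch q u m * qpoch q (u * q powi m) n"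
proof -
  have u': "u * q powi m \<notin> qpowers q"
    using assms by (simp add: qpowers_mult_powi_iff)
  have eq: "u * q powi m * q powi n = u * q powi (m + n)" for n
    using assms(1) by (simp add: power_int_add)
  show ?thesis
  proof (induction n rule: int_induct[where k = 0])
    case base
    show ?case by simp
  next
    case (step1 n)
    have "qpoch q u (m + (n + 1)) = qpoch q u (m + n) * (1 - u * q powi (m + n))"
      using qpoch_rec[OF assms, of "m + n"] by (simp add: add.assoc)
    thus ?case
      using step1 qpoch_rec[OF assms(1) u', of n] by (simp add: eq)
  next
    case (step2 n)
    have "qpoch q u (m + (n - 1)) = qpoch q u (m + n) / (1 - u * q powi (m + (n - 1)))"
      using qpoch_rec_minus[OF assms, of "m + n"] by (simp add: algebra_simps)
    thus ?case
      using step2 qpoch_rec_minus[OF assms(1) u', of n] by (simp add: eq)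
  qed
qed

text \<open>For nonnegative indices no factor is inverted, so \<open>u\<close> may be a power of \<open>q\<close>.\<close>

lemma qpoch_add_nonneg:
  assumes "q \<noteq> 0" "m \<ge> 0" "n \<ge> 0"
  shows "qpoch q u (m + n) = qpoch q u m * qpoch q (u * q powi m) n"
proof -
  obtain i where m: "m = int i" using assms(2) nonneg_eq_int by blast
  obtain j where n: "n = int j" using assms(3) nonneg_eq_int by blast
  have "qpoch q u (int (i + j)) = qpoch q u (int i) * qpoch q (u * q ^ i) (int j)"
  proof (induction j)
    case (Suc j)
    have "qpoch q u (int (i + Suc j)) = qpoch q u (int (i + j)) * (1 - u * q ^ (i + j))"
      using qpoch_nat_Suc[of q u "i + j"] by simp
    also have "\<dots> = qpoch q u (int i) * qpoch q (u * q ^ i) (int (Suc j))"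
      unfolding Suc.IH qpoch_nat_Suc by (simp add: power_add mult.assoc)
    finally show ?case .
  qed simp
  thus ?thesis by (simp add: m n)
qed

lemma q_pow_neq_1:
  assumes "unit_disc q" "n \<noteq> 0"
  shows "q powi n \<noteq> 1"
proof
  assume eq: "q powi n = 1"
  have q: "0 < norm q" "norm q < 1" using assms(1) by (auto simp: unit_disc_def)
  have "norm q ^ nat \<bar>n\<bar> < 1"
    using q assms(2) by (auto simp: power_less_one_iff)
  moreover have "norm (q powi n) = 1" using eq by simp
  hence "norm q ^ nat \<bar>n\<bar> = 1"
    by (cases "n \<ge> 0") (auto simp: power_int_def norm_power norm_inverse abs_if power_inverse)
  ultimately show False by simp
qed

lemma qpoch_q_nonzero:
  assumes "unit_disc q"
  shows "qpoch q q (int n) \<noteq> 0"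
proof -
  have "1 - q * q ^ j \<noteq> 0" for j
    using q_pow_neq_1[OF assms, of "int (Suc j)"] by (auto simp del: of_nat_Suc)
  thus ?thesis by (simp add: qpoch_nat)
qed

text \<open>The convention \<open>inverse 0 = 0\<close> makes \<open>1 / (q)\<^sub>n\<close> vanish for \<open>n < 0\<close>; hence series can be summed
  over all integers, and this recurrence needs no case distinction.\<close>

lemma inverse_qpoch_q_rec:
  assumes "unit_disc q"
  shows "inverse (qpoch q q (n - 1)) = inverse (qpoch q q n) * (1 - q powi n)"
proof -
  have q: "q \<noteq> 0" using assms by (rule unit_disc_nonzero)
  have qq: "q * q powi (n - 1) = q powi n" for n
    using q by (simp add: power_int_diff)
  show ?thesis
  proof (cases "n = 0")
    case True
    have "qpoch q q (- int 1) = 0"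
      using q by (simp only: qpoch_neg) (simp add: power_int_minus)
    thus ?thesis using True by simp
  next
    case False
    hence nz: "1 - q * q powi (n - 1) \<noteq> 0"
      unfolding qq using q_pow_neq_1[OF assms False] by simp
    have "qpoch q q n = qpoch q q (n - 1) * (1 - q powi n)"
      using qpoch_plus1[of "n - 1" q q] nz by (simp add: qq)
    thus ?thesis using nz by (simp add: qq)
  qed
qed

lemma inverse_qpoch_q_neg:
  assumes "unit_disc q" "n < 0"
  shows "inverse (qpoch q q n) = 0"
proof -
  have "inverse (qpoch q q (- int (Suc m))) = 0" for m
  proof (induction m)
    case 0
    show ?case using inverse_qpoch_q_rec[OF assms(1), of 0] by simp
  next
    case (Suc m)
    show ?case using inverse_qpoch_q_rec[OF assms(1), of "- int (Suc m)"] Suc.IH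
      by (simp add: algebra_simps)
  qed
  from this[of "nat (- n - 1)"] assms(2) show ?thesis by simp
qed

unbundle fps_syntax

section \<open>Contiguous families\<close>

lemma fls_const_add: "fls_const (x + y) = fls_const x + fls_const y"
  by (simp add: fls_plus_const)

lemma fls_const_diff: "fls_const (x - y) = fls_const x - fls_const y"
  by (simp add: fls_minus_const)

lemma fls_const_mult: "fls_const (x * y) = fls_const x * fls_const (y :: 'a :: field)"
  by simp

lemma fls_const_divide: "fls_const (x / y) = fls_const x / fls_const (y :: 'a :: field)"
  by (simp add: divide_inverse fls_inverse_const)

lemmas fls_const_hom = fls_const_add fls_const_diff fls_const_mult fls_const_divide fls_const_uminus

text \<open>The relations are stated for Laurent series so that they cover two situations at once: the value at
  a complex number \<open>x\<close>, embedded by \<open>fls_const\<close> (then \<open>X = fls_const x\<close>), and formal series in \<open>z = 1/x\<close>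
  (then \<open>X = fls_X_inv\<close>). For a series in \<open>x\<close> they hold coefficientwise because \<open>1 - aq\<^sup>k Y\<close>, \<open>1 - bq\<^sup>l Y\<close>,
  \<open>1 - cq\<^sup>m Y\<close> and \<open>1 - Y\<close> are linear functions of the same \<open>Y = q\<^sup>n\<close>, where \<open>1 - Y\<close> stems from the shift of all
  three parameters.\<close>

definition contiguous ::
  "complex \<Rightarrow> complex \<Rightarrow> complex \<Rightarrow> complex \<Rightarrow> complex fls \<Rightarrow> (int \<Rightarrow> int \<Rightarrow> int \<Rightarrow> complex fls) \<Rightarrow> bool" where
  "contiguous a b c q X G \<longleftrightarrow> (\<forall>k l m.
     G (k + 1) l m = fls_const (1 - a * q powi k) * G k l m
                     + fls_const (a * q powi k) * X * G (k + 1) (l + 1) (m + 1) \<and>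
     G k (l + 1) m = fls_const (1 - b * q powi l) * G k l m
                     + fls_const (b * q powi l) * X * G (k + 1) (l + 1) (m + 1) \<and>
     fls_const (c * q powi m) * G (k + 1) l (m + 1) = fls_const (a * q powi k) * G k l m
                     + fls_const (c * q powi m - a * q powi k) * G k l (m + 1) \<and>
     fls_const (c * q powi m) * G k (l + 1) (m + 1) = fls_const (b * q powi l) * G k l m
                     + fls_const (c * q powi m - b * q powi l) * G k l (m + 1))"

lemma contiguousD:
  assumes "contiguous a b c q X G"
  shows "G (k + 1) l m = fls_const (1 - a * q powi k) * G k l m
                     + fls_const (a * q powi k) * X * G (k + 1) (l + 1) (m + 1)"
    and "G k (l + 1) m = fls_const (1 - b * q powi l) * G k l m
                     + fls_const (b * q powi l) * X * G (k + 1) (l + 1) (m + 1)"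
    and "fls_const (c * q powi m) * G (k + 1) l (m + 1) = fls_const (a * q powi k) * G k l m
                     + fls_const (c * q powi m - a * q powi k) * G k l (m + 1)"
    and "fls_const (c * q powi m) * G k (l + 1) (m + 1) = fls_const (b * q powi l) * G k l m
                     + fls_const (c * q powi m - b * q powi l) * G k l (m + 1)"
  using assms unfolding contiguous_def by blast+

lemma contiguous_swap:
  "contiguous a b c q X G \<Longrightarrow> contiguous b a c q X (\<lambda>k l m. G l k m)"
  unfolding contiguous_def by blast

text \<open>Eliminating the diagonal neighbour from the first and the fourth relation produces the factor
  \<open>1 - (ab/c) q\<^sup>s X\<close> with \<open>s = k + l - m\<close>. Dividing by it is the only source of denominators other
  than powers of \<open>X\<close>.\<close>

lemma contiguous_raise:
  assumes G: "contiguous a b c q X G" and q: "q \<noteq> 0" and c: "c \<noteq> 0"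
  shows "fls_const (1 - a * q powi k) * G k l m
         - (1 - fls_const (a * b / c * q powi (k + l - m)) * X) * G (k + 1) l m
       = fls_const (a * q powi k * (b * q powi l / (c * q powi m) - 1)) * X * G (k + 1) l (m + 1)"
proof -
  define A B C where "A = fls_const (a * q powi k)" and "B = fls_const (b * q powi l)"
    and "C = fls_const (c * q powi m)"
  have C: "C \<noteq> 0" using q c by (simp add: C_def)
  have s: "fls_const (a * b / c * q powi (k + l - m)) = A * B / C"
    using q c by (simp add: A_def B_def C_def fls_const_hom [symmetric] power_int_diff power_int_add field_simps
      del: fls_const_mult_const)
  have t: "fls_const (a * q powi k * (b * q powi l / (c * q powi m) - 1)) = A * (B / C - 1)"
    by (simp add: A_def B_def C_def fls_const_hom del: fls_const_mult_const)
  have 1: "G (k + 1) l m = (1 - A) * G k l m + A * X * G (k + 1) (l + 1) (m + 1)"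
    using contiguousD(1)[OF G, of k l m] by (simp only: fls_const_diff A_def fls_const_1)
  have 2: "C * G (k + 1) (l + 1) (m + 1) = B * G (k + 1) l m + (C - B) * G (k + 1) l (m + 1)"
    using contiguousD(4)[OF G, of m "k + 1" l] by (simp only: fls_const_diff B_def C_def)
  have "C * ((1 - A) * G k l m - (1 - A * B / C * X) * G (k + 1) l m - A * (B / C - 1) * X * G (k + 1) l (m + 1))
      = C * ((1 - A) * G k l m - G (k + 1) l m) + A * X * (B * G (k + 1) l m + (C - B) * G (k + 1) l (m + 1))"
    using C by (simp add: field_simps)
  also have "\<dots> = C * ((1 - A) * G k l m + A * X * G (k + 1) (l + 1) (m + 1) - G (k + 1) l m)"
    unfolding 2 [symmetric] by (simp add: algebra_simps)
  also have "\<dots> = 0" using 1 by simp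
  finally show ?thesis unfolding s t fls_const_diff fls_const_1 A_def [symmetric] using C by simp
qed

section \<open>Rational functions of the argument\<close>

definition ev :: "complex poly \<Rightarrow> complex fls \<Rightarrow> complex fls" where
  "ev r X = poly (map_poly fls_const r) X"

lemma ev_0 [simp]: "ev 0 X = 0" and ev_pCons [simp]: "ev (pCons t r) X = fls_const t + X * ev r X"
  and ev_1 [simp]: "ev 1 X = 1"
  by (simp_all add: ev_def map_poly_pCons one_pCons)

lemma ev_add [simp]: "ev (r + s) X = ev r X + ev s X"
  by (induction r s rule: poly_induct2) (simp_all add: fls_const_add algebra_simps)

lemma ev_smult [simp]: "ev (smult t r) X = fls_const t * ev r X"
  by (induction r) (simp_all add: algebra_simps)

lemma ev_mult [simp]: "ev (r * s) X = ev r X * ev s X"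
  by (induction r) (simp_all add: algebra_simps)

lemma ev_monom [simp]: "ev (monom t n) X = fls_const t * X ^ n"
  by (induction n) (simp_all add: monom_0 monom_Suc)

lemma ev_fls_const: "ev r (fls_const x) = fls_const (poly r x)"
  by (induction r) (simp_all add: fls_const_add)

lemma ev_fls_X_inv_nth: "ev r fls_X_inv $$ n = (if n \<le> 0 then coeff r (nat (- n)) else 0)"
proof (induction r arbitrary: n)
  case (pCons t r)
  have "nat (- n) = Suc (nat (- n - 1))" if "n < 0"
    using that by auto
  moreover have "nat (-1 - n) = nat (- n - 1)" by simp
  ultimately show ?case
    by (auto simp: pCons.IH fls_X_inv_times_conv_shift coeff_pCons split: nat.splits)
qed simp

lemma ev_fls_X_inv_inject: "ev r fls_X_inv = ev s fls_X_inv \<longleftrightarrow> r = s"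
proof
  assume eq: "ev r fls_X_inv = ev s fls_X_inv"
  have "coeff r n = coeff s n" for n
    using arg_cong[OF eq, of "\<lambda>f. f $$ (- int n)"] by (simp add: ev_fls_X_inv_nth)
  thus "r = s" by (simp add: poly_eq_iff)
qed simp

text \<open>The arguments at which a rational function with denominators \<open>X\<close> and \<open>1 - d q\<^sup>j X\<close> may be
  evaluated.\<close>

definition generic :: "complex \<Rightarrow> complex \<Rightarrow> complex fls \<Rightarrow> bool" where
  "generic d q X \<longleftrightarrow> X \<noteq> 0 \<and> (\<forall>j::int. 1 - fls_const (d * q powi j) * X \<noteq> 0)"

lemma genericD:
  assumes "generic d q X"
  shows "X \<noteq> 0" "1 - fls_const (d * q powi j) * X \<noteq> 0" "1 - fls_const (d * q ^ n) * X \<noteq> 0"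
    "1 - fls_const d * X \<noteq> 0"
  using assms unfolding generic_def
  by (blast, blast, metis power_int_of_nat, metis mult.right_neutral power_int_0_right)

lemma generic_fls_X_inv: "generic d q fls_X_inv"
proof -
  have "(1 - fls_const x * fls_X_inv :: complex fls) $$ 0 \<noteq> 0" for x
    by simp
  hence "(1 - fls_const x * fls_X_inv :: complex fls) \<noteq> 0" for x
    using fls_nonzeroI by blast
  thus ?thesis by (simp add: generic_def)
qed

lemma generic_shift:
  assumes "q \<noteq> 0" shows "generic (d * q) q X \<longleftrightarrow> generic d q X"
proof -
  have *: "d * q * q powi j = d * q powi (j + 1)" for j
    using assms by (simp add: power_int_add)
  have "(\<forall>j::int. 1 - fls_const (d * q * q powi j) * X \<noteq> 0) \<longleftrightarrow> (\<forall>j::int. 1 - fls_const (d * q powi j) * X \<noteq> 0)"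
    unfolding * by (metis diff_add_cancel)
  thus ?thesis by (simp only: generic_def)
qed

definition ratl :: "complex \<Rightarrow> complex \<Rightarrow> (complex fls \<Rightarrow> complex fls) \<Rightarrow> bool" where
  "ratl d q f \<longleftrightarrow> (\<exists>r t. \<forall>X. generic d q X \<longrightarrow> ev t X \<noteq> 0 \<and> f X = ev r X / ev t X)"

lemma ratl_cong:
  assumes "ratl d q f" "\<And>X. generic d q X \<Longrightarrow> g X = f X" shows "ratl d q g"
  using assms unfolding ratl_def by metis

lemma ratl_ev: "ratl d q (ev r)"
  unfolding ratl_def by (rule exI[of _ r], rule exI[of _ 1]) simp

lemma ratl_add [intro]:
  assumes "ratl d q f" "ratl d q g" shows "ratl d q (\<lambda>X. f X + g X)"
proof -
  from assms obtain r t r' t' where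
    *: "\<And>X. generic d q X \<Longrightarrow> ev t X \<noteq> 0 \<and> f X = ev r X / ev t X"
      "\<And>X. generic d q X \<Longrightarrow> ev t' X \<noteq> 0 \<and> g X = ev r' X / ev t' X"
    unfolding ratl_def by metis
  show ?thesis unfolding ratl_def
    by (rule exI[of _ "r * t' + r' * t"], rule exI[of _ "t * t'"]) (use * in \<open>auto simp: field_simps\<close>)
qed

lemma ratl_mult [intro]:
  assumes "ratl d q f" "ratl d q g" shows "ratl d q (\<lambda>X. f X * g X)"
proof -
  from assms obtain r t r' t' where
    *: "\<And>X. generic d q X \<Longrightarrow> ev t X \<noteq> 0 \<and> f X = ev r X / ev t X"
      "\<And>X. generic d q X \<Longrightarrow> ev t' X \<noteq> 0 \<and> g X = ev r' X / ev t' X"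
    unfolding ratl_def by metis
  show ?thesis unfolding ratl_def
    by (rule exI[of _ "r * r'"], rule exI[of _ "t * t'"]) (use * in \<open>auto simp: field_simps\<close>)
qed

lemma ratl_inverse_ev:
  assumes "\<And>X. generic d q X \<Longrightarrow> ev t X \<noteq> 0" shows "ratl d q (\<lambda>X. inverse (ev t X))"
  unfolding ratl_def by (rule exI[of _ 1], rule exI[of _ t]) (use assms in \<open>auto simp: field_simps\<close>)

lemma ratl_const [intro]: "ratl d q (\<lambda>X. fls_const t)"
  by (rule ratl_cong[OF ratl_ev[of d q "[:t:]"]]) simp

lemma ratl_inverse_X [intro]: "ratl d q inverse"
  using ratl_cong[OF ratl_inverse_ev[of d q "[:0, 1:]"], of inverse] by (simp add: genericD)

lemma ratl_factor [intro]: "ratl d q (\<lambda>X. 1 - fls_const e * X)"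
  by (rule ratl_cong[OF ratl_ev[of d q "[:1, - e:]"]]) simp

lemma ratl_inverse_factor [intro]: "ratl d q (\<lambda>X. inverse (1 - fls_const (d * q powi j) * X))"
  by (rule ratl_cong[OF ratl_inverse_ev[of d q "[:1, - (d * q powi j):]"]])
     (use genericD(2) in \<open>auto simp: mult.commute\<close>)

text \<open>The argument \<open>fls_X_inv\<close> is transcendental over the constants. Hence an identity that has been
  proved for the solutions at infinity carries over to every generic argument.\<close>

lemma ratl_eqI:
  assumes "ratl d q f" "ratl d q g" "f fls_X_inv = g fls_X_inv" "generic d q X"
  shows "f X = g X"
proof -
  from assms(1,2) obtain r t r' t' where
    *: "\<And>X. generic d q X \<Longrightarrow> ev t X \<noteq> 0 \<and> f X = ev r X / ev t X"
      "\<And>X. generic d q X \<Longrightarrow> ev t' X \<noteq> 0 \<and> g X = ev r' X / ev t' X"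
    unfolding ratl_def by metis
  have "ev (r * t') fls_X_inv = ev (r' * t) fls_X_inv"
    using *[OF generic_fls_X_inv] assms(3) by (simp add: field_simps)
  hence "r * t' = r' * t" by (simp only: ev_fls_X_inv_inject)
  hence "ev (r * t') X = ev (r' * t) X" by simp
  thus ?thesis using *[OF assms(4)] by (simp add: field_simps)
qed

text \<open>The factor \<open>1 / (abqx/c)\<^bsub>max s 0 - 1\<^esub>\<close> with \<open>d = ab/c\<close>; for \<open>s \<le> 0\<close> the index is \<open>-1\<close>, and the shifted
  factorial \<open>(dqx)\<^bsub>-1\<^esub>\<close> is \<open>1 / (1 - dx)\<close>.\<close>

definition nfac :: "complex \<Rightarrow> complex \<Rightarrow> int \<Rightarrow> complex fls \<Rightarrow> complex fls" where
  "nfac d q s X = (if s \<ge> 1 then inverse (\<Prod>j=1..<nat s. 1 - fls_const (d * q ^ j) * X)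
                   else 1 - fls_const d * X)"

lemma nfac_1: "nfac d q 1 X = 1"
  by (simp add: nfac_def)

lemma nfac_nonpos: "s \<le> 0 \<Longrightarrow> nfac d q s X = 1 - fls_const d * X"
  by (simp add: nfac_def)

lemma nfac_Suc:
  assumes "generic d q X" "s \<ge> 0"
  shows "nfac d q (s + 1) X = nfac d q s X / (1 - fls_const (d * q powi s) * X)"
proof (cases "s = 0")
  case True
  thus ?thesis using genericD(4)[OF assms(1)] by (simp add: nfac_def)
next
  case False
  define n where "n = nat s"
  have s: "s = int n" "n \<ge> 1" using assms False by (auto simp: n_def)
  have "nat (s + 1) = Suc n" using s by simp
  thus ?thesis using s by (simp add: nfac_def divide_inverse)
qed

text \<open>Membership in the module \<open>X\<^sup>e nfac\<^sub>s \<complex>[X]\<close>, which is the shape of the first coefficient for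
  suitable \<open>e\<close> and \<open>s\<close>.\<close>

definition shaped :: "complex \<Rightarrow> complex \<Rightarrow> int \<Rightarrow> int \<Rightarrow> (complex fls \<Rightarrow> complex fls) \<Rightarrow> bool" where
  "shaped d q e s A \<longleftrightarrow> (\<exists>r. \<forall>X. generic d q X \<longrightarrow> A X = X powi e * nfac d q s X * ev r X)"

lemma shapedE:
  assumes "shaped d q e s A"
  obtains r where "\<And>X. generic d q X \<Longrightarrow> A X = X powi e * nfac d q s X * ev r X"
  using assms unfolding shaped_def by blast

lemma shapedI:
  "(\<And>X. generic d q X \<Longrightarrow> A X = X powi e * nfac d q s X * ev r X) \<Longrightarrow> shaped d q e s A"
  unfolding shaped_def by blast

lemma shaped_add:
  assumes "shaped d q e s A" "shaped d q e s B" shows "shaped d q e s (\<lambda>X. A X + B X)"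
proof -
  obtain r where r: "\<And>X. generic d q X \<Longrightarrow> A X = X powi e * nfac d q s X * ev r X"
    using assms(1) by (rule shapedE) blast
  obtain r' where r': "\<And>X. generic d q X \<Longrightarrow> B X = X powi e * nfac d q s X * ev r' X"
    using assms(2) by (rule shapedE) blast
  show ?thesis by (rule shapedI[where r = "r + r'"]) (simp add: r r' algebra_simps)
qed

lemma shaped_times:
  assumes "shaped d q e s A"
    and "\<And>X. generic d q X \<Longrightarrow> X powi e * nfac d q s X * f X = X powi e' * nfac d q s' X * ev t X"
  shows "shaped d q e' s' (\<lambda>X. f X * A X)"
proof -
  obtain r where r: "\<And>X. generic d q X \<Longrightarrow> A X = X powi e * nfac d q s X * ev r X"
    using assms(1) by (rule shapedE) blast
  show ?thesis
  proof (rule shapedI[where r = "t * r"])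
    fix X assume X: "generic d q X"
    have "f X * A X = (X powi e * nfac d q s X * f X) * ev r X"
      by (simp add: r[OF X] mult_ac)
    thus "f X * A X = X powi e' * nfac d q s' X * ev (t * r) X"
      unfolding assms(2)[OF X] by (simp add: mult_ac)
  qed
qed

lemma powi_split:
  assumes "X \<noteq> (0 :: complex fls)" "e' \<le> e"
  shows "X powi e = X powi e' * X ^ nat (e - e')"
proof -
  have "X powi e = X powi (e' + int (nat (e - e')))" using assms(2) by simp
  also have "\<dots> = X powi e' * X ^ nat (e - e')"
    using assms(1) by (simp only: power_int_add power_int_of_nat simp_thms)
  finally show ?thesis .
qed

text \<open>The module grows if \<open>e\<close> decreases; this is how a step in the lattice may multiply by a power of \<open>X\<close>
  and by a factor that relates \<open>nfac\<close> on two planes.\<close>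

lemma shaped_mono:
  assumes "shaped d q e s A" "e' \<le> e + i"
    and h: "\<And>X. generic d q X \<Longrightarrow> nfac d q s X * h X = nfac d q s' X * ev v X"
  shows "shaped d q e' s' (\<lambda>X. fls_const t * X powi i * h X * A X)"
proof (rule shaped_times[OF assms(1), where t = "smult t (monom 1 (nat (e + i - e')) * v)"])
  fix X assume X: "generic d q X"
  have 1: "X powi e * X powi i = X powi e' * X ^ nat (e + i - e')"
    using powi_split[OF genericD(1)[OF X] assms(2)] genericD(1)[OF X] by (simp add: power_int_add)
  have "X powi e * nfac d q s X * (fls_const t * X powi i * h X)
      = fls_const t * (X powi e * X powi i) * (nfac d q s X * h X)" by (simp add: mult_ac)
  thus "X powi e * nfac d q s X * (fls_const t * X powi i * h X) =
         X powi e' * nfac d q s' X * ev (smult t (monom 1 (nat (e + i - e')) * v)) X"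
    unfolding 1 h[OF X] by (simp add: mult_ac)
qed

lemma ratl_powi: "ratl d q (\<lambda>X. X powi i)"
proof (cases "i \<ge> 0")
  case True
  show ?thesis
    by (rule ratl_cong[OF ratl_ev[of d q "monom 1 (nat i)"]]) (use True in \<open>simp add: power_int_def\<close>)
next
  case False
  show ?thesis
    by (rule ratl_cong[OF ratl_inverse_ev[of d q "monom 1 (nat (- i))"]])
       (use False genericD(1) in \<open>auto simp: power_int_def power_inverse\<close>)
qed

section \<open>Shape of the coefficients\<close>

text \<open>The coefficients are functions of \<open>X\<close> that serve all solutions \<open>G\<close> simultaneously. Comparing two
  solutions at the same \<open>X\<close> will therefore determine \<open>A\<close>.\<close>

definition reduces ::
  "complex \<Rightarrow> complex \<Rightarrow> complex \<Rightarrow> complex \<Rightarrow> int \<Rightarrow> int \<Rightarrow> int \<Rightarrow>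
   (complex fls \<Rightarrow> complex fls) \<Rightarrow> (complex fls \<Rightarrow> complex fls) \<Rightarrow> bool" where
  "reduces a b c q k l m A B \<longleftrightarrow>
     shaped (a * b / c) q (1 - max m 0) (k + l - m) A \<and> ratl (a * b / c) q B \<and>
     (\<forall>X G. generic (a * b / c) q X \<longrightarrow> contiguous a b c q X G \<longrightarrow>
        G k l m = A X * G 1 1 1 + B X * G 0 0 0)"

definition reducible :: "complex \<Rightarrow> complex \<Rightarrow> complex \<Rightarrow> complex \<Rightarrow> int \<Rightarrow> int \<Rightarrow> int \<Rightarrow> bool" where
  "reducible a b c q k l m \<longleftrightarrow> (\<exists>A B. reduces a b c q k l m A B)"

text \<open>One step in the lattice: the premises collect the effect of a relation on the exponent of \<open>X\<close> and on
  \<open>nfac\<close>. A premise on \<open>e\<close> fails exactly where a step would introduce too high a power of \<open>1/X\<close>, which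
  forces the order in which the lattice is exhausted.\<close>

lemma reducible_step:
  assumes "reducible a b c q k1 l1 m1" "reducible a b c q k2 l2 m2"
    and rel: "\<And>X G. generic (a * b / c) q X \<Longrightarrow> contiguous a b c q X G \<Longrightarrow>
       G k l m = fls_const t1 * X powi i1 * h1 X * G k1 l1 m1 + fls_const t2 * X powi i2 * h2 X * G k2 l2 m2"
    and e: "1 - max m 0 \<le> 1 - max m1 0 + i1" "1 - max m 0 \<le> 1 - max m2 0 + i2"
    and s: "k + l - m = s" "k1 + l1 - m1 = s1" "k2 + l2 - m2 = s2"
    and h1: "\<And>X. generic (a * b / c) q X \<Longrightarrow>
       nfac (a * b / c) q s1 X * h1 X = nfac (a * b / c) q s X * ev v1 X"
    and h2: "\<And>X. generic (a * b / c) q X \<Longrightarrow>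
       nfac (a * b / c) q s2 X * h2 X = nfac (a * b / c) q s X * ev v2 X"
    and r: "ratl (a * b / c) q h1" "ratl (a * b / c) q h2"
  shows "reducible a b c q k l m"
proof -
  obtain A1 B1 where 1: "reduces a b c q k1 l1 m1 A1 B1" using assms(1) by (auto simp: reducible_def)
  obtain A2 B2 where 2: "reduces a b c q k2 l2 m2 A2 B2" using assms(2) by (auto simp: reducible_def)
  note d1 = 1[unfolded reduces_def] and d2 = 2[unfolded reduces_def]
  let ?f1 = "\<lambda>X. fls_const t1 * X powi i1 * h1 X" and ?f2 = "\<lambda>X. fls_const t2 * X powi i2 * h2 X"
  have A: "shaped (a * b / c) q (1 - max m 0) (k + l - m) (\<lambda>X. ?f1 X * A1 X + ?f2 X * A2 X)"
    using d1 d2 unfolding s by (intro shaped_add shaped_mono[OF _ e(1) h1] shaped_mono[OF _ e(2) h2]) auto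
  have B: "ratl (a * b / c) q (\<lambda>X. ?f1 X * B1 X + ?f2 X * B2 X)"
    using d1 d2 by (intro ratl_add ratl_mult ratl_const ratl_powi r) auto
  have "G k l m = (?f1 X * A1 X + ?f2 X * A2 X) * G 1 1 1 + (?f1 X * B1 X + ?f2 X * B2 X) * G 0 0 0"
    if "generic (a * b / c) q X" "contiguous a b c q X G" for X G
  proof -
    have "G k1 l1 m1 = A1 X * G 1 1 1 + B1 X * G 0 0 0" "G k2 l2 m2 = A2 X * G 1 1 1 + B2 X * G 0 0 0"
      using d1 d2 that by blast+
    thus ?thesis unfolding rel[OF that] by (simp add: algebra_simps)
  qed
  hence "reduces a b c q k l m (\<lambda>X. ?f1 X * A1 X + ?f2 X * A2 X) (\<lambda>X. ?f1 X * B1 X + ?f2 X * B2 X)"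
    unfolding reduces_def using A B by blast
  thus ?thesis unfolding reducible_def by blast
qed

lemma reducible_swap:
  assumes "reducible a b c q k l m" shows "reducible b a c q l k m"
proof -
  obtain A B where 1: "reduces a b c q k l m A B" using assms by (auto simp: reducible_def)
  note d1 = 1[unfolded reduces_def]
  have "G l k m = A X * G 1 1 1 + B X * G 0 0 0"
    if "generic (b * a / c) q X" "contiguous b a c q X G" for X G
    using d1 contiguous_swap[OF that(2)] that(1) by (auto simp: mult.commute)
  hence "reduces b a c q l k m A B"
    using d1 unfolding reduces_def by (simp add: mult.commute add.commute)
  thus ?thesis unfolding reducible_def by blast
qed

lemma nfac_1_factor: "nfac d q 0 X = nfac d q 1 X * ev [:1, - d:] X"
  by (simp add: nfac_def mult.commute)

locale heine_params =
  fixes a b c q :: complex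
  assumes adm: "admissible a b c q"
begin

lemma q: "unit_disc q" and q0: "q \<noteq> 0" and a0: "a \<noteq> 0" and b0: "b \<noteq> 0" and c0: "c \<noteq> 0"
  using adm by (auto simp: admissible_def unit_disc_def)

lemma notin: "a \<notin> qpowers q" "b \<notin> qpowers q" "c \<notin> qpowers q" "a / b \<notin> qpowers q"
    "c / a \<notin> qpowers q" "c / b \<notin> qpowers q"
    "b / a \<notin> qpowers q" "a / c \<notin> qpowers q" "b / c \<notin> qpowers q"
  using adm qpowers_inverse_iff[OF q0, of "a / b"] qpowers_inverse_iff[OF q0, of "c / a"]
    qpowers_inverse_iff[OF q0, of "c / b"]
  by (auto simp: admissible_def)

lemma swap: "heine_params b a c q"
  using notin q a0 b0 c0 by unfold_locales (auto simp: admissible_def unit_disc_def)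

abbreviation (input) "d \<equiv> a * b / c"
abbreviation (input) "R \<equiv> reducible a b c q"
abbreviation (input) "Y s X \<equiv> 1 - fls_const (d * q powi s) * X"

lemma ratl_1: "ratl e q (\<lambda>X. 1)"
  using ratl_const[of e q 1] by simp

lemma fls_const_neq_0: "fls_const (a * q powi k) \<noteq> 0" "fls_const (b * q powi k) \<noteq> 0"
    "fls_const (c * q powi k) \<noteq> 0"
  using a0 b0 c0 q0 by auto

lemma one_minus_neq_0: "1 - a * q powi k \<noteq> 0" "1 - b * q powi k \<noteq> 0" "1 - c * q powi k \<noteq> 0"
  using one_minus_qpow_nonzero[OF q0] notin by auto

lemma ratio_neq_1: "b * q powi l / (c * q powi m) - 1 \<noteq> 0" "a * q powi l / (c * q powi m) - 1 \<noteq> 0"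
proof -
  have "b * q powi l / (c * q powi m) = b / c * q powi (l - m)"
    "a * q powi l / (c * q powi m) = a / c * q powi (l - m)"
    using q0 by (simp_all add: power_int_diff)
  thus "b * q powi l / (c * q powi m) - 1 \<noteq> 0" "a * q powi l / (c * q powi m) - 1 \<noteq> 0"
    using one_minus_qpow_nonzero[OF q0 notin(9), of "l - m"] one_minus_qpow_nonzero[OF q0 notin(8), of "l - m"]
    by auto
qed

lemma fls_solve:
  assumes "fls_const t * y = z" "t \<noteq> 0" shows "y = fls_const (1 / t) * (z :: complex fls)"
  using assms(2) unfolding assms(1) [symmetric] by (simp add: mult.assoc [symmetric])

text \<open>The moves within the pair of planes \<open>s = 0\<close> and \<open>s = 1\<close>, where \<open>s = k + l - m\<close>. On these planes
  \<open>nfac\<close> is \<open>1 - (ab/c) X\<close> and \<open>1\<close>. A term on the plane \<open>0\<close> thus already contains the factor that occurs in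
  \<open>contiguous_raise\<close>, and no denominator arises. This first move exchanges a shift of \<open>a\<close> for one of \<open>b\<close>: both
  relations contain the same diagonal neighbour.\<close>

lemma move_k_to_l:
  assumes "R k l m" "R (k + 1) l m" "k + l = m"
  shows "R k (l + 1) m"
proof (rule reducible_step[OF assms(1,2)])
  fix X G assume X: "generic d q X" and G: "contiguous a b c q X G"
  have 1: "fls_const (b * q powi l) * (G (k + 1) l m - fls_const (1 - a * q powi k) * G k l m)
      = fls_const (a * q powi k) * (G k (l + 1) m - fls_const (1 - b * q powi l) * G k l m)"
    unfolding contiguousD(1)[OF G, of k l m] contiguousD(2)[OF G, of k l m] by (simp only: algebra_simps)
  define A B where "A = fls_const (a * q powi k)" and "B = fls_const (b * q powi l)"
  have A: "A \<noteq> 0" using fls_const_neq_0 by (simp add: A_def)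
  have t: "fls_const (1 - b * q powi l / (a * q powi k)) = 1 - B / A"
      "fls_const (b * q powi l / (a * q powi k)) = B / A"
    by (simp_all only: A_def B_def fls_const_diff fls_const_divide fls_const_1)
  show "G k (l + 1) m = fls_const (1 - b * q powi l / (a * q powi k)) * X powi 0 * (\<lambda>X. 1) X * G k l m +
          fls_const (b * q powi l / (a * q powi k)) * X powi 0 * (\<lambda>X. 1) X * G (k + 1) l m"
    using 1 A unfolding t fls_const_diff fls_const_1 A_def [symmetric] B_def [symmetric]
    by (simp add: field_simps)
next
  fix X assume X: "generic d q X"
  show "nfac d q 0 X * 1 = nfac d q 1 X * ev [:1, - d:] X"
    by (simp only: nfac_1_factor mult_1_right)
next
  fix X assume X: "generic d q X"
  show "nfac d q 1 X * 1 = nfac d q 1 X * ev 1 X"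
    by simp
qed (use assms(3) in \<open>auto intro: ratl_1\<close>)

lemma move_l_to_k:
  assumes "R k l m" "R k (l + 1) m" "k + l = m"
  shows "R (k + 1) l m"
proof -
  interpret s: heine_params b a c q by (rule swap)
  show ?thesis using s.move_k_to_l[of l k m] assms by (auto intro: reducible_swap)
qed

lemma raise':
  assumes "contiguous a b c q X G" "k + l - m = s"
  shows "fls_const (1 - a * q powi k) * G k l m - Y s X * G (k + 1) l m
       = fls_const (a * q powi k * (b * q powi l / (c * q powi m) - 1)) * X * G (k + 1) l (m + 1)"
  using contiguous_raise[OF assms(1) q0 c0, of k l m] assms(2) by simp

text \<open>Raising \<open>m\<close> divides by \<open>X\<close>, which the shape allows for \<open>m \<ge> 0\<close>. Lowering it below \<open>0\<close> needs a relation
  without this division, since there the exponent of \<open>X\<close> no longer depends on \<open>m\<close>.\<close>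

lemma move_up_m:
  assumes "R k l m" "R (k + 1) l m" "k + l = m" "m \<ge> 0"
  shows "R (k + 1) l (m + 1)"
proof (rule reducible_step[OF assms(1,2)])
  fix X G assume X: "generic d q X" and G: "contiguous a b c q X G"
  let ?t = "a * q powi k * (b * q powi l / (c * q powi m) - 1)"
  have t: "?t \<noteq> 0" using ratio_neq_1(1)[of l m] a0 q0 by simp
  have 1: "fls_const ?t * (X * G (k + 1) l (m + 1)) = fls_const (1 - a * q powi k) * G k l m - Y 0 X * G (k + 1) l m"
    using raise'[OF G, of k l m 0] assms(3) by (simp add: mult.assoc)
  have "X * G (k + 1) l (m + 1) = fls_const (1 / ?t) * (fls_const (1 - a * q powi k) * G k l m - Y 0 X * G (k + 1) l m)"
    by (rule fls_solve[OF 1 t])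
  hence "G (k + 1) l (m + 1) = inverse X * (fls_const (1 / ?t) * (fls_const (1 - a * q powi k) * G k l m - Y 0 X * G (k + 1) l m))"
    using genericD(1)[OF X] by (simp add: field_simps)
  also have "\<dots> = fls_const ((1 - a * q powi k) * (1 / ?t)) * X powi (-1) * (\<lambda>X. 1) X * G k l m +
          fls_const (- (1 / ?t)) * X powi (-1) * Y 0 X * G (k + 1) l m"
    unfolding fls_const_mult fls_const_uminus by (simp add: algebra_simps)
  finally show "G (k + 1) l (m + 1) = fls_const ((1 - a * q powi k) * (1 / ?t)) * X powi (-1) * (\<lambda>X. 1) X * G k l m +
          fls_const (- (1 / ?t)) * X powi (-1) * Y 0 X * G (k + 1) l m" .
next
  fix X assume X: "generic d q X"
  show "nfac d q 0 X * 1 = nfac d q 0 X * ev 1 X"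
    by simp
next
  fix X assume X: "generic d q X"
  show "nfac d q 1 X * Y 0 X = nfac d q 0 X * ev 1 X"
    by (simp add: nfac_def)
qed (use assms in \<open>auto intro: ratl_1 ratl_factor\<close>)

lemma move_up_m':
  assumes "R k l m" "R (k + 1) l m" "k + l = m" "m \<ge> 0"
  shows "R (k + 1) (l + 1) (m + 1)"
proof (rule reducible_step[OF assms(1,2)])
  fix X G assume X: "generic d q X" and G: "contiguous a b c q X G"
  define A where "A = fls_const (a * q powi k)"
  have A: "A \<noteq> 0" using fls_const_neq_0 by (simp add: A_def)
  show "G (k + 1) (l + 1) (m + 1) = fls_const (- ((1 - a * q powi k) / (a * q powi k))) * X powi (-1) * (\<lambda>X. 1) X * G k l m +
          fls_const (1 / (a * q powi k)) * X powi (-1) * (\<lambda>X. 1) X * G (k + 1) l m"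
    using contiguousD(1)[OF G, of k l m] A genericD(1)[OF X]
    unfolding fls_const_uminus fls_const_divide fls_const_diff fls_const_1 A_def [symmetric]
    by (simp add: field_simps)
next
  fix X assume X: "generic d q X"
  show "nfac d q 0 X * 1 = nfac d q 1 X * ev [:1, - d:] X"
    by (simp only: nfac_1_factor mult_1_right)
next
  fix X assume X: "generic d q X"
  show "nfac d q 1 X * 1 = nfac d q 1 X * ev 1 X"
    by simp
qed (use assms in \<open>auto intro: ratl_1\<close>)

lemma move_down_m':
  assumes "R (k + 1) l (m + 1)" "R (k + 1) (l + 1) (m + 1)" "k + l = m" "m + 1 \<le> 0"
  shows "R (k + 1) l m"
proof (rule reducible_step[OF assms(1,2)])
  fix X G assume X: "generic d q X" and G: "contiguous a b c q X G"
  define B C where "B = fls_const (b * q powi l)" and "C = fls_const (c * q powi m)"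
  have B: "B \<noteq> 0" using fls_const_neq_0 by (simp add: B_def)
  show "G (k + 1) l m = fls_const (- ((c * q powi m - b * q powi l) / (b * q powi l))) * X powi 0 * (\<lambda>X. 1) X * G (k + 1) l (m + 1) +
          fls_const (c * q powi m / (b * q powi l)) * X powi 0 * (\<lambda>X. 1) X * G (k + 1) (l + 1) (m + 1)"
    using contiguousD(4)[OF G, of m "k + 1" l] B genericD(1)[OF X]
    unfolding fls_const_uminus fls_const_divide fls_const_diff fls_const_1 B_def [symmetric] C_def [symmetric]
    by (simp add: field_simps)
next
  fix X assume X: "generic d q X"
  show "nfac d q 0 X * 1 = nfac d q 1 X * ev [:1, - d:] X"
    by (simp only: nfac_1_factor mult_1_right)
next
  fix X assume X: "generic d q X"
  show "nfac d q 1 X * 1 = nfac d q 1 X * ev 1 X"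
    by simp
qed (use assms in \<open>auto intro: ratl_1\<close>)

lemma move_down_m:
  assumes "R (k + 1) l m" "R (k + 1) l (m + 1)" "k + l = m"
  shows "R k l m"
proof (rule reducible_step[OF assms(1,2)])
  fix X G assume X: "generic d q X" and G: "contiguous a b c q X G"
  let ?t = "a * q powi k * (b * q powi l / (c * q powi m) - 1)"
  have 1: "fls_const (1 - a * q powi k) * G k l m = Y 0 X * G (k + 1) l m + fls_const ?t * X * G (k + 1) l (m + 1)"
    using raise'[OF G, of k l m 0] assms(3) by (simp add: algebra_simps)
  have "G k l m = fls_const (1 / (1 - a * q powi k)) * (Y 0 X * G (k + 1) l m + fls_const ?t * X * G (k + 1) l (m + 1))"
    by (rule fls_solve[OF 1 one_minus_neq_0(1)])
  also have "\<dots> = fls_const (1 / (1 - a * q powi k)) * X powi 0 * Y 0 X * G (k + 1) l m +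
        fls_const (1 / (1 - a * q powi k) * ?t) * X powi 1 * (\<lambda>X. 1) X * G (k + 1) l (m + 1)"
    unfolding fls_const_mult[of "1 / (1 - a * q powi k)"] by (simp add: algebra_simps)
  finally show "G k l m = fls_const (1 / (1 - a * q powi k)) * X powi 0 * Y 0 X * G (k + 1) l m +
        fls_const (1 / (1 - a * q powi k) * ?t) * X powi 1 * (\<lambda>X. 1) X * G (k + 1) l (m + 1)" .
next
  fix X assume X: "generic d q X"
  show "nfac d q 1 X * Y 0 X = nfac d q 0 X * ev 1 X"
    by (simp add: nfac_def)
next
  fix X assume X: "generic d q X"
  show "nfac d q 0 X * 1 = nfac d q 0 X * ev 1 X"
    by simp
qed (use assms in \<open>auto intro: ratl_1 ratl_factor\<close>)

lemma move_lateral: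
  assumes "R k l m" "R (k + 1) l m" "k + l = m"
  shows "R (k + 1) (l - 1) m"
proof (rule reducible_step[OF assms(1,2)])
  fix X G assume X: "generic d q X" and G: "contiguous a b c q X G"
  let ?t = "a * q powi k * (b * q powi l / (c * q powi m) - 1)"
  let ?a = "a * q powi k" and ?b = "b * q powi (l - 1)"
  have t: "?t \<noteq> 0" using ratio_neq_1(1)[of l m] a0 q0 by simp
  have 1: "fls_const ?t * (X * G (k + 1) l (m + 1)) = fls_const (1 - ?a) * G k l m - Y 0 X * G (k + 1) l m"
    using raise'[OF G, of k l m 0] assms(3) by (simp add: mult.assoc)
  have 2: "X * G (k + 1) l (m + 1) = fls_const (1 / ?t) * (fls_const (1 - ?a) * G k l m - Y 0 X * G (k + 1) l m)"
    by (rule fls_solve[OF 1 t])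
  have 3: "G (k + 1) (l - 1) m = fls_const (1 - ?a) * G k (l - 1) m + fls_const ?a * X * G (k + 1) l (m + 1)"
    "G k l m = fls_const (1 - ?b) * G k (l - 1) m + fls_const ?b * X * G (k + 1) l (m + 1)"
    using contiguousD(1)[OF G, of k "l - 1" m] contiguousD(2)[OF G, of k "l - 1" m] by simp_all
  have "fls_const (1 - ?b) * G (k + 1) (l - 1) m - fls_const (1 - ?a) * G k l m
     = fls_const (?a - ?b) * (X * G (k + 1) l (m + 1))"
    unfolding 3 fls_const_diff fls_const_1 by algebra
  hence 4: "fls_const (1 - ?b) * G (k + 1) (l - 1) m = fls_const (1 - ?a) * G k l m +
     fls_const ((?a - ?b) / ?t) * (fls_const (1 - ?a) * G k l m - Y 0 X * G (k + 1) l m)"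
    unfolding 2 by (simp add: algebra_simps)
  have "G (k + 1) (l - 1) m = fls_const (1 / (1 - ?b)) * (fls_const (1 - ?a) * G k l m +
     fls_const ((?a - ?b) / ?t) * (fls_const (1 - ?a) * G k l m - Y 0 X * G (k + 1) l m))"
    by (rule fls_solve[OF 4 one_minus_neq_0(2)])
  also have "\<dots> = fls_const (1 / (1 - ?b) * (1 + (?a - ?b) / ?t) * (1 - ?a)) * X powi 0 * (\<lambda>X. 1) X * G k l m +
     fls_const (- (1 / (1 - ?b) * ((?a - ?b) / ?t))) * X powi 0 * Y 0 X * G (k + 1) l m"
    unfolding fls_const_mult[of _ "1 - ?a"] fls_const_mult[of "1 / (1 - ?b)"] fls_const_add fls_const_uminus fls_const_1
    by (simp add: algebra_simps del: fls_const_mult_const)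
  finally show "G (k + 1) (l - 1) m = fls_const (1 / (1 - ?b) * (1 + (?a - ?b) / ?t) * (1 - ?a)) * X powi 0 * (\<lambda>X. 1) X * G k l m +
     fls_const (- (1 / (1 - ?b) * ((?a - ?b) / ?t))) * X powi 0 * Y 0 X * G (k + 1) l m" .
next
  fix X assume X: "generic d q X"
  show "nfac d q 0 X * 1 = nfac d q 0 X * ev 1 X"
    by simp
next
  fix X assume X: "generic d q X"
  show "nfac d q 1 X * Y 0 X = nfac d q 0 X * ev 1 X"
    by (simp add: nfac_def)
qed (use assms in \<open>auto intro: ratl_1 ratl_factor\<close>)

lemma solve_eq:
  fixes y z G G1 G2 t1 t2 X :: "complex fls"
  assumes "t1 * G1 - y * G = t2 * X * G2" "y \<noteq> 0"
  shows "G = t1 * X powi 0 * inverse y * G1 + (- t2) * X powi 1 * inverse y * G2"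
  using assms by (simp add: field_simps)

text \<open>Outside the two planes, induction on \<open>\<bar>s\<bar>\<close> suffices. For \<open>s \<ge> 0\<close> every step up divides by one factor
  \<open>1 - (ab/c) q\<^sup>s X\<close>; for \<open>s < 0\<close> the shape is constant in \<open>s\<close>, and steps down divide by none.\<close>

lemma move_up_s:
  assumes "R k l m" "R (k + 1) l (m + 1)" "k + l - m \<ge> 0"
  shows "R (k + 1) l m"
proof (rule reducible_step[OF assms(1,2)])
  fix X G assume X: "generic d q X" and G: "contiguous a b c q X G"
  let ?t = "a * q powi k * (b * q powi l / (c * q powi m) - 1)"
  from raise'[OF G, of k l m "k + l - m"]
  show "G (k + 1) l m = fls_const (1 - a * q powi k) * X powi 0 * inverse (Y (k + l - m) X) * G k l m +
      fls_const (- ?t) * X powi 1 * inverse (Y (k + l - m) X) * G (k + 1) l (m + 1)"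
    unfolding fls_const_uminus using genericD(2)[OF X, of "k + l - m"]
    by (intro solve_eq) simp_all
next
  fix X assume X: "generic d q X"
  show "nfac d q (k + l - m) X * inverse (Y (k + l - m) X) = nfac d q (k + l - m + 1) X * ev 1 X"
    using nfac_Suc[OF X assms(3)] by (simp add: divide_inverse[of "nfac _ _ _ _"])
next
  fix X assume X: "generic d q X"
  show "nfac d q (k + l - m) X * inverse (Y (k + l - m) X) = nfac d q (k + l - m + 1) X * ev 1 X"
    using nfac_Suc[OF X assms(3)] by (simp add: divide_inverse[of "nfac _ _ _ _"])
next
  show "ratl d q (\<lambda>X. inverse (Y (k + l - m) X))" "ratl d q (\<lambda>X. inverse (Y (k + l - m) X))"
    by (rule ratl_inverse_factor)+
qed simp_all

lemma move_down_s:
  assumes "R (k + 1) l m" "R (k + 1) (l + 1) (m + 1)" "k + l - m \<le> -1"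
  shows "R k l m"
proof (rule reducible_step[OF assms(1,2)])
  fix X G assume X: "generic d q X" and G: "contiguous a b c q X G"
  have 1: "fls_const (1 - a * q powi k) * G k l m = G (k + 1) l m - fls_const (a * q powi k) * X * G (k + 1) (l + 1) (m + 1)"
    using contiguousD(1)[OF G, of k l m] by (simp add: algebra_simps)
  have "G k l m = fls_const (1 / (1 - a * q powi k)) * (G (k + 1) l m - fls_const (a * q powi k) * X * G (k + 1) (l + 1) (m + 1))"
    by (rule fls_solve[OF 1 one_minus_neq_0(1)])
  thus "G k l m = fls_const (1 / (1 - a * q powi k)) * X powi 0 * (\<lambda>X. 1) X * G (k + 1) l m +
      fls_const (- (1 / (1 - a * q powi k) * (a * q powi k))) * X powi 1 * (\<lambda>X. 1) X * G (k + 1) (l + 1) (m + 1)"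
    unfolding fls_const_uminus fls_const_mult[of "1 / (1 - a * q powi k)"]
    by (simp add: algebra_simps del: fls_const_mult_const)
next
  fix X assume X: "generic d q X"
  show "nfac d q (k + l - m + 1) X * 1 = nfac d q (k + l - m) X * ev 1 X"
    using assms(3) by (simp add: nfac_nonpos)
next
  fix X assume X: "generic d q X"
  show "nfac d q (k + l - m + 1) X * 1 = nfac d q (k + l - m) X * ev 1 X"
    using assms(3) by (simp add: nfac_nonpos)
qed (use assms in \<open>auto intro: ratl_1\<close>)

lemma base_000: "R 0 0 0"
proof -
  have "shaped d q (1 - max 0 0) (0 + 0 - 0) (\<lambda>X. 0)" by (rule shapedI[where r = 0]) simp
  moreover have "ratl d q (\<lambda>X. 1)" by (rule ratl_1)
  ultimately have "reduces a b c q 0 0 0 (\<lambda>X. 0) (\<lambda>X. 1)" unfolding reduces_def by simp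
  thus ?thesis unfolding reducible_def by blast
qed

lemma base_111: "R 1 1 1"
proof -
  have "shaped d q (1 - max 1 0) (1 + 1 - 1) (\<lambda>X. 1)" by (rule shapedI[where r = 1]) (simp add: nfac_1)
  moreover have "ratl d q (\<lambda>X. 0)" using ratl_const[of d q 0] by simp
  ultimately have "reduces a b c q 1 1 1 (\<lambda>X. 1) (\<lambda>X. 0)" unfolding reduces_def by simp
  thus ?thesis unfolding reducible_def by blast
qed

lemma base_100: "R 1 0 0"
proof (rule reducible_step[OF base_000 base_111])
  fix X G assume X: "generic d q X" and G: "contiguous a b c q X G"
  show "G 1 0 0 = fls_const (1 - a) * X powi 0 * (\<lambda>X. 1) X * G 0 0 0 + fls_const a * X powi 1 * (\<lambda>X. 1) X * G 1 1 1"
    using contiguousD(1)[OF G, of 0 0 0] by simp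
next
  fix X assume X: "generic d q X"
  show "nfac d q 0 X * 1 = nfac d q 1 X * ev [:1, - d:] X"
    by (simp only: nfac_1_factor mult_1_right)
next
  fix X assume X: "generic d q X"
  show "nfac d q 1 X * 1 = nfac d q 1 X * ev 1 X"
    by simp
qed (auto intro: ratl_1)

text \<open>A pair of neighbours on the planes \<open>0\<close> and \<open>1\<close> determines the next pair in each direction, so pairs
  are the right objects for the induction over \<open>(k, l)\<close>.\<close>

abbreviation (input) "good k l \<equiv> R k l (k + l) \<and> R (k + 1) l (k + l)"

lemma good_lateral:
  assumes "good k l" shows "good (k + 1) (l - 1)"
proof -
  have 1: "R (k + 1) (l - 1) (k + l)" using move_lateral assms by blast
  have "R (k + 1 + 1) (l - 1) (k + l)" by (rule move_l_to_k) (use 1 assms in auto)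
  thus ?thesis using 1 by (simp add: algebra_simps)
qed

lemma good_lateral':
  assumes "good k l" shows "good (k - 1) (l + 1)"
proof -
  interpret s: heine_params b a c q by (rule swap)
  have 2: "R k (l + 1) (k + l)" using move_k_to_l assms by blast
  have "reducible b a c q (l + 1) (k - 1) (l + k)"
    by (rule s.move_lateral) (use 2 assms in \<open>auto intro: reducible_swap simp: add.commute\<close>)
  hence "R (k - 1) (l + 1) (l + k)" by (rule reducible_swap)
  thus ?thesis using 2 by (simp add: algebra_simps)
qed

lemma good_up:
  assumes "good k l" "k + l \<ge> 0" shows "good (k + 1) l"
proof -
  have 1: "R (k + 1) l (k + l + 1)" using move_up_m[of k l "k + l"] assms by auto
  have 2: "R (k + 1) (l + 1) (k + l + 1)" using move_up_m'[of k l "k + l"] assms by auto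
  have "R (k + 1 + 1) l (k + l + 1)" by (rule move_l_to_k[OF 1 2]) simp
  thus ?thesis using 1 by (simp add: algebra_simps)
qed

lemma good_down:
  assumes "good (k + 1) l" "k + l + 1 \<le> 0" shows "good k l"
proof -
  have 1: "R (k + 1) l (k + l + 1)" "R (k + 1 + 1) l (k + l + 1)" using assms by (auto simp: algebra_simps)
  have 2: "R (k + 1) (l + 1) (k + l + 1)" by (rule move_k_to_l[OF 1]) simp
  have 3: "R (k + 1) l (k + l)" by (rule move_down_m'[OF 1(1) 2]) (use assms in auto)
  have "R k l (k + l)" by (rule move_down_m[OF 3 1(1)]) simp
  thus ?thesis using 3 by simp
qed

lemma good_k0: "good k 0"
proof (induction k rule: int_induct[where k = 0])
  case base show ?case using base_000 base_100 by simp
next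
  case (step1 i) thus ?case using good_up[of i 0] by simp
next
  case (step2 i) thus ?case using good_down[of "i - 1" 0] by simp
qed

lemma good_all: "good k l"
proof (induction l arbitrary: k rule: int_induct[where k = 0])
  case base show ?case by (rule good_k0)
next
  case (step1 i)
  from good_lateral'[OF step1(2)[of "k + 1"]] show ?case by simp
next
  case (step2 i)
  from good_lateral[OF step2(2)[of "k - 1"]] show ?case by simp
qed

lemma reducible_nonneg: "R k l (k + l - int n)"
proof (induction n arbitrary: k l)
  case 0 show ?case using good_all by simp
next
  case (Suc n)
  have 1: "R (k - 1) l (k - 1 + l - int n)" "R k l (k + l - int n)" using Suc.IH by blast+
  have "R (k - 1 + 1) l (k + l - int (Suc n))"
    by (rule move_up_s) (use 1 in \<open>auto simp: algebra_simps\<close>)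
  thus ?case by simp
qed

lemma reducible_neg: "R k l (k + l + int n)"
proof (induction n arbitrary: k l)
  case 0 show ?case using good_all by simp
next
  case (Suc n)
  have 1: "R (k + 1) l (k + 1 + l + int n)" "R (k + 1) (l + 1) (k + 1 + (l + 1) + int n)" using Suc.IH by blast+
  show ?case by (rule move_down_s) (use 1 in \<open>auto simp: algebra_simps\<close>)
qed

theorem reducible_all: "R k l m"
proof (cases "k + l \<ge> m")
  case True
  thus ?thesis using reducible_nonneg[of k l "nat (k + l - m)"] by simp
next
  case False
  thus ?thesis using reducible_neg[of k l "nat (m - k - l)"] by simp
qed

end

section \<open>The solution at the origin\<close>

lemma eq_divideI: "x * c = y \<Longrightarrow> c \<noteq> 0 \<Longrightarrow> x = y / (c :: complex)"
  by (metis nonzero_mult_div_cancel_right)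

lemma suminf_linear:
  fixes f g h :: "nat \<Rightarrow> complex"
  assumes "summable f" "summable g" "summable h" "\<And>n. u * h n = s * f n + t * g n"
  shows "u * suminf h = s * suminf f + t * suminf g"
proof -
  have "u * suminf h = (\<Sum>n. s * f n + t * g n)"
    using suminf_mult[OF assms(3), of u] assms(4) by simp
  also have "\<dots> = s * suminf f + t * suminf g"
    using suminf_add[OF summable_mult[OF assms(1), of s] summable_mult[OF assms(2), of t]]
    by (simp add: suminf_mult[OF assms(1)] suminf_mult[OF assms(2)])
  finally show ?thesis .
qed

definition tri :: "int \<Rightarrow> int" where "tri n = n * (n - 1) div 2"

lemma tri_plus1: "tri (n + 1) = tri n + n"
proof -
  have "(n + 1) * (n + 1 - 1) = n * (n - 1) + n * 2" by (simp add: algebra_simps)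
  thus ?thesis unfolding tri_def by (simp only: div_mult_self3 zero_neq_numeral not_False_eq_True)
qed

context heine_params
begin

lemma shift_notin: "a * q powi k \<notin> qpowers q" "b * q powi k \<notin> qpowers q" "c * q powi k \<notin> qpowers q"
  using notin by (simp_all add: qpowers_mult_powi_iff[OF q0])

text \<open>The factors \<open>(a)\<^sub>k (b)\<^sub>l / (c)\<^sub>m\<close> are absorbed, which makes a shift of one parameter multiply or
  divide the coefficient by a linear function of \<open>q\<^sup>n\<close>.\<close>

definition zero_coeff :: "int \<Rightarrow> int \<Rightarrow> int \<Rightarrow> nat \<Rightarrow> complex" where
  "zero_coeff k l m n = qpoch q a (k + int n) * qpoch q b (l + int n) / (qpoch q q (int n) * qpoch q c (m + int n))"

lemma zero_coeff_nonzero: "zero_coeff k l m n \<noteq> 0"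
  using qpoch_nonzero[OF q0] notin qpoch_q_nonzero[OF q] by (simp add: zero_coeff_def)

lemma zero_coeff_k: "zero_coeff (k + 1) l m n = (1 - a * q powi k * q ^ n) * zero_coeff k l m n"
proof -
  have e: "k + 1 + int n = k + int n + 1" by simp
  show ?thesis
    unfolding zero_coeff_def e qpoch_rec[OF q0 notin(1)] by (simp add: power_int_add q0 mult.assoc)
qed

lemma zero_coeff_l: "zero_coeff k (l + 1) m n = (1 - b * q powi l * q ^ n) * zero_coeff k l m n"
proof -
  have e: "l + 1 + int n = l + int n + 1" by simp
  show ?thesis
    unfolding zero_coeff_def e qpoch_rec[OF q0 notin(2)] by (simp add: power_int_add q0 mult.assoc)
qed

lemma zero_coeff_m: "zero_coeff k l m n = (1 - c * q powi m * q ^ n) * zero_coeff k l (m + 1) n"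
proof -
  have e: "m + 1 + int n = m + int n + 1" by simp
  show ?thesis
    using qpoch_rec[OF q0 notin(3), of "m + int n"] q0 one_minus_qpow_nonzero[OF q0 notin(3), of "m + int n"]
    by (simp add: zero_coeff_def power_int_add e mult.assoc)
qed

lemma zero_coeff_klm: "zero_coeff (k + 1) (l + 1) (m + 1) n = (1 - q ^ Suc n) * zero_coeff k l m (Suc n)"
proof -
  have e: "k + 1 + int n = k + int (Suc n)" for k by simp
  have "1 - q ^ Suc n \<noteq> 0" using q_pow_neq_1[OF q, of "int (Suc n)"] by (simp del: of_nat_Suc power_Suc)
  thus ?thesis
    unfolding zero_coeff_def e qpoch_nat_Suc[of q q n] by (simp del: of_nat_Suc)
qed

lemma zero_coeff_ratio:
  "zero_coeff k l m (Suc n) / zero_coeff k l m n =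
   (1 - a * q powi k * q ^ n) * (1 - b * q powi l * q ^ n) / ((1 - q ^ Suc n) * (1 - c * q powi m * q ^ n))"
proof -
  have nz: "1 - q ^ Suc n \<noteq> 0" using q_pow_neq_1[OF q, of "int (Suc n)"] by (simp del: of_nat_Suc power_Suc)
  have nz': "1 - c * q powi m * q ^ n \<noteq> 0"
    using one_minus_qpow_nonzero[OF q0 shift_notin(3)[of m], of "int n"] by simp
  have z: "zero_coeff k l (m + 1) n \<noteq> 0" by (rule zero_coeff_nonzero)
  have "(1 - q ^ Suc n) * zero_coeff k l m (Suc n) = zero_coeff (k + 1) (l + 1) (m + 1) n"
    by (rule zero_coeff_klm [symmetric])
  also have "\<dots> = (1 - a * q powi k * q ^ n) * (1 - b * q powi l * q ^ n) * zero_coeff k l (m + 1) n"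
    unfolding zero_coeff_k zero_coeff_l by (simp only: mult_ac)
  finally have "zero_coeff k l m (Suc n) =
      (1 - a * q powi k * q ^ n) * (1 - b * q powi l * q ^ n) * zero_coeff k l (m + 1) n / (1 - q ^ Suc n)"
    by (intro eq_divideI nz) (simp only: mult_ac)
  thus ?thesis
    unfolding zero_coeff_m[of k l m n] using nz nz' z by simp
qed

lemma summable_zero_coeff:
  assumes "norm x < 1"
  shows "summable (\<lambda>n. zero_coeff k l m n * x ^ n)"
proof -
  have qn: "(\<lambda>n. q ^ n) \<longlonglongrightarrow> 0" using q by (intro LIMSEQ_power_zero) (simp add: unit_disc_def)
  have "(\<lambda>n. (1 - a * q powi k * q ^ n) * (1 - b * q powi l * q ^ n) / ((1 - q ^ Suc n) * (1 - c * q powi m * q ^ n)))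
        \<longlonglongrightarrow> (1 - a * q powi k * 0) * (1 - b * q powi l * 0) / ((1 - 0) * (1 - c * q powi m * 0))"
    by (intro tendsto_intros qn LIMSEQ_Suc[OF qn]) simp
  hence "(\<lambda>n. norm (zero_coeff k l m (Suc n) / zero_coeff k l m n)) \<longlonglongrightarrow> norm (1 :: complex)"
    unfolding zero_coeff_ratio by (intro tendsto_norm) simp
  hence lim: "(\<lambda>n. norm (zero_coeff k l m (Suc n) / zero_coeff k l m n) * norm x) \<longlonglongrightarrow> 1 * norm x"
    by (intro tendsto_mult tendsto_const) simp
  obtain r where r: "norm x < r" "r < 1" using assms dense by blast
  have "\<forall>\<^sub>F n in sequentially. norm (zero_coeff k l m (Suc n) / zero_coeff k l m n) * norm x < r"
    using order_tendstoD(2)[OF lim] r by simp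
  then obtain N where N: "\<And>n. n \<ge> N \<Longrightarrow> norm (zero_coeff k l m (Suc n) / zero_coeff k l m n) * norm x < r"
    by (auto simp: eventually_sequentially)
  show ?thesis
  proof (rule summable_ratio_test[OF r(2), where N = N])
    fix n assume "n \<ge> N"
    from N[OF this] have "norm (zero_coeff k l m (Suc n)) * norm x \<le> r * norm (zero_coeff k l m n)"
      using zero_coeff_nonzero[of k l m n] by (simp add: norm_divide field_simps)
    from mult_right_mono[OF this, of "norm x ^ n"]
    show "norm (zero_coeff k l m (Suc n) * x ^ Suc n) \<le> r * norm (zero_coeff k l m n * x ^ n)"
      by (simp add: norm_mult norm_power mult_ac)
  qed
qed

definition zero_fun :: "int \<Rightarrow> int \<Rightarrow> int \<Rightarrow> complex \<Rightarrow> complex" where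
  "zero_fun k l m x = (\<Sum>n. zero_coeff k l m n * x ^ n)"

text \<open>Multiplication by \<open>x\<close> turns the shift of all three parameters into the index shift \<open>n \<mapsto> n + 1\<close>.\<close>

lemma zero_fun_shift:
  assumes "norm x < 1"
  shows "x * zero_fun (k + 1) (l + 1) (m + 1) x = (\<Sum>n. (1 - q ^ n) * zero_coeff k l m n * x ^ n)"
    and "summable (\<lambda>n. (1 - q ^ n) * zero_coeff k l m n * x ^ n)"
proof -
  let ?f = "\<lambda>n. (1 - q ^ n) * zero_coeff k l m n * x ^ n"
  have S: "summable (\<lambda>n. x * (zero_coeff (k + 1) (l + 1) (m + 1) n * x ^ n))"
    by (intro summable_mult summable_zero_coeff assms)
  have eq: "x * (zero_coeff (k + 1) (l + 1) (m + 1) n * x ^ n) = ?f (Suc n)" for n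
    unfolding zero_coeff_klm by simp
  show S': "summable ?f"
    using S unfolding eq by (subst (asm) summable_Suc_iff)
  have "x * zero_fun (k + 1) (l + 1) (m + 1) x = (\<Sum>n. ?f (Suc n))"
    unfolding zero_fun_def eq [symmetric] by (rule suminf_mult [symmetric]) (rule summable_zero_coeff[OF assms])
  also have "\<dots> = (\<Sum>n. ?f n)" using suminf_split_head[OF S'] by simp
  finally show "x * zero_fun (k + 1) (l + 1) (m + 1) x = (\<Sum>n. ?f n)" .
qed

lemma contiguous_zero_fun:
  assumes "norm x < 1"
  shows "contiguous a b c q (fls_const x) (\<lambda>k l m. fls_const (zero_fun k l m x))"
proof -
  note S = summable_zero_coeff[OF assms] and S' = zero_fun_shift(2)[OF assms]
  have 1: "1 * zero_fun (k + 1) l m x = (1 - a * q powi k) * zero_fun k l m x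
       + a * q powi k * (x * zero_fun (k + 1) (l + 1) (m + 1) x)" for k l m
    unfolding zero_fun_shift(1)[OF assms] unfolding zero_fun_def
    by (rule suminf_linear[OF S S' S]) (unfold zero_coeff_k, simp add: algebra_simps)
  have 2: "1 * zero_fun k (l + 1) m x = (1 - b * q powi l) * zero_fun k l m x
       + b * q powi l * (x * zero_fun (k + 1) (l + 1) (m + 1) x)" for k l m
    unfolding zero_fun_shift(1)[OF assms] unfolding zero_fun_def
    by (rule suminf_linear[OF S S' S]) (unfold zero_coeff_l, simp add: algebra_simps)
  have 3: "c * q powi m * zero_fun (k + 1) l (m + 1) x = a * q powi k * zero_fun k l m x
       + (c * q powi m - a * q powi k) * zero_fun k l (m + 1) x" for k l m
    unfolding zero_fun_def
    by (rule suminf_linear[OF S S S]) (unfold zero_coeff_k zero_coeff_m[of k l m], simp add: algebra_simps)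
  have 4: "c * q powi m * zero_fun k (l + 1) (m + 1) x = b * q powi l * zero_fun k l m x
       + (c * q powi m - b * q powi l) * zero_fun k l (m + 1) x" for k l m
    unfolding zero_fun_def
    by (rule suminf_linear[OF S S S]) (unfold zero_coeff_l zero_coeff_m[of k l m], simp add: algebra_simps)
  have C: "fls_const u * fls_const v * fls_const w = fls_const (u * (v * w))" for u v w :: complex
    by (simp add: mult.assoc)
  show ?thesis unfolding contiguous_def C
    unfolding fls_const_mult_const fls_const_add [symmetric] 1 [symmetric, unfolded mult_1_left]
      2 [symmetric, unfolded mult_1_left] 3 4
    by (intro allI conjI refl)
qed

lemma phi21_zero_fun:
  assumes "norm x < 1"
  shows "zero_fun k l m x = qpoch q a k * qpoch q b l / qpoch q c m * phi21 (a * q powi k) (b * q powi l) (c * q powi m) q x"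
proof -
  have eq: "zero_coeff k l m n = qpoch q a k * qpoch q b l / qpoch q c m *
     (qpoch q (a * q powi k) (int n) * qpoch q (b * q powi l) (int n) /
           (qpoch q q (int n) * qpoch q (c * q powi m) (int n)))" for n
    unfolding zero_coeff_def qpoch_add[OF q0 notin(1)] qpoch_add[OF q0 notin(2)] qpoch_add[OF q0 notin(3)]
    by (simp add: mult_ac)
  have nz: "qpoch q a k * qpoch q b l / qpoch q c m \<noteq> 0"
    using qpoch_nonzero[OF q0] notin by simp
  have "summable (\<lambda>n. qpoch q (a * q powi k) (int n) * qpoch q (b * q powi l) (int n) /
           (qpoch q q (int n) * qpoch q (c * q powi m) (int n)) * x ^ n)"
    using summable_zero_coeff[OF assms, of k l m] unfolding eq mult.assoc[of "qpoch q a k * qpoch q b l / qpoch q c m"]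
    by (subst (asm) summable_cmult_iff) (use nz in simp)
  thus ?thesis unfolding zero_fun_def phi21_def eq mult.assoc[of "qpoch q a k * qpoch q b l / qpoch q c m"]
    by (rule suminf_mult)
qed

lemma isCont_zero_fun:
  assumes "norm x < 1" shows "isCont (zero_fun k l m) x"
proof -
  obtain r where r: "norm x < r" "r < 1" using assms dense by blast
  have "norm x < norm (complex_of_real r)" using r by (smt (verit) norm_of_real norm_ge_zero)
  moreover have "summable (\<lambda>n. zero_coeff k l m n * complex_of_real r ^ n)"
    by (rule summable_zero_coeff) (use r in \<open>smt (verit) norm_of_real norm_ge_zero\<close>)
  ultimately show ?thesis unfolding zero_fun_def [abs_def] by (intro isCont_powser)
qed

section \<open>The solutions at infinity\<close>

text \<open>The solution at infinity is \<open>x\<^bsup>-\<alpha>\<^esup>\<close> with \<open>q\<^sup>\<alpha> = a\<close> times a series in \<open>1/x\<close>; here \<open>N\<close> is the exponent of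
  \<open>1/x\<close> without \<open>\<alpha>\<close>. Its coefficients have to satisfy the recurrences of \<open>zero_coeff\<close> with \<open>q\<^sup>n\<close> replaced by
  \<open>q\<^bsup>-N\<^esup>/a\<close>. The signs and powers of \<open>q\<close> below arise when the shifted factorials of \<open>inf_coeff\<close>, which have
  \<open>N\<close> in their index, are used to solve them.\<close>

definition inf_pow :: "int \<Rightarrow> int \<Rightarrow> int \<Rightarrow> int \<Rightarrow> complex" where
  "inf_pow k l m N = (-1) powi (k + l + m) * q powi (tri k + tri l - tri m) * (b / a) powi l * (a / c) powi m *
     (c * q / (a * b)) powi N * q powi (N * (m - k - l))"

lemma inf_pow_k: "inf_pow (k + 1) l m N = - (q powi (k - N)) * inf_pow k l m N"
proof -
  have e: "tri k + k + tri l - tri m = (tri k + tri l - tri m) + k"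
    "N * (m - (k + 1) - l) = N * (m - k - l) - N" "k + 1 + l + m = (k + l + m) + 1"
    by (simp_all add: algebra_simps)
  show ?thesis unfolding inf_pow_def tri_plus1 e
    using q0 by (simp add: power_int_add power_int_diff mult_ac)
qed

lemma inf_pow_l: "inf_pow k (l + 1) m N = - (b / a * q powi (l - N)) * inf_pow k l m N"
proof -
  have e: "tri k + (tri l + l) - tri m = (tri k + tri l - tri m) + l"
    "N * (m - k - (l + 1)) = N * (m - k - l) - N" "k + (l + 1) + m = (k + l + m) + 1"
    by (simp_all add: algebra_simps)
  show ?thesis unfolding inf_pow_def tri_plus1 e
    using q0 a0 b0 by (simp add: power_int_add power_int_diff mult_ac)
qed

lemma inf_pow_m: "inf_pow k l (m + 1) N = - (a / c * q powi (N - m)) * inf_pow k l m N"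
proof -
  have e: "tri k + tri l - (tri m + m) = (tri k + tri l - tri m) - m"
    "N * (m + 1 - k - l) = N * (m - k - l) + N" "k + l + (m + 1) = (k + l + m) + 1"
    by (simp_all add: algebra_simps)
  show ?thesis unfolding inf_pow_def tri_plus1 e
    using q0 a0 c0 by (simp add: power_int_add power_int_diff mult_ac)
qed

lemma inf_pow_N: "inf_pow k l m (N + 1) = c * q / (a * b) * q powi (m - k - l) * inf_pow k l m N"
proof -
  have e: "(N + 1) * (m - k - l) = N * (m - k - l) + (m - k - l)" by (simp add: algebra_simps)
  show ?thesis unfolding inf_pow_def e
    using q0 a0 b0 c0 by (simp add: power_int_add[of _ N] power_int_add[of q "N * (m - k - l)"])
qed

definition inf_coeff :: "int \<Rightarrow> int \<Rightarrow> int \<Rightarrow> int \<Rightarrow> complex" where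
  "inf_coeff k l m N = inf_pow k l m N * qpoch q a N * qpoch q (a * q / c) (N - m) * inverse (qpoch q q (N - k)) /
     qpoch q (a * q / b) (N - l)"

lemma notin': "a * q / c \<notin> qpowers q" "a * q / b \<notin> qpowers q" "b * q / c \<notin> qpowers q" "b * q / a \<notin> qpowers q"
  using notin qpowers_mult_powi_iff[OF q0, of "a / c" 1] qpowers_mult_powi_iff[OF q0, of "a / b" 1]
    qpowers_mult_powi_iff[OF q0, of "b / c" 1] qpowers_mult_powi_iff[OF q0, of "b / a" 1]
  by simp_all

text \<open>As \<open>q\<^bsup>k - N\<^esup> = aq\<^sup>k \<cdot> q\<^bsup>-N\<^esup>/a\<close>, and similarly below, these are the recurrences of \<open>zero_coeff\<close> at the
  exponent \<open>-\<alpha> - N\<close>.\<close>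

lemma inf_coeff_k: "inf_coeff (k + 1) l m N = (1 - q powi (k - N)) * inf_coeff k l m N"
proof -
  have 1: "inverse (qpoch q q (N - (k + 1))) = inverse (qpoch q q (N - k)) * (1 - q powi (N - k))"
    using inverse_qpoch_q_rec[OF q, of "N - k"] by (simp add: algebra_simps)
  have 2: "- (q powi (k - N)) * (1 - q powi (N - k)) = 1 - q powi (k - N)"
    using q0 by (simp add: algebra_simps power_int_diff)
  have "inf_coeff (k + 1) l m N = - (q powi (k - N)) * (1 - q powi (N - k)) * inf_coeff k l m N"
    unfolding inf_coeff_def inf_pow_k 1 by (simp only: times_divide_eq_right times_divide_eq_left mult_ac)
  thus ?thesis unfolding 2 .
qed

lemma inf_coeff_l: "inf_coeff k (l + 1) m N = (1 - b / a * q powi (l - N)) * inf_coeff k l m N"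
proof -
  have e: "N - l = (N - (l + 1)) + 1" by simp
  define z where "z = 1 - a * q / b * q powi (N - (l + 1))"
  have z: "z \<noteq> 0" unfolding z_def by (rule one_minus_qpow_nonzero[OF q0 notin'(2)])
  have 1: "qpoch q (a * q / b) (N - l) = qpoch q (a * q / b) (N - (l + 1)) * z"
    unfolding z_def by (subst e) (rule qpoch_rec[OF q0 notin'(2)])
  have "- (b / a * q powi (l - N)) * z = 1 - b / a * q powi (l - N)"
    using q0 a0 b0 by (simp add: z_def field_simps power_int_diff power_int_add)
  hence 2: "- (b / a * q powi (l - N)) = (1 - b / a * q powi (l - N)) / z"
    by (intro eq_divideI z)
  show ?thesis
    unfolding inf_coeff_def inf_pow_l 1 2 by (simp add: mult_ac)
qed

lemma inf_coeff_m: "inf_coeff k l m N = (1 - c / a * q powi (m - N)) * inf_coeff k l (m + 1) N"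
proof -
  have e: "N - m = (N - (m + 1)) + 1" by simp
  define z where "z = 1 - a * q / c * q powi (N - (m + 1))"
  have 1: "qpoch q (a * q / c) (N - m) = qpoch q (a * q / c) (N - (m + 1)) * z"
    unfolding z_def by (subst e) (rule qpoch_rec[OF q0 notin'(1)])
  have "z = (1 - c / a * q powi (m - N)) * (- (a / c * q powi (N - m)))"
    using q0 a0 c0 by (simp add: z_def field_simps power_int_diff power_int_add)
  thus ?thesis
    unfolding inf_coeff_def inf_pow_m 1 by simp
qed

lemma inf_coeff_klm: "inf_coeff (k + 1) (l + 1) (m + 1) (N + 1) = (1 - q powi (- N) / a) * inf_coeff k l m N"
proof -
  have p: "inf_pow (k + 1) (l + 1) (m + 1) (N + 1) = - (q powi (- N) / a) * inf_pow k l m N"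
    unfolding inf_pow_N inf_pow_k inf_pow_l inf_pow_m
    using q0 a0 b0 c0 by (simp add: field_simps power_int_diff power_int_add power_int_minus)
  have e: "N + 1 - (i + 1) = N - i" for i by simp
  have 2: "- (q powi (- N) / a) * (1 - a * q powi N) = 1 - q powi (- N) / a"
    using q0 a0 by (simp add: field_simps power_int_minus)
  have "inf_coeff (k + 1) (l + 1) (m + 1) (N + 1) = - (q powi (- N) / a) * (1 - a * q powi N) * inf_coeff k l m N"
    unfolding inf_coeff_def p e qpoch_rec[OF q0 notin(1)]
    by (simp only: times_divide_eq_right times_divide_eq_left mult_ac)
  thus ?thesis unfolding 2 .
qed

text \<open>The factor \<open>1 / (q)\<^bsub>N - k\<^esub>\<close> stops the series at \<open>N = k\<close>, so that it is a Laurent series in \<open>1/x\<close>.\<close>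

lemma inf_coeff_below: "N < k \<Longrightarrow> inf_coeff k l m N = 0"
  using inverse_qpoch_q_neg[OF q, of "N - k"] by (simp add: inf_coeff_def)

definition inf_sol :: "int \<Rightarrow> int \<Rightarrow> int \<Rightarrow> complex fls" where
  "inf_sol k l m = fls_shift (- k) (fps_to_fls (Abs_fps (\<lambda>n. inf_coeff k l m (k + int n))))"

lemma inf_sol_nth: "inf_sol k l m $$ N = inf_coeff k l m N"
  using inf_coeff_below[of N k] by (simp add: inf_sol_def)

text \<open>The second solution at infinity is the same one with \<open>a\<close> and \<open>b\<close> exchanged.\<close>

theorem contiguous_inf_sol: "contiguous a b c q fls_X_inv inf_sol"
proof -
  define p where "p = (\<lambda>N. q powi (- N) / a)"
  have t: "q powi (k - N) = a * q powi k * p N"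
    "b / a * q powi (k - N) = b * q powi k * p N"
    "c / a * q powi (k - N) = c * q powi k * p N" for k N
  proof -
    have "q powi (k - N) = q powi k * q powi (- N)" using q0 by (simp flip: power_int_add)
    thus "q powi (k - N) = a * q powi k * p N" "b / a * q powi (k - N) = b * q powi k * p N"
      "c / a * q powi (k - N) = c * q powi k * p N"
      using a0 by (simp_all add: p_def)
  qed
  have X: "(fls_const u * fls_X_inv * f) $$ N = u * f $$ (N + 1)" for u N and f :: "complex fls"
    by (simp only: mult.assoc fls_mult_const_nth fls_X_inv_times_conv_shift(1) fls_shift_nth)
  have 1: "inf_coeff (k + 1) l m N = (1 - a * q powi k * p N) * inf_coeff k l m N"
    "inf_coeff k (l + 1) m N = (1 - b * q powi l * p N) * inf_coeff k l m N"
    "inf_coeff k l m N = (1 - c * q powi m * p N) * inf_coeff k l (m + 1) N"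
    "inf_coeff (k + 1) (l + 1) (m + 1) (N + 1) = (1 - p N) * inf_coeff k l m N" for k l m N
    using inf_coeff_k[of k l m N] inf_coeff_l[of k l m N] inf_coeff_m[of k l m N] inf_coeff_klm[of k l m N]
    by (simp_all only: t(1)[of k N] t(2)[of l N] t(3)[of m N] p_def)
  have A: "inf_sol (k + 1) l m = fls_const (1 - a * q powi k) * inf_sol k l m +
      fls_const (a * q powi k) * fls_X_inv * inf_sol (k + 1) (l + 1) (m + 1)" for k l m
    by (rule fls_eqI) (simp only: fls_plus_nth X fls_mult_const_nth inf_sol_nth 1(4),
        simp only: 1(1), simp add: algebra_simps)
  have B: "inf_sol k (l + 1) m = fls_const (1 - b * q powi l) * inf_sol k l m +
      fls_const (b * q powi l) * fls_X_inv * inf_sol (k + 1) (l + 1) (m + 1)" for k l m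
    by (rule fls_eqI) (simp only: fls_plus_nth X fls_mult_const_nth inf_sol_nth 1(4),
        simp only: 1(2), simp add: algebra_simps)
  have C: "fls_const (c * q powi m) * inf_sol (k + 1) l (m + 1) = fls_const (a * q powi k) * inf_sol k l m +
      fls_const (c * q powi m - a * q powi k) * inf_sol k l (m + 1)" for k l m
    by (rule fls_eqI) (simp only: fls_plus_nth X fls_mult_const_nth inf_sol_nth 1(1) 1(3)[of k l m],
        simp add: algebra_simps)
  have D: "fls_const (c * q powi m) * inf_sol k (l + 1) (m + 1) = fls_const (b * q powi l) * inf_sol k l m +
      fls_const (c * q powi m - b * q powi l) * inf_sol k l (m + 1)" for k l m
    by (rule fls_eqI) (simp only: fls_plus_nth X fls_mult_const_nth inf_sol_nth 1(2) 1(3)[of k l m],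
        simp add: algebra_simps)
  show ?thesis
    unfolding contiguous_def by (intro allI conjI A B C D)
qed

end

section \<open>Euler's transformation for formal power series\<close>

text \<open>The substitution \<open>x \<mapsto> qx\<close>.\<close>

definition dil :: "complex \<Rightarrow> complex fps \<Rightarrow> complex fps" where
  "dil q f = Abs_fps (\<lambda>n. q ^ n * fps_nth f n)"

lemma dil_nth [simp]: "fps_nth (dil q f) n = q ^ n * fps_nth f n"
  by (simp add: dil_def)

lemma dil_mult: "dil q (f * g) = dil q f * dil q g"
proof (rule fps_ext)
  fix n
  have "q ^ n * (fps_nth f i * fps_nth g (n - i)) = q ^ i * fps_nth f i * (q ^ (n - i) * fps_nth g (n - i))"
    if "i \<in> {0..n}" for i
    using that by (simp flip: power_add)
  thus "fps_nth (dil q (f * g)) n = fps_nth (dil q f * dil q g) n"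
    unfolding dil_nth fps_mult_nth sum_distrib_left by (rule sum.cong[OF refl])
qed

lemma dil_diff: "dil q (f - g) = dil q f - dil q g"
  and dil_const: "dil q (fps_const t * f) = fps_const t * dil q f"
  and dil_X: "dil q (fps_X) = fps_const q * fps_X"
  and dil_1: "dil q 1 = 1"
  and dil_fps_const: "dil q (fps_const t) = fps_const t"
  by (auto intro!: fps_ext simp: algebra_simps)

text \<open>By the \<open>q\<close>-binomial theorem this is \<open>(yVx)\<^sub>\<infinity> / (Vx)\<^sub>\<infinity>\<close>; the series replaces the product because
  all identities are formal.\<close>

definition qbin :: "complex \<Rightarrow> complex \<Rightarrow> complex \<Rightarrow> complex fps" where
  "qbin q y V = Abs_fps (\<lambda>n. qpoch q y (int n) / qpoch q q (int n) * V ^ n)"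

definition hyp :: "complex \<Rightarrow> complex \<Rightarrow> complex \<Rightarrow> complex \<Rightarrow> complex \<Rightarrow> complex fps" where
  "hyp q A B C V = Abs_fps (\<lambda>n. qpoch q A (int n) * qpoch q B (int n) / (qpoch q q (int n) * qpoch q C (int n)) * V ^ n)"

lemma qpow_Suc_neq: "unit_disc q \<Longrightarrow> 1 - q ^ Suc n \<noteq> 0"
  using q_pow_neq_1[of q "int (Suc n)"] by (simp del: of_nat_Suc power_Suc)

lemma qbin_0 [simp]: "fps_nth (qbin q y V) 0 = 1"
  and hyp_0 [simp]: "fps_nth (hyp q A B C V) 0 = 1"
  using qpoch_0 by (simp_all add: qbin_def hyp_def)

lemma qbin_rec:
  assumes "unit_disc q"
  shows "(1 - q ^ Suc n) * fps_nth (qbin q y V) (Suc n) = (1 - y * q ^ n) * V * fps_nth (qbin q y V) n"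
  using qpow_Suc_neq[OF assms, of n] qpoch_q_nonzero[OF assms, of n]
  unfolding qbin_def fps_nth_Abs_fps qpoch_nat_Suc by (simp add: divide_simps)

lemma hyp_rec:
  assumes "unit_disc q" "C \<notin> qpowers q"
  shows "(1 - q ^ Suc n) * (1 - C * q ^ n) * fps_nth (hyp q A B C V) (Suc n) =
         V * (1 - A * q ^ n) * (1 - B * q ^ n) * fps_nth (hyp q A B C V) n"
  using qpow_Suc_neq[OF assms(1), of n] qpoch_q_nonzero[OF assms(1), of n]
    one_minus_qpow_nonzero[OF unit_disc_nonzero[OF assms(1)] assms(2), of "int n"]
    qpoch_nonzero[OF unit_disc_nonzero[OF assms(1)] assms(2), of "int n"]
  unfolding hyp_def fps_nth_Abs_fps qpoch_nat_Suc by (simp add: divide_simps)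

lemma hyp_unique:
  assumes "unit_disc q" "C \<notin> qpowers q" "fps_nth f 0 = 1"
    and "\<And>n. (1 - q ^ Suc n) * (1 - C * q ^ n) * fps_nth f (Suc n) = V * (1 - A * q ^ n) * (1 - B * q ^ n) * fps_nth f n"
  shows "f = hyp q A B C V"
proof (rule fps_ext)
  fix n show "fps_nth f n = fps_nth (hyp q A B C V) n"
  proof (induction n)
    case (Suc n)
    have "(1 - q ^ Suc n) * (1 - C * q ^ n) \<noteq> 0"
      using qpow_Suc_neq[OF assms(1), of n]
        one_minus_qpow_nonzero[OF unit_disc_nonzero[OF assms(1)] assms(2), of "int n"] by simp
    moreover have "(1 - q ^ Suc n) * (1 - C * q ^ n) * fps_nth f (Suc n) =
        (1 - q ^ Suc n) * (1 - C * q ^ n) * fps_nth (hyp q A B C V) (Suc n)"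
      unfolding assms(4) hyp_rec[OF assms(1,2)] Suc.IH ..
    ultimately show ?case by (metis mult_left_cancel)
  qed (simp add: assms(3))
qed

text \<open>Recurrences of the coefficients as functional equations under \<open>x \<mapsto> q x\<close>.\<close>

lemma qbin_functional:
  assumes "unit_disc q"
  shows "(1 - fps_const V * fps_X) * qbin q y V = (1 - fps_const (y * V) * fps_X) * dil q (qbin q y V)"
proof (rule fps_ext)
  fix n
  show "fps_nth ((1 - fps_const V * fps_X) * qbin q y V) n =
        fps_nth ((1 - fps_const (y * V) * fps_X) * dil q (qbin q y V)) n"
  proof (cases n)
    case (Suc m)
    show ?thesis using qbin_rec[OF assms, of m y V] unfolding Suc
      by (simp add: left_diff_distrib mult.assoc algebra_simps)
  qed (simp add: left_diff_distrib mult.assoc)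
qed

definition hyp_operator ::
  "complex \<Rightarrow> complex \<Rightarrow> complex \<Rightarrow> complex \<Rightarrow> complex \<Rightarrow> complex fps \<Rightarrow> complex fps" where
  "hyp_operator q s C V t f = (1 - fps_const V * fps_X) * f
     - (fps_const (1 + C / q) - fps_const s * fps_X) * dil q f
     + (fps_const (C / q) - fps_const t * fps_X) * dil q (dil q f)"

lemma hyp_operator_nth:
  assumes "q \<noteq> 0"
  shows "fps_nth (hyp_operator q ((A + B) * V) C V (A * B * V) f) (Suc n) =
    (1 - q ^ Suc n) * (1 - C * q ^ n) * fps_nth f (Suc n) - V * (1 - A * q ^ n) * (1 - B * q ^ n) * fps_nth f n"
proof -
  define g where "g = C / q"
  have C: "C = g * q" using assms by (simp add: g_def)
  show ?thesis unfolding hyp_operator_def g_def [symmetric] unfolding C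
    by (simp add: left_diff_distrib mult.assoc) (simp add: algebra_simps)
qed

lemma hyp_operator_nth_0: "fps_nth (hyp_operator q s C V t f) 0 = 0"
  by (simp add: hyp_operator_def left_diff_distrib ring_distribs mult.assoc)

lemma hyp_operator_hyp:
  assumes "unit_disc q" "C \<notin> qpowers q"
  shows "hyp_operator q ((A + B) * V) C V (A * B * V) (hyp q A B C V) = 0"
proof (rule fps_ext)
  fix n show "fps_nth (hyp_operator q ((A + B) * V) C V (A * B * V) (hyp q A B C V)) n = fps_nth 0 n"
    by (cases n) (simp_all add: hyp_operator_nth_0 hyp_operator_nth[OF unit_disc_nonzero[OF assms(1)]]
        hyp_rec[OF assms] del: power_Suc)
qed

text \<open>Both sides are determined by the \<open>q\<close>-difference equation of \<open>\<^sub>2\<phi>\<^sub>1\<close> and the constant term \<open>1\<close>. The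
  \<open>q\<close>-binomial factor satisfies an equation of order one, and conjugating the equation with it yields an
  equation of the same form with new parameters.\<close>

theorem euler_transformation:
  assumes q: "unit_disc q" and C: "C \<notin> qpowers q" and nz: "A \<noteq> 0" "B \<noteq> 0" "C \<noteq> 0"
  shows "hyp q A B C V = qbin q (A * B / C) V * hyp q (C / A) (C / B) C (A * B * V / C)"
proof (rule hyp_unique [symmetric, OF q C])
  have q0: "q \<noteq> 0" using q by (rule unit_disc_nonzero)
  define W where "W = A * B * V / C"
  define H where "H = qbin q (A * B / C) V"
  define Psi where "Psi = hyp q (C / A) (C / B) C W"
  define e f e' f' where "e = (1 - fps_const V * fps_X)" and "f = (1 - fps_const W * fps_X)"
    and "e' = (1 - fps_const (q * V) * fps_X)" and "f' = (1 - fps_const (q * W) * fps_X)"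
  define bb where "bb = fps_const (1 + C / q) - fps_const ((A + B) * V) * fps_X"
  have W: "A * B / C * V = W" by (simp add: W_def)
  have H1: "e * H = f * dil q H"
    using qbin_functional[OF q, of V "A * B / C"] unfolding W H_def e_def f_def .
  have de: "dil q e = e'" "dil q f = f'"
    unfolding e_def f_def e'_def f'_def
    unfolding dil_diff dil_const dil_X dil_1 mult.assoc [symmetric] fps_const_mult
    by (simp_all only: mult.commute[of _ q])
  have H2: "e' * dil q H = f' * dil q (dil q H)"
    using arg_cong[OF H1, of "dil q"] unfolding dil_mult de .
  have s: "(C / A + C / B) * W = (A + B) * V" "C / A * (C / B) * W = C / q * (q * V)" "A * B * V = C / q * (q * W)"
  proof -
    have 1: "C / A * W = B * V" "C / B * W = A * V" "C * W = A * B * V"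
      using nz by (simp_all add: W_def)
    show "(C / A + C / B) * W = (A + B) * V"
      unfolding distrib_right 1 by (rule add.commute)
    have "C / A * (C / B) * W = C / B * (C / A * W)" by (simp only: mult_ac)
    also have "\<dots> = C * V" unfolding 1 using nz by simp
    finally show "C / A * (C / B) * W = C / q * (q * V)" using q0 by simp
    show "A * B * V = C / q * (q * W)" unfolding 1(3) [symmetric] using q0 by simp
  qed
  have Psi: "f * Psi - bb * dil q Psi + fps_const (C / q) * e' * dil q (dil q Psi) = 0"
  proof -
    have "fps_const (C / q) * e' = fps_const (C / q) - fps_const (C / q * (q * V)) * fps_X"
      unfolding e'_def right_diff_distrib mult_1_right mult.assoc [symmetric] fps_const_mult ..
    thus ?thesis
      using hyp_operator_hyp[OF q C, of "C / A" "C / B" W]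
      unfolding hyp_operator_def Psi_def f_def bb_def s by simp
  qed
  have f': "fps_const (C / q) * f' = fps_const (C / q) - fps_const (A * B * V) * fps_X"
    unfolding f'_def s(3) right_diff_distrib mult_1_right mult.assoc [symmetric] fps_const_mult ..
  have "hyp_operator q ((A + B) * V) C V (A * B * V) (H * Psi) =
     (e * H) * Psi - bb * dil q H * dil q Psi + fps_const (C / q) * (f' * dil q (dil q H)) * dil q (dil q Psi)"
    unfolding hyp_operator_def dil_mult e_def bb_def f' [symmetric] by (simp add: algebra_simps)
  also have "\<dots> = dil q H * (f * Psi - bb * dil q Psi + fps_const (C / q) * e' * dil q (dil q Psi))"
    unfolding H1 H2 [symmetric] by (simp add: algebra_simps)
  also have "\<dots> = 0" unfolding Psi by simp
  finally have op: "hyp_operator q ((A + B) * V) C V (A * B * V) (H * Psi) = 0" .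
  show "(1 - q ^ Suc n) * (1 - C * q ^ n) * fps_nth (qbin q (A * B / C) V * hyp q (C / A) (C / B) C (A * B * V / C)) (Suc n) =
    V * (1 - A * q ^ n) * (1 - B * q ^ n) * fps_nth (qbin q (A * B / C) V * hyp q (C / A) (C / B) C (A * B * V / C)) n" for n
    using arg_cong[OF op, of "\<lambda>f. fps_nth f (Suc n)"] hyp_operator_nth[OF q0, of A B V C "H * Psi" n]
    unfolding H_def Psi_def W_def by simp
qed simp

text \<open>In terms of infinite products: \<open>(yVx)\<^sub>\<infinity> / (Vx/q)\<^sub>\<infinity>\<close> loses the factor \<open>1 - Vx/q\<close> of its denominator.\<close>

lemma qbin_step:
  assumes "unit_disc q"
  shows "qbin q (y * q) (V / q) * (1 - fps_const (V / q) * fps_X) = qbin q y V"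
proof (rule fps_ext)
  fix n
  have q0: "q \<noteq> 0" using assms by (rule unit_disc_nonzero)
  show "fps_nth (qbin q (y * q) (V / q) * (1 - fps_const (V / q) * fps_X)) n = fps_nth (qbin q y V) n"
  proof (cases n)
    case 0
    thus ?thesis by (simp add: mult.commute left_diff_distrib mult.assoc)
  next
    case (Suc m)
    have s: "qpoch q y (int (Suc m)) = (1 - y) * qpoch q (y * q) (int m)"
      using qpoch_add_nonneg[OF q0, of 1 "int m" y] by (simp add: qpoch_def)
    have s': "qpoch q (y * q) (int (Suc m)) = qpoch q (y * q) (int m) * (1 - y * q ^ Suc m)"
      unfolding qpoch_nat_Suc by simp
    have nz: "qpoch q q (int m) \<noteq> 0" "1 - q ^ Suc m \<noteq> 0" using qpoch_q_nonzero[OF assms] qpow_Suc_neq[OF assms] by blast+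
    have "fps_nth (qbin q (y * q) (V / q) * (1 - fps_const (V / q) * fps_X)) n
       = fps_nth (qbin q (y * q) (V / q)) (Suc m) - V / q * fps_nth (qbin q (y * q) (V / q)) m"
      by (simp add: Suc right_diff_distrib mult.assoc mult.left_commute[of _ "fps_const _"])
    also have "\<dots> = qpoch q (y * q) (int m) / (qpoch q q (int m) * (1 - q ^ Suc m)) * (V / q) ^ Suc m *
        ((1 - y * q ^ Suc m) - (1 - q ^ Suc m))"
    proof -
      have arith: "P * Y / (Q * r) * (v * z) - v * (P / Q * z) = P / (Q * r) * (v * z) * (Y - r)"
        if "Q \<noteq> 0" "r \<noteq> 0" for P Q Y r v z :: complex
        using that by (simp add: field_simps)
      show ?thesis
        unfolding qbin_def fps_nth_Abs_fps s' qpoch_nat_Suc[of q q] power_Suc[symmetric, of q] power_Suc[of "V / q"]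
        by (rule arith) (use nz in simp_all)
    qed
    also have "(1 - y * q ^ Suc m) - (1 - q ^ Suc m) = q ^ Suc m * (1 - y)" by (simp add: algebra_simps)
    also have "qpoch q (y * q) (int m) / (qpoch q q (int m) * (1 - q ^ Suc m)) * (V / q) ^ Suc m * (q ^ Suc m * (1 - y))
       = fps_nth (qbin q y V) n"
      using q0 unfolding Suc qbin_def fps_nth_Abs_fps s qpoch_nat_Suc[of q q]
      by (simp add: power_divide)
    finally show ?thesis .
  qed
qed

section \<open>Products of two series as terminating series\<close>

lemma qpoch_terminating: "q \<noteq> 0 \<Longrightarrow> i > n \<Longrightarrow> qpoch q (q powi (- int n)) (int i) = 0"
  unfolding qpoch_nat by (rule prod_zero) (auto simp: power_int_minus intro!: bexI[of _ n])

lemma phi43_terminating: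
  assumes "q \<noteq> 0"
  shows "phi43 (q powi (- int n)) a1 a2 a3 b1 b2 b3 q z =
     (\<Sum>i\<le>n. qpoch q (q powi (- int n)) (int i) * qpoch q a1 (int i) * qpoch q a2 (int i) * qpoch q a3 (int i) /
           (qpoch q q (int i) * qpoch q b1 (int i) * qpoch q b2 (int i) * qpoch q b3 (int i)) * z ^ i)"
  unfolding phi43_def
  by (rule suminf_finite) (use qpoch_terminating[OF assms] in \<open>auto simp: not_le\<close>)

text \<open>Reversal of the order of multiplication in the shifted factorials: \<open>(u)\<^bsub>n - i\<^esub>\<close> is, up to an elementary
  factor, \<open>(u)\<^sub>n / (q\<^bsup>1 - n\<^esup>/u)\<^sub>i\<close>. The elementary factors combine to the \<open>i\<close>-th power of a constant.\<close>

lemma reversed_coeff: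
  assumes q: "unit_disc q" and u: "u1 \<notin> qpowers q" "u2 \<notin> qpowers q" "u4 \<notin> qpowers q"
    and nz: "u1 \<noteq> 0" "u2 \<noteq> 0" "u4 \<noteq> 0" "V \<noteq> 0" and "i \<le> n"
  shows "fps_nth (hyp q u1 u2 u4 V) (n - i) = fps_nth (hyp q u1 u2 u4 V) n *
     (qpoch q (q powi (- int n)) (int i) * qpoch q (q powi (1 - int n) / u4) (int i) /
      (qpoch q (q powi (1 - int n) / u1) (int i) * qpoch q (q powi (1 - int n) / u2) (int i))) *
     (q * u4 / (u1 * u2 * V)) ^ i"
  using \<open>i \<le> n\<close>
proof (induction i)
  case 0 show ?case using qpoch_0 by simp
next
  case (Suc i)
  have q0: "q \<noteq> 0" using q by (rule unit_disc_nonzero)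
  define j where "j = n - Suc i"
  have j: "n - i = Suc j" "n - Suc i = j" using Suc.prems by (auto simp: j_def)
  define w where "w = q ^ j"
  have w: "w \<noteq> 0" using q0 by (simp add: w_def)
  have p: "q powi (1 - int n) * q ^ i = 1 / w"
  proof -
    have "q powi (1 - int n) * q ^ i = q powi (1 - int n + int i)"
      unfolding power_int_add[OF disjI1[OF q0]] power_int_of_nat ..
    also have "1 - int n + int i = - int j" using Suc.prems by (simp add: j_def)
    finally show ?thesis by (simp add: w_def power_int_minus divide_inverse)
  qed
  have p': "q powi (- int n) * q ^ i = 1 / (q * w)"
  proof -
    have "q powi (- int n) * q ^ i = q powi (- int n + int i)"
      unfolding power_int_add[OF disjI1[OF q0]] power_int_of_nat ..
    also have "- int n + int i = - int (Suc j)" using Suc.prems by (simp add: j_def)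
    finally show ?thesis by (simp add: w_def power_int_minus divide_inverse del: of_nat_Suc)
  qed
  have f: "1 - u * w \<noteq> 0" if "u \<notin> qpowers q" for u
    using one_minus_qpow_nonzero[OF q0 that, of "int j"] by (simp add: w_def)
  have regroup: "T * (P1 * P2 / (R1 * R2)) * z * (x * y / (u * v) * t) = T * (P1 * x * (P2 * y) / (R1 * u * (R2 * v))) * (t * z)"
    for T P1 P2 R1 R2 x y z u v t :: complex
    by (simp add: divide_inverse mult_ac)
  have qw: "1 - q * w \<noteq> 0" using qpow_Suc_neq[OF q, of j] by (simp add: w_def)
  have rec: "(1 - q * w) * (1 - u4 * w) * fps_nth (hyp q u1 u2 u4 V) (Suc j) =
         V * (1 - u1 * w) * (1 - u2 * w) * fps_nth (hyp q u1 u2 u4 V) j"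
    using hyp_rec[OF q u(3), of j u1 u2 V] by (simp add: w_def)
  have ratio: "(1 - q powi (- int n) * q ^ i) * (1 - q powi (1 - int n) / u4 * q ^ i) /
      ((1 - q powi (1 - int n) / u1 * q ^ i) * (1 - q powi (1 - int n) / u2 * q ^ i)) * (q * u4 / (u1 * u2 * V))
     = (1 - q * w) * (1 - u4 * w) / (V * (1 - u1 * w) * (1 - u2 * w))"
  proof -
    have d: "1 - q powi (1 - int n) / u * q ^ i = - ((1 - u * w) / (u * w))" if "u \<noteq> 0" for u
    proof -
      have "q powi (1 - int n) / u * q ^ i = 1 / (w * u)"
        unfolding times_divide_eq_left p by simp
      thus ?thesis using that w by (simp add: field_simps)
    qed
    have d': "1 - q powi (- int n) * q ^ i = - ((1 - q * w) / (q * w))"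
      unfolding p' using q0 w by (simp add: field_simps)
    have "- (x / (q * w)) * - (y / (u4 * w)) / (- (z / (u1 * w)) * - (t / (u2 * w))) * (q * u4 / (u1 * u2 * V))
       = x * y / (V * z * t)" if "z \<noteq> 0" "t \<noteq> 0" for x y z t
      using that q0 w nz by (simp add: field_simps)
    thus ?thesis unfolding d[OF nz(1)] d[OF nz(2)] d[OF nz(3)] d'
      using f[OF u(1)] f[OF u(2)] by blast
  qed
  have "fps_nth (hyp q u1 u2 u4 V) (n - Suc i) = fps_nth (hyp q u1 u2 u4 V) (n - i) *
     ((1 - q * w) * (1 - u4 * w) / (V * (1 - u1 * w) * (1 - u2 * w)))"
    using rec f[OF u(1)] f[OF u(2)] nz(4) unfolding j by (simp add: divide_simps mult_ac)
  also have "\<dots> = fps_nth (hyp q u1 u2 u4 V) n *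
     (qpoch q (q powi (- int n)) (int (Suc i)) * qpoch q (q powi (1 - int n) / u4) (int (Suc i)) /
      (qpoch q (q powi (1 - int n) / u1) (int (Suc i)) * qpoch q (q powi (1 - int n) / u2) (int (Suc i)))) *
     (q * u4 / (u1 * u2 * V)) ^ Suc i"
    unfolding ratio [symmetric] Suc.IH[OF Suc_leD[OF Suc.prems]] qpoch_nat_Suc power_Suc[of "_ / _"]
    by (rule regroup)
  finally show ?case .
qed

text \<open>With one factor reversed, the Cauchy product is a terminating series of type \<open>\<^sub>4\<phi>\<^sub>3\<close>.\<close>

theorem hyp_mult_nth:
  assumes q: "unit_disc q" and u: "u1 \<notin> qpowers q" "u2 \<notin> qpowers q" "u4 \<notin> qpowers q"
    and nz: "u1 \<noteq> 0" "u2 \<noteq> 0" "u4 \<noteq> 0" "V \<noteq> 0"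
  shows "fps_nth (hyp q s1 s2 s4 V' * hyp q u1 u2 u4 V) n = fps_nth (hyp q u1 u2 u4 V) n *
     phi43 (q powi (- int n)) (q powi (1 - int n) / u4) s1 s2
           s4 (q powi (1 - int n) / u1) (q powi (1 - int n) / u2) q (V' * (q * u4 / (u1 * u2 * V)))"
proof -
  have "fps_nth (hyp q s1 s2 s4 V' * hyp q u1 u2 u4 V) n =
      (\<Sum>i\<le>n. fps_nth (hyp q s1 s2 s4 V') i * fps_nth (hyp q u1 u2 u4 V) (n - i))"
    by (simp add: fps_mult_nth atMost_atLeast0)
  also have "\<dots> = fps_nth (hyp q u1 u2 u4 V) n *
     phi43 (q powi (- int n)) (q powi (1 - int n) / u4) s1 s2
           s4 (q powi (1 - int n) / u1) (q powi (1 - int n) / u2) q (V' * (q * u4 / (u1 * u2 * V)))"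
    unfolding phi43_terminating[OF unit_disc_nonzero[OF q]] sum_distrib_left
  proof (rule sum.cong[OF refl], goal_cases)
    case (1 i)
    hence i: "i \<le> n" by simp
    have s: "fps_nth (hyp q s1 s2 s4 V') i =
       qpoch q s1 (int i) * qpoch q s2 (int i) / (qpoch q q (int i) * qpoch q s4 (int i)) * V' ^ i"
      by (simp add: hyp_def)
    have "S1 * S2 / (Q * S4) * v * (T * (P1 * P2 / (R1 * R2)) * z) =
        T * (P1 * P2 * S1 * S2 / (Q * S4 * R1 * R2) * (v * z))" for S1 S2 S4 Q v T P1 P2 R1 R2 z :: complex
      by (simp add: divide_inverse mult_ac)
    thus ?case unfolding reversed_coeff[OF q u nz i] s power_mult_distrib[of V'] .
  qed
  finally show ?thesis .
qed

section \<open>The Casoratian of the two solutions at infinity\<close>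

text \<open>An equation of order one determines a series up to its constant term; with this the Casoratian is
  recognised as a \<open>q\<close>-binomial series.\<close>

lemma qbin_unique:
  assumes q: "unit_disc q" and f: "(1 - fps_const V * fps_X) * f = (1 - fps_const (y * V) * fps_X) * dil q f"
  shows "f = fps_const (fps_nth f 0) * qbin q y V"
proof (rule fps_ext)
  fix n show "fps_nth f n = fps_nth (fps_const (fps_nth f 0) * qbin q y V) n"
  proof (induction n)
    case (Suc n)
    have "(1 - q ^ Suc n) * fps_nth f (Suc n) = (1 - y * q ^ n) * V * fps_nth f n"
      using arg_cong[OF f, of "\<lambda>g. fps_nth g (Suc n)"] by (simp add: left_diff_distrib mult.assoc algebra_simps)
    also have "\<dots> = fps_nth f 0 * ((1 - y * q ^ n) * V * fps_nth (qbin q y V) n)"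
      unfolding Suc.IH by simp
    also have "\<dots> = (1 - q ^ Suc n) * (fps_nth f 0 * fps_nth (qbin q y V) (Suc n))"
      unfolding qbin_rec[OF q, symmetric] by simp
    finally show ?case using qpow_Suc_neq[OF q, of n] by simp
  qed simp
qed

context heine_params
begin

text \<open>The three terms of the \<open>q\<close>-difference equation at infinity: \<open>x \<mapsto> qx\<close> acts on \<open>x\<^bsup>-\<alpha>\<^esup> (1/x)\<^sup>n\<close> as the factor
  \<open>(1/a) (1/q)\<^sup>n\<close>.\<close>

definition inf_base :: "complex fps" where
  "inf_base = Abs_fps (\<lambda>n. inf_coeff 0 0 0 (int n))"

definition inf_shift :: "complex fps" where
  "inf_shift = fps_const (1 / a) * dil (1 / q) inf_base"

definition inf_shift2 :: "complex fps" where
  "inf_shift2 = fps_const (1 / a) * dil (1 / q) inf_shift"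

lemma inf_coeff_0: "inf_coeff 0 0 0 0 = 1"
  by (simp add: inf_coeff_def inf_pow_def tri_def)

lemma inf_sol_000: "inf_sol 0 0 0 = fps_to_fls inf_base"
  by (simp add: inf_sol_def inf_base_def)

lemma powi_minus_nat: "q powi (- int n) = (1 / q) ^ n"
  by (simp add: power_int_minus power_one_over divide_inverse power_inverse)

lemma inf_sol_111: "fls_X_inv * inf_sol 1 1 1 = fps_to_fls (inf_base - inf_shift)"
proof (rule fls_eqI)
  fix N
  have 1: "(fls_X_inv * inf_sol 1 1 1) $$ N = (1 - q powi (- N) / a) * inf_coeff 0 0 0 N"
    using inf_coeff_klm[of 0 0 0 N] by (simp add: fls_X_inv_times_conv_shift inf_sol_nth)
  show "(fls_X_inv * inf_sol 1 1 1) $$ N = fps_to_fls (inf_base - inf_shift) $$ N"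
  proof (cases "N < 0")
    case True
    thus ?thesis unfolding 1 using inf_coeff_below[of N 0 0 0] by simp
  next
    case False
    then obtain n where N: "N = int n" using nonneg_eq_int by (metis not_less)
    show ?thesis unfolding 1 unfolding N powi_minus_nat
      by (simp add: inf_base_def inf_shift_def algebra_simps)
  qed
qed

lemma inf_base_rec:
  "(1 - (1 / q) ^ n / a) * (1 - c / a * (1 / q) ^ Suc n) * fps_nth inf_base n =
   (1 - (1 / q) ^ Suc n) * (1 - b / a * (1 / q) ^ Suc n) * fps_nth inf_base (Suc n)"
proof -
  have e: "0 - (int n + 1) = - int (Suc n)" by simp
  have 1: "(1 - q powi (- int n) / a) * inf_coeff 0 0 0 (int n) = inf_coeff 1 1 1 (int n + 1)"
    using inf_coeff_klm[of 0 0 0 "int n"] by simp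
  have 2: "inf_coeff 1 1 0 (int n + 1) = (1 - c / a * q powi (0 - (int n + 1))) * inf_coeff 1 1 1 (int n + 1)"
    using inf_coeff_m[of 1 1 0 "int n + 1"] by simp
  have 3: "inf_coeff 1 1 0 (int n + 1) = (1 - b / a * q powi (0 - (int n + 1))) * ((1 - q powi (0 - (int n + 1))) * inf_coeff 0 0 0 (int n + 1))"
    using inf_coeff_l[of 1 0 0 "int n + 1"] inf_coeff_k[of 0 0 0 "int n + 1"] by simp
  have 4: "inf_coeff 0 0 0 (int n + 1) = fps_nth inf_base (Suc n)" "inf_coeff 0 0 0 (int n) = fps_nth inf_base n"
    by (simp_all add: inf_base_def add.commute)
  have "(1 - c / a * (1 / q) ^ Suc n) * ((1 - (1 / q) ^ n / a) * fps_nth inf_base n)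
     = (1 - b / a * (1 / q) ^ Suc n) * ((1 - (1 / q) ^ Suc n) * fps_nth inf_base (Suc n))"
    using 2 3 unfolding 1 [symmetric] unfolding 4 e powi_minus_nat by simp
  thus ?thesis by (simp only: mult_ac)
qed

lemma inf_base_functional:
  "(1 - fps_X) * inf_base = (fps_const (a + b) - fps_const (1 + c / q) * fps_X) * inf_shift
     - (fps_const (a * b) - fps_const (c / q) * fps_X) * inf_shift2"
proof (rule fps_ext)
  fix n
  show "fps_nth ((1 - fps_X) * inf_base) n = fps_nth ((fps_const (a + b) - fps_const (1 + c / q) * fps_X) * inf_shift
     - (fps_const (a * b) - fps_const (c / q) * fps_X) * inf_shift2) n"
  proof (cases n)
    case 0
    define i where "i = 1 / a"
    have i: "a * i = 1" using a0 by (simp add: i_def)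
    have "(a + b) * (i * f) - a * b * (i * (i * f)) = (a * i) * f + b * i * f - (a * i) * (b * i * f)" for f
      by (simp only: algebra_simps)
    hence "(a + b) * (i * f) - a * b * (i * (i * f)) = f" for f unfolding i by simp
    thus ?thesis unfolding inf_shift_def inf_shift2_def i_def [symmetric] 0
      by (simp add: left_diff_distrib mult.assoc)
  next
    case (Suc m)
    define r where "r = (1 / q) ^ Suc m / a"
    have p: "(1 / q) ^ m / a = q * r" using q0 by (simp add: r_def)
    have s: "fps_nth inf_shift m = q * r * fps_nth inf_base m" "fps_nth inf_shift2 m = q * r * (q * r * fps_nth inf_base m)"
      "fps_nth inf_shift (Suc m) = r * fps_nth inf_base (Suc m)"
      "fps_nth inf_shift2 (Suc m) = r * (r * fps_nth inf_base (Suc m))"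
      unfolding p [symmetric] by (simp_all add: inf_shift_def inf_shift2_def r_def)
    have "c / a * (1 / q) ^ Suc m = c * r" "b / a * (1 / q) ^ Suc m = b * r" "(1 / q) ^ Suc m = a * r"
      using a0 by (simp_all add: r_def)
    hence "(1 - q * r) * (1 - c * r) * fps_nth inf_base m = (1 - a * r) * (1 - b * r) * fps_nth inf_base (Suc m)"
      using inf_base_rec[of m] by (simp only: p)
    moreover have "c / q * (q * r) = c * r" using q0 by simp
    ultimately show ?thesis unfolding Suc using q0
      by (simp add: left_diff_distrib mult.assoc s) (simp add: algebra_simps)
  qed
qed

text \<open>As for a Wronskian, the \<open>q\<close>-difference equation of second order yields one of first order for the
  determinant of two solutions.\<close>

lemma casoratian:
  "inf_sol 1 1 1 * heine_params.inf_sol b a c q 0 0 0 - heine_params.inf_sol b a c q 1 1 1 * inf_sol 0 0 0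
   = fls_const (1 / b - 1 / a) * fls_X * fps_to_fls (qbin q (a * b * q / c) (c / (a * b)))"
proof -
  interpret s: heine_params b a c q by (rule swap)
  define w where "w = inf_base * s.inf_shift - s.inf_base * inf_shift"
  define u where "u = fps_const (a + b) - fps_const (1 + c / q) * fps_X"
  define v where "v = fps_const (a * b) - fps_const (c / q) * fps_X"
  have 1: "(1 - fps_X) * inf_base = u * inf_shift - v * inf_shift2"
    using inf_base_functional by (simp only: u_def v_def)
  have 2: "(1 - fps_X) * s.inf_base = u * s.inf_shift - v * s.inf_shift2"
    using s.inf_base_functional by (simp only: u_def v_def add.commute mult.commute)
  have D: "dil (1 / q) inf_base = fps_const a * inf_shift" "dil (1 / q) inf_shift = fps_const a * inf_shift2"
    "dil (1 / q) s.inf_base = fps_const b * s.inf_shift" "dil (1 / q) s.inf_shift = fps_const b * s.inf_shift2"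
    using a0 b0 by (simp_all add: inf_shift_def inf_shift2_def s.inf_shift_def s.inf_shift2_def flip: mult.assoc)
  have Dw: "dil (1 / q) w = fps_const (a * b) * (inf_shift * s.inf_shift2 - s.inf_shift * inf_shift2)"
    unfolding w_def dil_diff dil_mult D fps_const_mult [symmetric] by (simp only: algebra_simps)
  have v: "v = fps_const (a * b) * (1 - fps_const (c / (q * (a * b))) * fps_X)"
    using a0 b0 unfolding v_def right_diff_distrib mult.assoc [symmetric] fps_const_mult by simp
  have "(1 - fps_X) * w = ((1 - fps_X) * inf_base) * s.inf_shift - ((1 - fps_X) * s.inf_base) * inf_shift"
    unfolding w_def by (simp only: algebra_simps)
  also have "\<dots> = v * (inf_shift * s.inf_shift2 - s.inf_shift * inf_shift2)"
    unfolding 1 2 by (simp only: algebra_simps)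
  also have "\<dots> = (1 - fps_const (c / (q * (a * b))) * fps_X) * dil (1 / q) w"
    unfolding Dw v by (simp only: mult_ac)
  finally have w1: "(1 - fps_X) * w = (1 - fps_const (c / (q * (a * b))) * fps_X) * dil (1 / q) w" .
  \<comment> \<open>The equation relates \<open>w\<close> to \<open>dil (1 / q) w\<close>; applying \<open>dil q\<close> brings it into the form required by \<open>qbin_unique\<close>.\<close>
  have dd: "dil q (dil (1 / q) w) = w"
    using q0 by (intro fps_ext) (simp add: power_one_over)
  have "dil q ((1 - fps_X) * w) = dil q ((1 - fps_const (c / (q * (a * b))) * fps_X) * dil (1 / q) w)"
    by (simp only: w1)
  hence "(1 - fps_const q * fps_X) * dil q w = (1 - fps_const (c / (q * (a * b)) * q) * fps_X) * w"
    unfolding dil_mult dil_diff dil_fps_const dil_X dil_1 mult.assoc [symmetric] fps_const_mult dd .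
  hence "(1 - fps_const (c / (a * b)) * fps_X) * w = (1 - fps_const (a * b * q / c * (c / (a * b))) * fps_X) * dil q w"
    using q0 a0 b0 c0 by simp
  hence "w = fps_const (fps_nth w 0) * qbin q (a * b * q / c) (c / (a * b))"
    by (rule qbin_unique[OF q])
  also have "fps_nth w 0 = 1 / b - 1 / a"
    by (simp add: w_def inf_base_def s.inf_base_def inf_shift_def s.inf_shift_def inf_coeff_0 s.inf_coeff_0)
  finally have w: "w = fps_const (1 / b - 1 / a) * qbin q (a * b * q / c) (c / (a * b))" .
  have X: "fls_X * (fls_X_inv * f) = (f :: complex fls)" for f
    by (simp add: mult.assoc [symmetric] flip: fls_inverse_X)
  have "fls_X_inv * (inf_sol 1 1 1 * s.inf_sol 0 0 0 - s.inf_sol 1 1 1 * inf_sol 0 0 0)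
      = fls_X_inv * inf_sol 1 1 1 * s.inf_sol 0 0 0 - fls_X_inv * s.inf_sol 1 1 1 * inf_sol 0 0 0"
    by (simp only: algebra_simps)
  also have "\<dots> = fps_to_fls ((inf_base - inf_shift) * s.inf_base - (s.inf_base - s.inf_shift) * inf_base)"
    unfolding inf_sol_111 s.inf_sol_111 inf_sol_000 s.inf_sol_000 fls_times_fps_to_fls fps_to_fls_minus ..
  also have "(inf_base - inf_shift) * s.inf_base - (s.inf_base - s.inf_shift) * inf_base = w"
    unfolding w_def by (simp add: algebra_simps)
  finally have "fls_X_inv * (inf_sol 1 1 1 * s.inf_sol 0 0 0 - s.inf_sol 1 1 1 * inf_sol 0 0 0) = fps_to_fls w" .
  from arg_cong[OF this, of "\<lambda>f. fls_X * f"] show ?thesis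
    unfolding X w fls_times_fps_to_fls fps_const_to_fls by (simp only: mult_ac)
qed

section \<open>Series for the solutions at infinity\<close>

text \<open>The solution at infinity without its leading monomial, and the second factor of its Euler transform.\<close>

definition inf_hyp :: "int \<Rightarrow> int \<Rightarrow> int \<Rightarrow> complex fps" where
  "inf_hyp k l m = hyp q (a * q powi k) (a * q powi (k - m + 1) / c) (a * q powi (k - l + 1) / b)
     (c * q powi (m - k - l + 1) / (a * b))"

definition inf_euler :: "int \<Rightarrow> int \<Rightarrow> int \<Rightarrow> complex fps" where
  "inf_euler k l m = hyp q (q powi (1 - l) / b) (c * q powi (m - l) / b) (a * q powi (k - l + 1) / b) q"

text \<open>The part of the leading coefficient that is symmetric in the two solutions at infinity; removing it
  from the leading coefficients leaves \<open>mu1\<close> and \<open>mu2\<close>.\<close>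

definition rho :: "int \<Rightarrow> int \<Rightarrow> int \<Rightarrow> complex" where
  "rho k l m = (-1) powi (k + l + m) * q powi (tri k + tri l - tri m) * a powi k * b powi l / c powi m"

lemma notin_shift: "a * q powi n / c \<notin> qpowers q" "a * q powi n / b \<notin> qpowers q" "b * q powi n / c \<notin> qpowers q"
   "b * q powi n / a \<notin> qpowers q" "c * q powi n / b \<notin> qpowers q" "c * q powi n / a \<notin> qpowers q"
   "q powi n / b \<notin> qpowers q" "q powi n / a \<notin> qpowers q"
proof -
  have "x * q powi n / y \<notin> qpowers q" if "x / y \<notin> qpowers q" for x y
    using that qpowers_mult_powi_iff[OF q0, of "x / y" n] by simp
  moreover have "1 / b \<notin> qpowers q" "1 / a \<notin> qpowers q"
    using notin qpowers_inverse_iff[OF q0] by (simp_all add: divide_inverse)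
  ultimately show "a * q powi n / c \<notin> qpowers q" "a * q powi n / b \<notin> qpowers q" "b * q powi n / c \<notin> qpowers q"
   "b * q powi n / a \<notin> qpowers q" "c * q powi n / b \<notin> qpowers q" "c * q powi n / a \<notin> qpowers q"
   "q powi n / b \<notin> qpowers q" "q powi n / a \<notin> qpowers q"
    using notin by (blast, blast, blast, blast, blast, blast, metis mult_1, metis mult_1)
qed

lemma inf_hyp_euler:
  "inf_hyp k l m = qbin q (a * b / c * q powi (k + l - m)) (c * q powi (m - k - l + 1) / (a * b)) * inf_euler k l m"
proof -
  let ?A = "a * q powi k" and ?B = "a * q powi (k - m + 1) / c" and ?C = "a * q powi (k - l + 1) / b"
    and ?V = "c * q powi (m - k - l + 1) / (a * b)"
  have nz: "?A \<noteq> 0" "?B \<noteq> 0" "?C \<noteq> 0" using q0 a0 b0 c0 by simp_all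
  have e: "?A * ?B / ?C = a * b / c * q powi (k + l - m)" "?C / ?A = q powi (1 - l) / b" "?C / ?B = c * q powi (m - l) / b"
    using q0 a0 b0 c0 by (simp_all add: power_int_add power_int_diff field_simps)
  have e2: "?A * ?B * ?V / ?C = q"
  proof -
    have "?A * ?B * ?V / ?C = (?A * ?B / ?C) * ?V" by simp
    also have "\<dots> = q powi (k + l - m) * q powi (m - k - l + 1)" unfolding e using q0 a0 b0 c0 by simp
    also have "\<dots> = q powi (k + l - m + (m - k - l + 1))"
      by (rule power_int_add[OF disjI1[OF q0], symmetric])
    finally show ?thesis by simp
  qed
  show ?thesis
    using euler_transformation[OF q notin_shift(2) nz, where V = ?V]
    unfolding e e2 inf_hyp_def inf_euler_def .
qed

lemma inf_pow_nat: "inf_pow k l m (k + int n) = inf_pow k l m k * (c * q powi (m - k - l + 1) / (a * b)) ^ n"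
proof (induction n)
  case (Suc n)
  have "inf_pow k l m (k + int (Suc n)) = inf_pow k l m (k + int n + 1)" by (simp add: algebra_simps)
  also have "\<dots> = c * q / (a * b) * q powi (m - k - l) * inf_pow k l m (k + int n)" by (rule inf_pow_N)
  finally show ?case unfolding Suc.IH using q0 by (simp add: power_int_add mult_ac)
qed simp

lemma inf_pow_rho: "inf_pow k l m k = rho k l m * (a powi (m - k - l) * (c / (a * b)) powi k * q powi (k * (m - k - l + 1)))"
proof -
  have "k * (m - k - l + 1) = k * (m - k - l) + k" by (simp add: algebra_simps)
  thus ?thesis
    unfolding inf_pow_def rho_def using q0 a0 b0 c0
    by (simp add: power_int_add power_int_diff power_int_mult_distrib power_int_divide_distrib mult_ac)
qed

lemma inf_sol_hyp:
  "inf_sol k l m = fls_const (rho k l m * mu1 k l m a b c q) * fls_shift (- k) (fps_to_fls (inf_hyp k l m))"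
proof (rule fls_eqI)
  fix N
  show "inf_sol k l m $$ N = (fls_const (rho k l m * mu1 k l m a b c q) * fls_shift (- k) (fps_to_fls (inf_hyp k l m))) $$ N"
  proof (cases "N < k")
    case True
    thus ?thesis by (simp add: inf_sol_nth inf_coeff_below)
  next
    case False
    define n where "n = nat (N - k)"
    have N: "N = k + int n" using False by (simp add: n_def)
    have e: "k + int n - m = (k - m) + int n" "k + int n - l = (k - l) + int n" "k + int n - k = int n" by simp_all
    have e2: "a * q / c * q powi (k - m) = a * q powi (k - m + 1) / c" "a * q / b * q powi (k - l) = a * q powi (k - l + 1) / b"
      using q0 by (simp_all add: power_int_add)
    have "inf_coeff k l m N = rho k l m * mu1 k l m a b c q * fps_nth (inf_hyp k l m) n"
      unfolding N inf_coeff_def e inf_pow_nat inf_pow_rho qpoch_add[OF q0 notin(1)] qpoch_add[OF q0 notin'(1)]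
        qpoch_add[OF q0 notin'(2)] e2 mu1_def inf_hyp_def hyp_def fps_nth_Abs_fps
      by (simp add: divide_inverse mult_ac)
    thus ?thesis by (simp add: inf_sol_nth N)
  qed
qed

end

context heine_params
begin

text \<open>The four families are Cauchy products of one solution at infinity and one Euler transform. The two
  choices of the factor to be transformed account for the two cases \<open>s \<ge> 0\<close> and \<open>s < 0\<close>.\<close>

lemma C_coeff_series:
  "mu1 k l m a b c q * fps_nth (inf_euler k l m * heine_params.inf_hyp b a c q 0 0 0) n = C_coeff k l m a b c q (int n)"
proof -
  interpret s: heine_params b a c q by (rule swap)
  have f: "s.inf_hyp 0 0 0 = hyp q b (b * q / c) (b * q / a) (c * q / (a * b))"
    unfolding s.inf_hyp_def by (simp add: mult.commute[of b a])
  have e: "q powi (1 - int n) / (b * q / a) = a * q powi (- int n) / b"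
    "q powi (1 - int n) / (b * q / c) = c * q powi (- int n) / b"
    using q0 by (simp_all add: power_int_diff power_int_minus field_simps)
  have e2: "q * (q * (b * q / a) / (b * (b * q / c) * (c * q / (a * b)))) = q"
    using q0 a0 b0 c0 by (simp add: field_simps)
  have nz: "b * q / c \<noteq> 0" "b * q / a \<noteq> 0" "c * q / (a * b) \<noteq> 0" using q0 a0 b0 c0 by simp_all
  show ?thesis
    unfolding f inf_euler_def hyp_mult_nth[OF q notin(2) notin'(3,4) b0 nz] e e2
    unfolding C_coeff_def hyp_def fps_nth_Abs_fps by (simp add: mult_ac)
qed

lemma D_coeff_series:
  "mu2 k l m a b c q * fps_nth (inf_hyp 0 0 0 * heine_params.inf_euler b a c q l k m) n = D_coeff k l m a b c q (int n)"
proof -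
  interpret s: heine_params b a c q by (rule swap)
  have f: "inf_hyp 0 0 0 = hyp q a (a * q / c) (a * q / b) (c * q / (a * b))"
    unfolding inf_hyp_def by simp
  have e: "q powi (1 - int n) / (b * q powi (l - k + 1) / a) = a * q powi (k - l - int n) / b"
    "q powi (1 - int n) / (q powi (1 - k) / a) = a * q powi (k - int n)"
    "q powi (1 - int n) / (c * q powi (m - k) / a) = a * q powi (k - m - int n + 1) / c"
    using q0 by (simp_all add: power_int_diff power_int_add field_simps)
  have e2: "c * q / (a * b) * (q * (b * q powi (l - k + 1) / a) / (q powi (1 - k) / a * (c * q powi (m - k) / a) * q))
     = q powi (k + l - m + 1)"
    using q0 a0 b0 c0 by (simp add: power_int_diff power_int_add field_simps)
  have nz: "q powi (1 - k) / a \<noteq> 0" "c * q powi (m - k) / a \<noteq> 0" "b * q powi (l - k + 1) / a \<noteq> 0"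
    using q0 a0 b0 c0 by simp_all
  show ?thesis
    unfolding f s.inf_euler_def hyp_mult_nth[OF q notin_shift(8,6,4) nz q0] e e2
    unfolding D_coeff_def hyp_def fps_nth_Abs_fps by (simp add: mult_ac)
qed

lemma C'_coeff_series:
  "mu1 k l m a b c q * fps_nth (heine_params.inf_euler b a c q 0 0 0 * inf_hyp k l m) n = C'_coeff k l m a b c q (int n)"
proof -
  interpret s: heine_params b a c q by (rule swap)
  have f: "s.inf_euler 0 0 0 = hyp q (q / a) (c / a) (b * q / a) q"
    unfolding s.inf_euler_def by simp
  have e: "q powi (1 - int n) / (a * q powi (k - l + 1) / b) = b * q powi (l - k - int n) / a"
    "q powi (1 - int n) / (a * q powi k) = q powi (1 - k - int n) / a"
    "q powi (1 - int n) / (a * q powi (k - m + 1) / c) = c * q powi (m - k - int n) / a"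
    using q0 by (simp_all add: power_int_diff power_int_add field_simps)
  have e2: "q * (q * (a * q powi (k - l + 1) / b) / (a * q powi k * (a * q powi (k - m + 1) / c) *
      (c * q powi (m - k - l + 1) / (a * b)))) = q"
    using q0 a0 b0 c0 by (simp add: power_int_diff power_int_add field_simps)
  have nz: "a * q powi k \<noteq> 0" "a * q powi (k - m + 1) / c \<noteq> 0" "a * q powi (k - l + 1) / b \<noteq> 0"
     "c * q powi (m - k - l + 1) / (a * b) \<noteq> 0"
    using q0 a0 b0 c0 by simp_all
  show ?thesis
    unfolding f inf_hyp_def hyp_mult_nth[OF q shift_notin(1) notin_shift(1,2) nz] e e2
    unfolding C'_coeff_def hyp_def fps_nth_Abs_fps by (simp add: mult_ac)
qed

lemma D'_coeff_series:
  "mu2 k l m a b c q * fps_nth (heine_params.inf_hyp b a c q l k m * inf_euler 0 0 0) n = D'_coeff k l m a b c q (int n)"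
proof -
  interpret s: heine_params b a c q by (rule swap)
  have f: "inf_euler 0 0 0 = hyp q (q / b) (c / b) (a * q / b) q"
    unfolding inf_euler_def by simp
  have e: "q powi (1 - int n) / (a * q / b) = b * q powi (- int n) / a"
    "q powi (1 - int n) / (q / b) = b * q powi (- int n)"
    "q powi (1 - int n) / (c / b) = b * q powi (1 - int n) / c"
    using q0 by (simp_all add: power_int_diff power_int_minus field_simps)
  have e2: "c * q powi (m - l - k + 1) / (b * a) * (q * (a * q / b) / (q / b * (c / b) * q)) = q powi (m - k - l + 1)"
    using q0 a0 b0 c0 by (simp add: power_int_diff power_int_add field_simps)
  have nz: "q / b \<noteq> 0" "c / b \<noteq> 0" "a * q / b \<noteq> 0"
    using q0 a0 b0 c0 by simp_all
  have ni: "q / b \<notin> qpowers q" using notin_shift(7)[of 1] by simp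
  show ?thesis
    unfolding f s.inf_hyp_def hyp_mult_nth[OF q ni notin(6) notin'(2) nz q0] e e2
    unfolding D'_coeff_def hyp_def fps_nth_Abs_fps by (simp add: mult_ac)
qed

section \<open>The coefficient in closed form\<close>

text \<open>The Laurent series in \<open>z = 1/x\<close> with the coefficients \<open>C\<^sub>n - D\<^bsub>n + k - l\<^esub>\<close> (or \<open>C'\<^sub>n - D'\<^bsub>n + k - l\<^esub>\<close>) at
  \<open>z\<^bsup>k + n\<^esup>\<close>.\<close>

definition inf_series :: "int \<Rightarrow> int \<Rightarrow> int \<Rightarrow> complex fls" where
  "inf_series k l m =
     (if k + l - m \<ge> 0 then
        fls_const (mu1 k l m a b c q) * fls_shift (- k) (fps_to_fls (inf_euler k l m * heine_params.inf_hyp b a c q 0 0 0)) -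
        fls_const (mu2 k l m a b c q) * fls_shift (- l) (fps_to_fls (inf_hyp 0 0 0 * heine_params.inf_euler b a c q l k m))
      else
        fls_const (mu1 k l m a b c q) * fls_shift (- k) (fps_to_fls (heine_params.inf_euler b a c q 0 0 0 * inf_hyp k l m)) -
        fls_const (mu2 k l m a b c q) * fls_shift (- l) (fps_to_fls (heine_params.inf_hyp b a c q l k m * inf_euler 0 0 0)))"

lemma inf_series_below: "k \<le> l \<Longrightarrow> N < k \<Longrightarrow> inf_series k l m $$ N = 0"
  by (simp add: inf_series_def)

lemma shifted_nth:
  fixes f :: "complex fps"
  assumes "\<And>n. t * fps_nth f n = g (int n)"
  shows "(fls_const t * fls_shift (- i) (fps_to_fls f)) $$ N = (if N < i then 0 else g (N - i))"
  using assms[of "nat (N - i)"] unfolding fls_mult_const_nth fls_shift_nth fps_to_fls_nth by simp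

lemma inf_series_nth:
  assumes "N \<ge> k"
  shows "inf_series k l m $$ N = (if k + l - m \<ge> 0 then C_coeff k l m a b c q (N - k) - D_coeff k l m a b c q (N - l)
     else C'_coeff k l m a b c q (N - k) - D'_coeff k l m a b c q (N - l))"
proof -
  have "D_coeff k l m a b c q (N - l) = 0" "D'_coeff k l m a b c q (N - l) = 0" if "N < l"
    using that by (simp_all add: D_coeff_def D'_coeff_def)
  thus ?thesis
    using assms unfolding inf_series_def
    by (auto simp only: fls_minus_nth shifted_nth[OF C_coeff_series] shifted_nth[OF D_coeff_series]
        shifted_nth[OF C'_coeff_series] shifted_nth[OF D'_coeff_series] split: if_splits)
qed

text \<open>The first factor in the Euler transform of \<open>inf_hyp k l m\<close>; it depends on \<open>k + l - m\<close> only and is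
  symmetric in \<open>a\<close> and \<open>b\<close>, hence common to both solutions at infinity.\<close>

definition qbin_s :: "int \<Rightarrow> complex fps" where
  "qbin_s s = qbin q (a * b / c * q powi s) (c * q powi (1 - s) / (a * b))"

lemma qbin_s_nonzero: "qbin_s s \<noteq> 0"
  using qbin_0[of q "a * b / c * q powi s" "c * q powi (1 - s) / (a * b)"] unfolding qbin_s_def
  by (metis fps_zero_nth zero_neq_one)

lemma qbin_s_step: "qbin_s (s + 1) * (1 - fps_const (c * q powi (- s) / (a * b)) * fps_X) = qbin_s s"
proof -
  have e: "a * b / c * q powi (s + 1) = a * b / c * q powi s * q"
    "c * q powi (1 - (s + 1)) / (a * b) = c * q powi (1 - s) / (a * b) / q"
    "c * q powi (- s) / (a * b) = c * q powi (1 - s) / (a * b) / q"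
    using q0 by (simp_all add: power_int_add power_int_diff power_int_minus divide_inverse)
  show ?thesis unfolding qbin_s_def e by (rule qbin_step[OF q])
qed

lemma inf_hyp_euler_s: "inf_hyp k l m = qbin_s (k + l - m) * inf_euler k l m"
proof -
  have e: "m - k - l + 1 = 1 - (k + l - m)" by simp
  show ?thesis unfolding inf_hyp_euler e qbin_s_def ..
qed

lemma qbin_s_swap: "heine_params.qbin_s b a c q s = qbin_s s"
proof -
  interpret s: heine_params b a c q by (rule swap)
  show ?thesis unfolding s.qbin_s_def qbin_s_def by (simp add: mult.commute)
qed

lemma rho_swap: "heine_params.rho b a c q l k m = rho k l m"
proof -
  interpret s: heine_params b a c q by (rule swap)
  show ?thesis unfolding s.rho_def rho_def by (simp add: add_ac mult_ac)
qed

lemma mu_swap: "mu1 l k m b a c q = mu2 k l m a b c q"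
proof -
  have "m - l - k = m - k - l" by simp
  thus ?thesis unfolding mu1_def mu2_def by (simp only: mult.commute[of b a])
qed

text \<open>Of the planes \<open>s\<close> and \<open>0\<close>, which carry the two factors of each product, the Euler transformation is
  applied to the factor on the higher one.\<close>

lemma casoratian_shifted:
  "inf_sol k l m * heine_params.inf_sol b a c q 0 0 0 - heine_params.inf_sol b a c q l k m * inf_sol 0 0 0
   = fls_const (rho k l m) * fps_to_fls (qbin_s (max (k + l - m) 0)) * inf_series k l m"
proof -
  interpret s: heine_params b a c q by (rule swap)
  have one: "rho 0 0 0 * mu1 0 0 0 a b c q = 1" "s.rho 0 0 0 * mu1 0 0 0 b a c q = 1"
    by (simp_all add: rho_def s.rho_def tri_def mu1_def)
  have 0: "inf_sol 0 0 0 = fps_to_fls (inf_hyp 0 0 0)" "s.inf_sol 0 0 0 = fps_to_fls (s.inf_hyp 0 0 0)"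
    unfolding inf_sol_hyp[of 0 0 0] s.inf_sol_hyp[of 0 0 0] one by simp_all
  have sh: "fls_shift (- i) (fps_to_fls (f * g)) = fls_shift (- i) (fps_to_fls f) * fps_to_fls (g :: complex fps)" for i f g
    by (simp add: fls_times_fps_to_fls fls_shifted_times_simps)
  let ?A = "fls_const (mu1 k l m a b c q)" and ?B = "fls_const (mu2 k l m a b c q)"
  show ?thesis
  proof (cases "k + l - m \<ge> 0")
    case True
    have e: "max (k + l - m) 0 = k + l - m" "l + k - m = k + l - m" using True by auto
    have p: "inf_hyp k l m = qbin_s (k + l - m) * inf_euler k l m" "s.inf_hyp l k m = qbin_s (k + l - m) * s.inf_euler l k m"
      by (simp_all only: inf_hyp_euler_s s.inf_hyp_euler_s qbin_s_swap e(2))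
    show ?thesis
      unfolding 0 inf_sol_hyp[of k l m] s.inf_sol_hyp[of l k m] rho_swap mu_swap p inf_series_def if_P[OF True] e(1)
        fls_const_mult_const [symmetric]
      using sh[of k "inf_euler k l m" "qbin_s (k + l - m)"] sh[of l "s.inf_euler l k m" "qbin_s (k + l - m)"]
        sh[of k "inf_euler k l m" "s.inf_hyp 0 0 0"] sh[of l "s.inf_euler l k m" "inf_hyp 0 0 0"]
      by (simp only: mult.commute[of "qbin_s (k + l - m)"] mult.commute[of "inf_hyp 0 0 0"])
         (simp only: algebra_simps)
  next
    case False
    have e: "max (k + l - m) 0 = 0" using False by auto
    have p: "inf_hyp 0 0 0 = qbin_s 0 * inf_euler 0 0 0" "s.inf_hyp 0 0 0 = qbin_s 0 * s.inf_euler 0 0 0"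
      using inf_hyp_euler_s[of 0 0 0] s.inf_hyp_euler_s[of 0 0 0] by (simp_all only: qbin_s_swap) simp_all
    show ?thesis
      unfolding 0 inf_sol_hyp[of k l m] s.inf_sol_hyp[of l k m] rho_swap mu_swap p inf_series_def if_not_P[OF False] e
        fls_const_mult_const [symmetric] fls_times_fps_to_fls
      using sh[of k "inf_hyp k l m" "s.inf_euler 0 0 0"] sh[of l "s.inf_hyp l k m" "inf_euler 0 0 0"]
      by (simp only: fls_times_fps_to_fls [symmetric] mult.commute[of "s.inf_euler 0 0 0" "inf_hyp k l m"])
         (simp only: fls_times_fps_to_fls algebra_simps)
  qed
qed

text \<open>The quotient of the \<open>q\<close>-binomial series in the two Casoratians is a finite product in \<open>1/x\<close>; rewritten
  in \<open>x\<close>, it is the prefactor \<open>nfac\<close> up to a monomial. This monomial is the origin of the sign and of the powers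
  of \<open>ab/c\<close> and \<open>q\<close> in \<open>lambda_Q\<close> that depend on \<open>M\<close>.\<close>

lemma nfac_fls_X_inv:
  "nfac (a * b / c) q (int n) fls_X_inv * fls_const ((- (a * b / c)) powi (int n - 1) * q powi tri (int n)) *
   fls_X_inv powi (int n - 1) * fps_to_fls (qbin_s 1) = fps_to_fls (qbin_s (int n))"
proof (induction n)
  case 0
  have d: "a * b / c \<noteq> 0" using a0 b0 c0 by simp
  have X: "fls_X_inv powi (- 1) = (fls_X :: complex fls)" by (simp add: fls_inverse_X_inv)
  have XX: "fls_X_inv * fls_X = (1 :: complex fls)" by (simp flip: fls_inverse_X)
  have "nfac (a * b / c) q 0 fls_X_inv * fls_const ((- (a * b / c)) powi (- 1) * q powi tri 0) * fls_X
      = 1 - fls_const (c * q powi (- 0) / (a * b)) * fls_X"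
  proof -
    have 1: "fls_const (a * b / c) * fls_const ((- (a * b / c)) powi (- 1)) = - 1"
      unfolding fls_const_mult_const using d by simp
    have "(1 - fls_const (a * b / c) * fls_X_inv) * fls_const ((- (a * b / c)) powi (- 1)) * fls_X
      = fls_const ((- (a * b / c)) powi (- 1)) * fls_X - fls_const (a * b / c) * fls_const ((- (a * b / c)) powi (- 1)) * (fls_X_inv * fls_X)"
      by (simp only: algebra_simps mult_1_left)
    also have "\<dots> = 1 - fls_const (c / (a * b)) * fls_X"
      unfolding 1 XX by (simp add: algebra_simps)
    finally show ?thesis by (simp add: nfac_nonpos tri_def)
  qed
  hence "nfac (a * b / c) q 0 fls_X_inv * fls_const ((- (a * b / c)) powi (- 1) * q powi tri 0) * fls_X * fps_to_fls (qbin_s 1)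
    = fps_to_fls (qbin_s 1 * (1 - fps_const (c * q powi (- 0) / (a * b)) * fps_X))"
    by (simp add: fls_times_fps_to_fls mult.commute)
  also have "\<dots> = fps_to_fls (qbin_s 0)" using qbin_s_step[of 0] by simp
  finally show ?case by (simp only: X of_nat_0 diff_0)
next
  case (Suc n)
  define d where "d = a * b / c"
  have d: "d \<noteq> 0" using a0 b0 c0 by (simp add: d_def)
  have ci: "c * q powi (- int n) / (a * b) = 1 / (d * q powi int n)"
    using c0 by (simp add: d_def power_int_minus field_simps)
  define f where "f = 1 - fls_const (d * q powi int n) * fls_X_inv"
  have f0: "f \<noteq> 0" using genericD(2)[OF generic_fls_X_inv] by (simp only: f_def not_False_eq_True)
  have XX: "fls_X_inv * fls_X = (1 :: complex fls)" by (simp flip: fls_inverse_X)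
  define g where "g = 1 - fls_const (c * q powi (- int n) / (a * b)) * fls_X"
  have fg: "f = fls_const (- (d * q powi int n)) * fls_X_inv * g"
  proof -
    have 1: "fls_const (- (d * q powi int n)) * fls_const (c * q powi (- int n) / (a * b)) = - 1"
      unfolding fls_const_mult_const ci using d q0 by simp
    have "fls_const (- (d * q powi int n)) * fls_X_inv * g =
       fls_const (- (d * q powi int n)) * fls_X_inv
        - fls_const (- (d * q powi int n)) * fls_const (c * q powi (- int n) / (a * b)) * (fls_X_inv * fls_X)"
      unfolding g_def by (simp only: algebra_simps mult_1_left)
    also have "\<dots> = fls_const (- (d * q powi int n)) * fls_X_inv + 1"
      unfolding 1 XX by simp
    also have "\<dots> = f" unfolding f_def fls_const_uminus by simp
    finally show ?thesis ..
  qed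
  hence g0: "g \<noteq> 0" using f0 by auto
  have st: "fps_to_fls (qbin_s (int n + 1)) * g = fps_to_fls (qbin_s (int n))"
    using arg_cong[OF qbin_s_step[of "int n"], of fps_to_fls] by (simp add: g_def fls_times_fps_to_fls)
  have n1: "nfac d q (int n + 1) fls_X_inv = nfac d q (int n) fls_X_inv / f"
    unfolding f_def by (rule nfac_Suc[OF generic_fls_X_inv]) simp
  have c1: "fls_const ((- d) powi (int n + 1 - 1) * q powi tri (int n + 1)) = fls_const ((- d) powi (int n - 1) * q powi tri (int n)) * fls_const (- (d * q powi int n))"
    using d q0 unfolding fls_const_mult_const tri_plus1 by (simp add: power_int_add power_int_diff)
  have x1: "fls_X_inv powi (int n + 1 - 1) = fls_X_inv powi (int n - 1) * (fls_X_inv :: complex fls)"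
    using power_int_add[of "fls_X_inv :: complex fls" "int n - 1" 1] by simp
  have IH: "nfac d q (int n) fls_X_inv * fls_const ((- d) powi (int n - 1) * q powi tri (int n)) *
   fls_X_inv powi (int n - 1) * fps_to_fls (qbin_s 1) = fps_to_fls (qbin_s (int n))"
    using Suc.IH by (simp only: d_def)
  have "nfac d q (int n + 1) fls_X_inv * fls_const ((- d) powi (int n + 1 - 1) * q powi tri (int n + 1)) *
      fls_X_inv powi (int n + 1 - 1) * fps_to_fls (qbin_s 1)
     = (fls_const (- (d * q powi int n)) * fls_X_inv) / f * (nfac d q (int n) fls_X_inv * fls_const ((- d) powi (int n - 1) * q powi tri (int n)) *
   fls_X_inv powi (int n - 1) * fps_to_fls (qbin_s 1))"
    unfolding n1 c1 x1 by (simp add: divide_inverse mult_ac del: fls_const_mult_const)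
  also have "\<dots> = (fls_const (- (d * q powi int n)) * fls_X_inv) / f * (fps_to_fls (qbin_s (int n + 1)) * g)"
    unfolding IH st ..
  also have "\<dots> = (fls_const (- (d * q powi int n)) * fls_X_inv * g) / f * fps_to_fls (qbin_s (int n + 1))"
    by (simp only: divide_inverse mult_ac)
  also have "\<dots> = fps_to_fls (qbin_s (int n + 1))"
    unfolding fg [symmetric] using f0 by simp
  finally show ?case by (simp add: d_def add.commute)
qed

end

lemma nfac_nonzero:
  assumes "generic d q X" shows "nfac d q s X \<noteq> 0"
  using genericD(3,4)[OF assms] by (auto simp: nfac_def)

context heine_params
begin

text \<open>The constant by which the polynomial in the first coefficient differs from \<open>P_poly\<close>.\<close>

definition kappa :: "int \<Rightarrow> int \<Rightarrow> int \<Rightarrow> complex" where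
  "kappa k l m = rho k l m * ((- (a * b / c)) powi (max (k + l - m) 0 - 1) * q powi tri (max (k + l - m) 0)) / (1 / b - 1 / a)"

lemma a_neq_b: "a \<noteq> b"
proof
  assume "a = b"
  hence "a / b = 1" using b0 by simp
  thus False using notin(4) one_in_qpowers by simp
qed

lemma fls_X_inv_powi_nth: "(fls_X_inv powi i * f) $$ N = (f :: complex fls) $$ (N + i)"
proof (cases "i \<ge> 0")
  case True
  then obtain n where i: "i = int n" using nonneg_eq_int by blast
  show ?thesis by (simp add: i fls_X_inv_power_times_conv_shift)
next
  case False
  define n where "n = nat (- i)"
  have i: "i = - int n" using False by (simp add: n_def)
  have "fls_X_inv powi i = (fls_X :: complex fls) ^ n"
    unfolding i by (simp add: power_int_minus power_inverse [symmetric] fls_inverse_X_inv)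
  thus ?thesis by (simp add: i fls_X_power_times_conv_shift)
qed

lemma contiguous_inf_sol_swap: "contiguous a b c q fls_X_inv (\<lambda>k l m. heine_params.inf_sol b a c q l k m)"
  using contiguous_swap[OF heine_params.contiguous_inf_sol[OF swap]] .

lemma reduces_casoratian:
  assumes "reduces a b c q k l m A B"
  shows "A fls_X_inv * (fls_const (1 / b - 1 / a) * fls_X * fps_to_fls (qbin_s 1)) =
     fls_const (rho k l m) * fps_to_fls (qbin_s (max (k + l - m) 0)) * inf_series k l m"
proof -
  interpret s: heine_params b a c q by (rule swap)
  note d = assms[unfolded reduces_def]
  have 1: "inf_sol k l m = A fls_X_inv * inf_sol 1 1 1 + B fls_X_inv * inf_sol 0 0 0"
    using d generic_fls_X_inv contiguous_inf_sol by blast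
  have 2: "s.inf_sol l k m = A fls_X_inv * s.inf_sol 1 1 1 + B fls_X_inv * s.inf_sol 0 0 0"
    using d generic_fls_X_inv contiguous_inf_sol_swap by blast
  have "qbin q (a * b * q / c) (c / (a * b)) = qbin_s 1"
    by (simp add: qbin_s_def)
  hence W: "fls_const (1 / b - 1 / a) * fls_X * fps_to_fls (qbin_s 1)
     = inf_sol 1 1 1 * s.inf_sol 0 0 0 - s.inf_sol 1 1 1 * inf_sol 0 0 0"
    using casoratian by simp
  have "A fls_X_inv * (fls_const (1 / b - 1 / a) * fls_X * fps_to_fls (qbin_s 1)) =
     inf_sol k l m * s.inf_sol 0 0 0 - s.inf_sol l k m * inf_sol 0 0 0"
    unfolding 1 2 W by (simp add: algebra_simps)
  thus ?thesis unfolding casoratian_shifted .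
qed

text \<open>The polynomial \<open>r\<close> is evaluated at \<open>x = 1/z\<close>: a quotient of Casoratians in which all infinite products
  cancel.\<close>

lemma coefficient_series:
  assumes A: "reduces a b c q k l m A B"
    and r: "\<And>X. generic (a * b / c) q X \<Longrightarrow> A X = X powi (1 - max m 0) * nfac (a * b / c) q (k + l - m) X * ev r X"
  shows "ev r fls_X_inv = fls_const (kappa k l m) * (fls_X_inv powi (max (k + l - m) 0 - 1 + max m 0) * inf_series k l m)"
proof -
  define M where "M = max (k + l - m) 0"
  define e where "e = 1 - max m 0"
  define X :: "complex fls" where "X = fls_X_inv"
  define N where "N = nfac (a * b / c) q M X"
  define H where "H = fps_to_fls (qbin_s 1)"
  define t where "t = 1 / b - 1 / a"
  define u where "u = (- (a * b / c)) powi (M - 1) * q powi tri M"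
  have X0: "X \<noteq> 0" "fls_X = inverse X" by (simp_all add: X_def fls_inverse_X_inv)
  have t0: "t \<noteq> 0" using a_neq_b a0 b0 by (simp add: t_def field_simps)
  have H0: "H \<noteq> 0" using qbin_s_nonzero by (simp add: H_def)
  have N0: "N \<noteq> 0"
    unfolding N_def X_def by (rule nfac_nonzero[OF generic_fls_X_inv])
  have Nf: "nfac (a * b / c) q (k + l - m) X = N"
    unfolding N_def M_def by (cases "k + l - m \<ge> 1") (simp_all add: nfac_nonpos max_def)
  have HM: "fps_to_fls (qbin_s M) = N * fls_const u * X powi (M - 1) * H"
    using nfac_fls_X_inv[of "nat M"] by (simp add: M_def N_def u_def X_def H_def)
  have "X powi e * N * ev r X * (fls_const t * fls_X * H) = fls_const (rho k l m) * fps_to_fls (qbin_s M) * inf_series k l m"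
    using reduces_casoratian[OF A] r[OF generic_fls_X_inv]
    unfolding t_def H_def M_def e_def X_def [symmetric] Nf by simp
  hence "N * H * (fls_const t * (X powi e * inverse X * ev r X)) =
      N * H * (fls_const (rho k l m) * fls_const u * (X powi (M - 1) * inf_series k l m))"
    unfolding HM X0(2) by (simp only: mult_ac)
  hence 1: "fls_const t * (X powi e * inverse X * ev r X) = fls_const (rho k l m * u) * (X powi (M - 1) * inf_series k l m)"
    using N0 H0 by (metis mult_left_cancel no_zero_divisors fls_const_mult_const)
  have "X powi e * inverse X * ev r X = fls_const (1 / t) * (fls_const (rho k l m * u) * (X powi (M - 1) * inf_series k l m))"
    by (rule fls_solve[OF 1 t0])
  also have "\<dots> = fls_const (kappa k l m) * (X powi (M - 1) * inf_series k l m)"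
    unfolding mult.assoc [symmetric] fls_const_mult_const by (simp add: kappa_def t_def u_def M_def)
  finally have 2: "X powi e * inverse X * ev r X = fls_const (kappa k l m) * (X powi (M - 1) * inf_series k l m)" .
  have 3: "X powi (1 - e) * (X powi e * inverse X) = 1"
    using X0(1) by (simp add: power_int_diff)
  have 4: "X powi (1 - e) * X powi (M - 1) = X powi (M - 1 + max m 0)"
    using X0(1) by (simp add: e_def power_int_add[symmetric] add.commute)
  have "ev r X = X powi (1 - e) * (X powi e * inverse X) * ev r X" unfolding 3 by simp
  also have "\<dots> = X powi (1 - e) * (X powi e * inverse X * ev r X)" by (simp only: mult.assoc)
  also have "\<dots> = fls_const (kappa k l m) * (X powi (1 - e) * X powi (M - 1) * inf_series k l m)"
    unfolding 2 by (simp only: mult_ac)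
  finally show ?thesis unfolding 4 unfolding X_def M_def .
qed

text \<open>The four cases in the definition of \<open>P_poly\<close> differ in the degree bound and in the choice of the
  coefficients; both have a uniform description.\<close>

lemma P_poly_sum:
  fixes k l m :: int
  defines "bd \<equiv> max (k + l - m) 0 - 1 + max m 0 - k"
  shows "P_poly k l m a b c q x = (\<Sum>n\<in>{0..bd}. inf_series k l m $$ (k + n) * x ^ nat (bd - n))"
proof -
  have s: "inf_series k l m $$ (k + n) = (if k + l - m \<ge> 0 then C_coeff k l m a b c q n - D_coeff k l m a b c q (n + k - l)
     else C'_coeff k l m a b c q n - D'_coeff k l m a b c q (n + k - l))" if "n \<in> {0..bd}" for n
    using inf_series_nth[of k "k + n" l m] that by (simp add: algebra_simps)
  have t: "bd = (if k + l - m \<ge> 0 then if m \<ge> 0 then l - 1 else l - m - 1 else if m \<ge> 0 then m - k - 1 else - k - 1)"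
    by (auto simp: bd_def)
  have e: "l - 1 - n = bd - n" if "m \<ge> 0" "k + l - m \<ge> 0" for n
    using that t by simp
  show ?thesis
    unfolding P_poly_def by (auto simp: s t intro!: sum.cong)
qed

text \<open>The left-hand side of \<open>coefficient_series\<close> contains no positive powers of \<open>z = 1/x\<close>. Therefore the series
  on its right-hand side breaks off, and it has no terms below \<open>z\<^sup>k\<close> since \<open>k \<le> l\<close>.\<close>

theorem coefficient_polynomial:
  assumes "k \<le> l" and A: "reduces a b c q k l m A B"
    and r: "\<And>X. generic (a * b / c) q X \<Longrightarrow> A X = X powi (1 - max m 0) * nfac (a * b / c) q (k + l - m) X * ev r X"
  shows "poly r x = kappa k l m * P_poly k l m a b c q x"
proof -
  define bd where "bd = max (k + l - m) 0 - 1 + max m 0 - k"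
  let ?s = "\<lambda>n. kappa k l m * inf_series k l m $$ (k + n)"
  have ser: "ev r fls_X_inv = fls_const (kappa k l m) * (fls_X_inv powi (max (k + l - m) 0 - 1 + max m 0) * inf_series k l m)"
    by (rule coefficient_series[OF A]) (rule r)
  have idx: "- int i + (max (k + l - m) 0 - 1 + max m 0) = k + (bd - int i)" for i
    by (simp add: bd_def)
  have rr: "r = (\<Sum>n\<in>{0..bd}. monom (?s n) (nat (bd - n)))"
  proof (rule poly_eqI)
    fix i
    have "coeff r i = ev r fls_X_inv $$ (- int i)" by (simp add: ev_fls_X_inv_nth)
    also have "\<dots> = kappa k l m * inf_series k l m $$ (k + (bd - int i))"
      unfolding ser fls_mult_const_nth fls_X_inv_powi_nth idx ..
    also have "\<dots> = (if bd - int i \<in> {0..bd} then ?s (bd - int i) else 0)"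
      using inf_series_below[OF assms(1), of "k + (bd - int i)" m] by auto
    also have "\<dots> = (\<Sum>n\<in>{0..bd}. if n = bd - int i then ?s n else 0)"
      by (subst sum.delta) auto
    also have "\<dots> = (\<Sum>n\<in>{0..bd}. coeff (monom (?s n) (nat (bd - n))) i)"
      by (rule sum.cong) auto
    finally show "coeff r i = coeff (\<Sum>n\<in>{0..bd}. monom (?s n) (nat (bd - n))) i"
      by (simp add: coeff_sum)
  qed
  have "poly r x = (\<Sum>n\<in>{0..bd}. ?s n * x ^ nat (bd - n))"
    by (subst rr) (simp add: poly_sum poly_monom)
  thus ?thesis unfolding P_poly_sum bd_def [symmetric] by (simp add: sum_distrib_left mult.assoc)
qed

section \<open>The second coefficient by a shift of parameters\<close>

lemma shifted: "heine_params (a * q) (b * q) (c * q) q"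
proof
  have "x * q \<notin> qpowers q" if "x \<notin> qpowers q" for x
    using that qpowers_mult_powi_iff[OF q0, of x 1] by simp
  thus "admissible (a * q) (b * q) (c * q) q"
    using adm q0 by (simp add: admissible_def)
qed

lemma contiguous_shift:
  assumes "contiguous a b c q X G"
  shows "contiguous (a * q) (b * q) (c * q) q X (\<lambda>k l m. G (k + 1) (l + 1) (m + 1))"
proof -
  have e: "u * q * q powi n = u * q powi (n + 1)" for u n
    using q0 by (simp add: power_int_add mult_ac)
  show ?thesis unfolding contiguous_def e by (intro allI conjI contiguousD[OF assms])
qed

text \<open>The explicit coefficient of \<open>G 0 0 0\<close> is the value needed; that of \<open>G 1 1 1\<close> will be absorbed into the
  first coefficient.\<close>

lemma three_levels:
  assumes X: "generic (a * b / c) q X"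
  obtains beta where "\<And>G. contiguous a b c q X G \<Longrightarrow> G 2 2 2 = beta * G 1 1 1 +
     fls_const ((1 - a) * (1 - b) / c) * inverse X * inverse (1 - fls_const (a * b / c * q) * X) * G 0 0 0"
proof -
  define A B C Q where "A = fls_const a" and "B = fls_const b" and "C = fls_const c" and "Q = fls_const q"
  define Y where "Y = 1 - fls_const (a * b / c * q) * X"
  have nz: "A \<noteq> 0" "B \<noteq> 0" "C \<noteq> 0" "Q \<noteq> 0" "X \<noteq> 0" "Y \<noteq> 0"
    using a0 b0 c0 q0 genericD[OF X] genericD(3)[OF X, of 1] by (simp_all add: A_def B_def C_def Q_def Y_def)
  \<comment> \<open>A common denominator, so that the elimination takes place in polynomials.\<close>
  define D where "D = B * C * Y * (A * Q) * X"
  have D0: "D \<noteq> 0" using nz by (simp add: D_def)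
  define beta where "beta = (B * C * (1 - A * Q) * (1 - Y) - A * Q * (B - C + (1 - B) * C - (1 - B) * B * A * X)) / D"
  have bD: "D * beta = B * C * (1 - A * Q) * (1 - Y) - A * Q * (B - C + (1 - B) * C - (1 - B) * B * A * X)"
    using D0 by (simp add: beta_def)
  have "G 2 2 2 = beta * G 1 1 1 +
     fls_const ((1 - a) * (1 - b) / c) * inverse X * inverse (1 - fls_const (a * b / c * q) * X) * G 0 0 0"
    if G: "contiguous a b c q X G" for G
  proof -
    have f1: "G 1 0 0 = (1 - A) * G 0 0 0 + A * X * G 1 1 1"
      using contiguousD(1)[OF G, of 0 0 0] by (simp add: A_def fls_const_diff)
    have f2: "C * G 1 1 1 = B * G 1 0 0 + (C - B) * G 1 0 1"
      using contiguousD(4)[OF G, of 0 1 0] by (simp add: B_def C_def fls_const_diff)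
    have f3: "G 1 1 1 = (1 - B) * G 1 0 1 + B * X * G 2 1 2"
      using contiguousD(2)[OF G, of 1 0 1] by (simp add: B_def fls_const_diff)
    have f4: "G 2 1 1 = (1 - A * Q) * G 1 1 1 + A * Q * X * G 2 2 2"
      using contiguousD(1)[OF G, of 1 1 1] by (simp add: A_def Q_def fls_const_diff)
    have bc: "fls_const (a * q powi 1 * (b * q powi 1 / (c * q powi 1) - 1)) = A * Q * (B / C - 1)"
    proof -
      have "a * q powi 1 * (b * q powi 1 / (c * q powi 1) - 1) = a * q * (b / c - 1)" using q0 by simp
      thus ?thesis unfolding A_def B_def C_def Q_def
        by (simp only: fls_const_diff fls_const_mult fls_const_divide fls_const_1)
    qed
    have "(1 - A * Q) * G 1 1 1 - Y * G 2 1 1 = A * Q * (B / C - 1) * X * G 2 1 2"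
      using contiguous_raise[OF G q0 c0, of 1 1 1] unfolding bc
      by (simp add: A_def Q_def Y_def fls_const_diff)
    hence "B * C * ((1 - A * Q) * G 1 1 1 - Y * G 2 1 1) = A * Q * (C * (B / C - 1)) * (B * X * G 2 1 2)"
      by (simp only: mult_ac)
    also have "C * (B / C - 1) = B - C" using nz by (simp add: field_simps)
    also have "B * X * G 2 1 2 = G 1 1 1 - (1 - B) * G 1 0 1" unfolding f3[symmetric] using f3 by simp
    finally have f5: "B * C * ((1 - A * Q) * G 1 1 1 - Y * G 2 1 1) = A * Q * (B - C) * (G 1 1 1 - (1 - B) * G 1 0 1)" .
    have f6: "(B - C) * G 1 0 1 = B * G 1 0 0 - C * G 1 1 1" unfolding f2 by (simp add: algebra_simps)
    have "D * G 2 2 2 = B * C * Y * (G 2 1 1 - (1 - A * Q) * G 1 1 1)"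
      unfolding f4 D_def by (simp add: algebra_simps)
    also have "\<dots> = B * C * (1 - A * Q) * (1 - Y) * G 1 1 1 - B * C * ((1 - A * Q) * G 1 1 1 - Y * G 2 1 1)"
      by (simp add: algebra_simps)
    also have "\<dots> = B * C * (1 - A * Q) * (1 - Y) * G 1 1 1 - A * Q * ((B - C) * G 1 1 1 - (1 - B) * ((B - C) * G 1 0 1))"
      unfolding f5 by (simp add: algebra_simps)
    also have "\<dots> = D * beta * G 1 1 1 + A * Q * (1 - B) * B * (1 - A) * G 0 0 0"
      unfolding f6 f1 bD by (simp add: algebra_simps)
    also have "A * Q * (1 - B) * B * (1 - A) = D * ((1 - A) * (1 - B) / C * inverse X * inverse Y)"
    proof -
      have "D * ((1 - A) * (1 - B) / C * inverse X * inverse Y) =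
          A * Q * (1 - B) * B * (1 - A) * (C * inverse C) * (X * inverse X) * (Y * inverse Y)"
        by (simp only: D_def divide_inverse mult_ac)
      thus ?thesis using nz by simp
    qed
    finally have "D * G 2 2 2 = D * (beta * G 1 1 1 + (1 - A) * (1 - B) / C * inverse X * inverse Y * G 0 0 0)"
      by (simp add: algebra_simps)
    hence "G 2 2 2 = beta * G 1 1 1 + (1 - A) * (1 - B) / C * inverse X * inverse Y * G 0 0 0"
      using D0 by simp
    moreover have "(1 - A) * (1 - B) / C = fls_const ((1 - a) * (1 - b) / c)"
      by (simp only: A_def B_def C_def fls_const_diff fls_const_mult fls_const_divide fls_const_1)
    ultimately show ?thesis by (simp only: Y_def)
  qed
  thus ?thesis by (rule that)
qed

lemma ratl_nfac: "ratl e q (nfac e q s)"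
proof -
  have "ratl e q (\<lambda>X. inverse (\<Prod>j=1..<n. 1 - fls_const (e * q ^ j) * X))" for n
  proof (induction n)
    case (Suc n)
    show ?case
    proof (cases "n \<ge> 1")
      case True
      have "ratl e q (\<lambda>X. inverse (\<Prod>j=1..<n. 1 - fls_const (e * q ^ j) * X) * inverse (1 - fls_const (e * q ^ n) * X))"
        using ratl_mult[OF Suc.IH ratl_inverse_factor[of e q "int n"]] by simp
      thus ?thesis by (rule ratl_cong) (use True in simp)
    qed (simp add: ratl_1)
  qed (simp add: ratl_1)
  thus ?thesis unfolding nfac_def [abs_def] using ratl_factor[of e q e] by (cases "s \<ge> 1") simp_all
qed

lemma ratl_shaped:
  assumes "shaped e q i s A" shows "ratl e q A"
proof -
  obtain r where r: "\<And>X. generic e q X \<Longrightarrow> A X = X powi i * nfac e q s X * ev r X"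
    using assms by (rule shapedE) blast
  have "ratl e q (\<lambda>X. X powi i * nfac e q s X * ev r X)"
    by (intro ratl_mult ratl_powi ratl_nfac ratl_ev)
  thus ?thesis by (rule ratl_cong) (rule r)
qed

text \<open>Expanding the same \<open>G k l m\<close> once in \<open>G 1 1 1\<close>, \<open>G 0 0 0\<close> and once in \<open>G 2 2 2\<close>, \<open>G 1 1 1\<close> leaves a linear relation
  between \<open>G 1 1 1\<close> and \<open>G 0 0 0\<close>. It holds for both solutions at infinity, whose Casoratian does not
  vanish, and so its coefficients are \<open>0\<close>.\<close>

theorem second_coefficient:
  assumes "reduces a b c q k l m A B" and "reduces (a * q) (b * q) (c * q) q (k - 1) (l - 1) (m - 1) A' B'"
    and "generic (a * b / c) q X"
  shows "B X = A' X * (fls_const ((1 - a) * (1 - b) / c) * inverse X * inverse (1 - fls_const (a * b / c * q) * X))"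
proof -
  interpret s: heine_params b a c q by (rule swap)
  have d: "a * q * (b * q) / (c * q) = a * b / c * q" using q0 by simp
  note r = assms(1)[unfolded reduces_def] and r' = assms(2)[unfolded reduces_def d]
  have rB: "ratl (a * b / c) q B" using r by blast
  have rA': "ratl (a * b / c) q A'"
    using ratl_shaped[of "a * b / c * q"] r' unfolding ratl_def generic_shift[OF q0] by blast
  define g where "g = (\<lambda>X. fls_const ((1 - a) * (1 - b) / c) * inverse X * inverse (1 - fls_const (a * b / c * q) * X))"
  have rg: "ratl (a * b / c) q g"
    unfolding g_def using ratl_inverse_factor[of "a * b / c" q 1]
    by (intro ratl_mult ratl_const ratl_inverse_X) simp
  have "B fls_X_inv = A' fls_X_inv * g fls_X_inv"
  proof -
    let ?X = "fls_X_inv :: complex fls"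
    obtain beta where b: "\<And>G. contiguous a b c q ?X G \<Longrightarrow> G 2 2 2 = beta * G 1 1 1 + g ?X * G 0 0 0"
      using three_levels[OF generic_fls_X_inv] unfolding g_def by metis
    define u where "u = A ?X - (A' ?X * beta + B' ?X)"
    define v where "v = B ?X - A' ?X * g ?X"
    have main: "u * G 1 1 1 + v * G 0 0 0 = 0" if G: "contiguous a b c q ?X G" for G
    proof -
      have 1: "G k l m = A ?X * G 1 1 1 + B ?X * G 0 0 0"
        using r G generic_fls_X_inv by blast
      have "G k l m = A' ?X * G 2 2 2 + B' ?X * G 1 1 1"
        using r' contiguous_shift[OF G] generic_fls_X_inv[of "a * b / c * q" q] by fastforce
      thus ?thesis unfolding 1 b[OF G] u_def v_def by (simp add: algebra_simps)
    qed
    have 1: "u * inf_sol 1 1 1 + v * inf_sol 0 0 0 = 0" by (rule main[OF contiguous_inf_sol])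
    have 2: "u * s.inf_sol 1 1 1 + v * s.inf_sol 0 0 0 = 0" using main[OF contiguous_inf_sol_swap] by simp
    have "v * (inf_sol 1 1 1 * s.inf_sol 0 0 0 - s.inf_sol 1 1 1 * inf_sol 0 0 0)
       = inf_sol 1 1 1 * (u * s.inf_sol 1 1 1 + v * s.inf_sol 0 0 0) - s.inf_sol 1 1 1 * (u * inf_sol 1 1 1 + v * inf_sol 0 0 0)"
      by (simp add: algebra_simps)
    hence "v * (inf_sol 1 1 1 * s.inf_sol 0 0 0 - s.inf_sol 1 1 1 * inf_sol 0 0 0) = 0"
      unfolding 1 2 by simp
    moreover have "inf_sol 1 1 1 * s.inf_sol 0 0 0 - s.inf_sol 1 1 1 * inf_sol 0 0 0 \<noteq> 0"
    proof -
      have "qbin q (a * b * q / c) (c / (a * b)) = qbin_s 1" by (simp add: qbin_s_def)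
      moreover have "1 / b - 1 / a \<noteq> 0" using a_neq_b a0 b0 by (simp add: field_simps)
      ultimately show ?thesis unfolding casoratian using qbin_s_nonzero by simp
    qed
    ultimately show ?thesis by (simp add: v_def)
  qed
  from ratl_eqI[OF rB ratl_mult[OF rA' rg] this assms(3)] show ?thesis unfolding g_def .
qed

end

section \<open>The three term relation at a point\<close>

lemma fls_const_powi: "fls_const x powi i = fls_const (x powi i :: complex)"
  by (cases "i \<ge> 0") (simp_all add: power_int_def fls_const_power fls_inverse_const)

lemma minus_one_powi_cong:
  assumes "even (i - j)" shows "(-1 :: complex) powi i = (-1) powi j"
proof -
  obtain t where "i - j = 2 * t" using assms by (rule evenE)
  hence i: "i = j + 2 * t" by simp
  have "(-1 :: complex) powi (2 * t) = ((-1) powi 2) powi t" by (simp only: power_int_mult)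
  also have "\<dots> = 1" by simp
  finally show ?thesis unfolding i by (simp add: power_int_add)
qed

lemma tri_double: "2 * tri n = n * (n - 1)"
  unfolding tri_def by (rule dvd_mult_div_cancel) auto

lemma nfac_fls_const:
  assumes "q \<noteq> 0"
  shows "nfac (a * b / c) q s (fls_const x) = fls_const (inverse (qpoch q (a * b * q * x / c) (max s 0 - 1)))"
proof (cases "s \<ge> 1")
  case True
  define n where "n = nat (s - 1)"
  have s: "s = int (Suc n)" "max s 0 - 1 = int n" using True by (auto simp: n_def)
  have c: "1 - fls_const (u :: complex) * fls_const x = fls_const (1 - u * x)" for u
    by (simp add: fls_const_diff)
  have p: "(\<Prod>j\<in>J. fls_const (f j)) = fls_const (\<Prod>j\<in>J. f j)" if "finite J" for f :: "nat \<Rightarrow> complex" and J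
    using that by (induction J) auto
  have "(\<Prod>j=1..<Suc n. 1 - a * b / c * q ^ j * x) = (\<Prod>j<n. 1 - a * b / c * q ^ Suc j * x)"
    by (rule prod.reindex_bij_witness[of _ Suc "\<lambda>j. j - 1"]) auto
  also have "\<dots> = qpoch q (a * b * q * x / c) (int n)"
    unfolding qpoch_nat by (intro prod.cong refl) (simp add: mult_ac)
  finally have "(\<Prod>j=1..<Suc n. 1 - a * b / c * q ^ j * x) = qpoch q (a * b * q * x / c) (int n)" .
  moreover have "nfac (a * b / c) q s (fls_const x) = inverse (\<Prod>j=1..<Suc n. fls_const (1 - a * b / c * q ^ j * x))"
    using True unfolding nfac_def c s(1) by (simp del: of_nat_Suc)
  ultimately show ?thesis unfolding s(2) p[OF finite_atLeastLessThan] by (simp add: fls_inverse_const)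
next
  case False
  hence s: "max s 0 - 1 = - int 1" "s \<le> 0" by auto
  have "inverse (\<Prod>j=1..1. inverse (1 - a * b * q * x / c * q powi (- int j))) = 1 - a * b * q * x / c * inverse q"
    by (simp add: power_int_minus)
  also have "\<dots> = 1 - a * b / c * x" using assms by (simp add: field_simps)
  finally show ?thesis unfolding s(1) nfac_nonpos[OF s(2)] qpoch_neg
    by (simp only: fls_const_diff fls_const_1 fls_const_mult)
qed

context heine_params
begin

text \<open>The constants collected in \<open>kappa\<close>, together with the normalisation of \<open>G\<close>, amount to \<open>lambda_Q\<close>.\<close>

lemma norm_factor_Q:
  "- lambda_Q k l m a b c q * (c / (q - c)) = qpoch q c m / (qpoch q a k * qpoch q b l) * kappa k l m"
proof -
  define M where "M = max (k + l - m) 0"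
  define d where "d = a * b / c"
  define N where "N = qpoch q c m / (qpoch q a k * qpoch q b l)"
  define T where "T = tri k + tri l - tri m + tri M"
  have d0: "d \<noteq> 0" using a0 b0 c0 by (simp add: d_def)
  have qc: "q - c \<noteq> 0" using notin(3) qpowersI[of q 1] by auto
  have ab: "a - b \<noteq> 0" "b - a \<noteq> 0" using a_neq_b by auto
  have "k * (k - 1) + l * (l - 1) - m * (m - 1) + M * (M - 1) = 2 * T"
    unfolding T_def tri_double [symmetric] by simp
  hence T: "(k * (k - 1) + l * (l - 1) - m * (m - 1) + M * (M - 1)) div 2 = T" by simp
  have "(- d) powi (M - 1) = ((-1) * d) powi (M - 1)" by simp
  hence dM: "(- d) powi (M - 1) = (-1) powi (M - 1) * (d powi M / d)"
    unfolding power_int_mult_distrib using d0 by (simp add: power_int_diff)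
  have sg: "(-1 :: complex) powi (k + l - m - 1 + M) = (-1) powi (k + l + m) * (-1) powi (M - 1)"
  proof -
    have "(-1 :: complex) powi (k + l + m) * (-1) powi (M - 1) = (-1) powi (k + l + m + (M - 1))"
      by (rule power_int_add [symmetric]) simp
    also have "\<dots> = (-1) powi (k + l - m - 1 + M)" by (rule minus_one_powi_cong) simp
    finally show ?thesis ..
  qed
  have qT: "q powi T = q powi (tri k + tri l - tri m) * q powi tri M"
    unfolding T_def by (rule power_int_add) (use q0 in simp)
  have L: "lambda_Q k l m a b c q = (-1) powi (k + l - m - 1 + M) * q powi T * ((q - c) * a powi k * b powi l / ((b - a) * c powi m)) * d powi M * N"
    unfolding lambda_Q_def Let_def M_def [symmetric] T d_def N_def ..
  have K: "kappa k l m = rho k l m * ((- d) powi (M - 1) * q powi tri M) / (1 / b - 1 / a)"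
    unfolding kappa_def d_def M_def ..
  have z: "d powi M / d / (1 / b - 1 / a) = - (d powi M * c / (b - a))"
    using ab a0 b0 c0 by (simp add: d_def divide_simps) (simp add: algebra_simps)
  have "N * kappa k l m = N * ((-1) powi (k + l + m) * (-1) powi (M - 1)) * (q powi (tri k + tri l - tri m) * q powi tri M) *
      (a powi k * b powi l / c powi m) * (d powi M / d / (1 / b - 1 / a))"
    unfolding K rho_def dM by (simp add: divide_inverse mult_ac)
  also have "\<dots> = - ((-1) powi (k + l - m - 1 + M) * q powi T * (1 * a powi k * b powi l / ((b - a) * c powi m)) * d powi M * N) * c"
    unfolding z sg [symmetric] qT [symmetric] by (simp add: divide_inverse mult_ac)
  also have "\<dots> = - lambda_Q k l m a b c q * (c / (q - c))"
    unfolding L using qc by simp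
  finally show ?thesis unfolding N_def ..
qed

text \<open>The same constants at \<open>aq, bq, cq\<close>; the additional powers of \<open>q\<close> turn \<open>M'(M' - 1)\<close> into \<open>M'(M' + 1)\<close>.\<close>

lemma norm_factor_R:
  "- lambda_R k l m a b c q = qpoch q c m / (qpoch q a k * qpoch q b l) * ((1 - a) * (1 - b) / c) *
     heine_params.kappa (a * q) (b * q) (c * q) q (k - 1) (l - 1) (m - 1)"
proof -
  interpret s: heine_params "a * q" "b * q" "c * q" q by (rule shifted)
  define M where "M = max (k + l - m - 1) 0"
  define d where "d = a * b / c"
  define N where "N = qpoch q c m / (qpoch q (a * q) (k - 1) * qpoch q (b * q) (l - 1))"
  define T where "T = tri k + tri l - tri m + tri M + M"
  have d0: "d \<noteq> 0" using a0 b0 c0 by (simp add: d_def)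
  have ab: "a - b \<noteq> 0" "b - a \<noteq> 0" using a_neq_b by auto
  have split: "qpoch q u n = (1 - u) * qpoch q (u * q) (n - 1)" if "u \<notin> qpowers q" for u n
    using qpoch_add[OF q0 that, of 1 "n - 1"] by (simp add: qpoch_def)
  have N: "qpoch q c m / (qpoch q a k * qpoch q b l) * ((1 - a) * (1 - b) / c) = N / c"
    using one_minus_neq_0(1,2)[of 0] unfolding N_def split[OF notin(1), of k] split[OF notin(2), of l]
    by (simp add: divide_simps)
  have M2: "M * (M + 1) = 2 * (tri M + M)" using tri_double[of M] by (simp add: algebra_simps)
  have "k * (k - 1) + l * (l - 1) - m * (m - 1) + M * (M + 1) = 2 * T"
    unfolding T_def M2 tri_double [symmetric] by simp
  hence T: "(k * (k - 1) + l * (l - 1) - m * (m - 1) + M * (M + 1)) div 2 = T" by simp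
  have L: "lambda_R k l m a b c q = (-1) powi (k + l - m + M) * q powi T * (a powi k * b powi l / ((b - a) * c powi m)) * d powi (M - 1) * N"
    unfolding lambda_R_def Let_def M_def [symmetric] T d_def N_def ..
  have "k - 1 + (l - 1) - (m - 1) = k + l - m - 1" by simp
  hence M': "max (k - 1 + (l - 1) - (m - 1)) 0 = M" by (simp only: M_def)
  have d': "a * q * (b * q) / (c * q) = d * q" using q0 by (simp add: d_def)
  have "(- (d * q)) powi (M - 1) = (((-1) * q) * d) powi (M - 1)" by (simp add: mult.commute)
  hence dM: "(- (d * q)) powi (M - 1) = (-1) powi (M - 1) * q powi (M - 1) * d powi (M - 1)"
    by (simp only: power_int_mult_distrib)
  have sg: "(-1 :: complex) powi (k + l - m + M) = (-1) powi (k - 1 + (l - 1) + (m - 1)) * (-1) powi (M - 1)"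
  proof -
    have "(-1 :: complex) powi (k - 1 + (l - 1) + (m - 1)) * (-1) powi (M - 1) = (-1) powi (k - 1 + (l - 1) + (m - 1) + (M - 1))"
      by (rule power_int_add [symmetric]) simp
    also have "\<dots> = (-1) powi (k + l - m + M)" by (rule minus_one_powi_cong) simp
    finally show ?thesis ..
  qed
  have t1: "tri n = tri (n - 1) + (n - 1)" for n using tri_plus1[of "n - 1"] by simp
  have q1: "q powi (tri (k - 1) + tri (l - 1) - tri (m - 1)) * q powi (k - 1) * q powi (l - 1) * inverse (q powi (m - 1)) *
      q powi (M - 1) * q powi tri M * q = q powi T"
  proof -
    have "T = (tri (k - 1) + tri (l - 1) - tri (m - 1)) + (k - 1) + (l - 1) + (- (m - 1)) + (M - 1) + tri M + 1"
      unfolding T_def t1[of k] t1[of l] t1[of m] by simp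
    thus ?thesis using q0 by (simp only: power_int_add[OF disjI1[OF q0]] power_int_minus power_int_1_right)
  qed
  have z: "1 / (1 / (b * q) - 1 / (a * q)) = - (q * (a * b / (b - a)))"
    using ab a0 b0 q0 by (simp add: divide_simps) (simp add: algebra_simps)
  have p: "a powi (k - 1) * a = a powi k" "b powi (l - 1) * b = b powi l" "inverse (c powi (m - 1)) * inverse c = inverse (c powi m)"
    using a0 b0 c0 by (simp_all add: power_int_diff divide_inverse)
  have "s.kappa (k - 1) (l - 1) (m - 1) = ((-1) powi (k - 1 + (l - 1) + (m - 1)) * q powi (tri (k - 1) + tri (l - 1) - tri (m - 1)) *
      (a powi (k - 1) * q powi (k - 1)) * (b powi (l - 1) * q powi (l - 1)) / (c powi (m - 1) * q powi (m - 1))) *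
      ((-1) powi (M - 1) * q powi (M - 1) * d powi (M - 1) * q powi tri M) * (1 / (1 / (b * q) - 1 / (a * q)))"
    unfolding s.kappa_def s.rho_def M' d' dM power_int_mult_distrib by simp
  hence "N / c * s.kappa (k - 1) (l - 1) (m - 1) = - (((-1) powi (k - 1 + (l - 1) + (m - 1)) * (-1) powi (M - 1)) *
     (q powi (tri (k - 1) + tri (l - 1) - tri (m - 1)) * q powi (k - 1) * q powi (l - 1) * inverse (q powi (m - 1)) *
      q powi (M - 1) * q powi tri M * q) * ((a powi (k - 1) * a) * (b powi (l - 1) * b) * (inverse (c powi (m - 1)) * inverse c) / (b - a)) * d powi (M - 1) * N)"
    unfolding z by (simp add: divide_inverse mult_ac)
  also have "\<dots> = - lambda_R k l m a b c q"
    unfolding L sg [symmetric] q1 p by (simp add: divide_inverse mult_ac)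
  finally show ?thesis unfolding N ..
qed

text \<open>For a number \<open>x\<close> the universal coefficients are evaluated at the solution at the origin.\<close>

theorem three_term_at_generic_point:
  assumes kl: "k \<le> l" and x: "norm x < 1" and X: "generic (a * b / c) q (fls_const x)"
  shows "phi21 (a * q powi k) (b * q powi l) (c * q powi m) q x =
     Q_expr k l m a b c q x * phi21 (a * q) (b * q) (c * q) q x + R_expr k l m a b c q x * phi21 a b c q x"
proof -
  interpret s: heine_params "a * q" "b * q" "c * q" q by (rule shifted)
  define d where "d = a * b / c"
  have d': "a * q * (b * q) / (c * q) = d * q" using q0 by (simp add: d_def)
  have X': "generic (a * q * (b * q) / (c * q)) q (fls_const x)"
    unfolding d' generic_shift[OF q0] using X by (simp only: d_def)
  have x0: "x \<noteq> 0" using genericD(1)[OF X] by simp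
  have dx: "1 - d * q powi j * x \<noteq> 0" for j
    using genericD(2)[OF X, of j] unfolding d_def fls_const_mult_const
    by (metis fls_const_0 fls_const_1 fls_const_diff)
  obtain A B where AB: "reduces a b c q k l m A B" using reducible_all[of k l m] unfolding reducible_def by blast
  obtain A' B' where AB': "reduces (a * q) (b * q) (c * q) q (k - 1) (l - 1) (m - 1) A' B'"
    using s.reducible_all[of "k - 1" "l - 1" "m - 1"] unfolding reducible_def by blast
  obtain r where r: "\<And>X. generic (a * b / c) q X \<Longrightarrow> A X = X powi (1 - max m 0) * nfac (a * b / c) q (k + l - m) X * ev r X"
    using shapedE[OF conjunct1[OF AB[unfolded reduces_def]]] by blast
  obtain r' where r': "\<And>X. generic (a * q * (b * q) / (c * q)) q X \<Longrightarrow> A' X = X powi (1 - max (m - 1) 0) *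
      nfac (a * q * (b * q) / (c * q)) q (k - 1 + (l - 1) - (m - 1)) X * ev r' X"
    using shapedE[OF conjunct1[OF AB'[unfolded reduces_def]]] by blast
  define M where "M = max (k + l - m) 0"
  define M' where "M' = max (k + l - m - 1) 0"
  have "k - 1 + (l - 1) - (m - 1) = k + l - m - 1" by simp
  hence M': "max (k - 1 + (l - 1) - (m - 1)) 0 = M'" by (simp only: M'_def)
  define P where "P = P_poly k l m a b c q x"
  define P' where "P' = P_poly (k - 1) (l - 1) (m - 1) (a * q) (b * q) (c * q) q x"
  define QA where "QA = x powi (1 - max m 0) * inverse (qpoch q (a * b * q * x / c) (M - 1)) * (kappa k l m * P)"
  define QA' where "QA' = x powi (1 - max (m - 1) 0) * inverse (qpoch q (a * q * (b * q) * q * x / (c * q)) (M' - 1)) *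
     (s.kappa (k - 1) (l - 1) (m - 1) * P')"
  define QB where "QB = QA' * ((1 - a) * (1 - b) / c * inverse x * inverse (1 - d * q * x))"
  have pr: "poly r x = kappa k l m * P"
    unfolding P_def by (rule coefficient_polynomial[OF kl AB]) (rule r)
  have A: "A (fls_const x) = fls_const QA"
    unfolding r[OF X] nfac_fls_const[OF q0] fls_const_powi ev_fls_const pr M_def [symmetric]
    by (simp add: QA_def)
  have pr': "poly r' x = s.kappa (k - 1) (l - 1) (m - 1) * P'"
    unfolding P'_def by (rule s.coefficient_polynomial[OF _ AB']) (use kl in simp, rule r')
  have A': "A' (fls_const x) = fls_const QA'"
    unfolding r'[OF X'] nfac_fls_const[OF q0] fls_const_powi ev_fls_const M' pr'
    by (simp add: QA'_def)
  have B: "B (fls_const x) = fls_const QB"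
  proof -
    have "inverse (1 - fls_const (a * b / c * q) * fls_const x) = fls_const (inverse (1 - d * q * x))"
      unfolding d_def fls_const_mult_const by (metis fls_const_1 fls_const_diff fls_inverse_const)
    thus ?thesis
      unfolding second_coefficient[OF AB AB' X] A' by (simp add: QB_def fls_inverse_const mult.assoc)
  qed
  have "fls_const (zero_fun k l m x) = A (fls_const x) * fls_const (zero_fun 1 1 1 x) + B (fls_const x) * fls_const (zero_fun 0 0 0 x)"
    using AB X contiguous_zero_fun[OF x] unfolding reduces_def by blast
  hence "fls_const (zero_fun k l m x) = fls_const (QA * zero_fun 1 1 1 x + QB * zero_fun 0 0 0 x)"
    unfolding A B by (simp add: fls_const_add)
  hence z: "zero_fun k l m x = QA * zero_fun 1 1 1 x + QB * zero_fun 0 0 0 x"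
    by (metis fls_const_nth)
  define N where "N = qpoch q c m / (qpoch q a k * qpoch q b l)"
  have nz: "qpoch q c m \<noteq> 0" "qpoch q a k \<noteq> 0" "qpoch q b l \<noteq> 0"
    using qpoch_nonzero[OF q0] notin by blast+
  have "N * zero_fun k l m x = phi21 (a * q powi k) (b * q powi l) (c * q powi m) q x"
    unfolding phi21_zero_fun[OF x] N_def using nz by simp
  moreover have "zero_fun 1 1 1 x = (1 - a) * (1 - b) / (1 - c) * phi21 (a * q) (b * q) (c * q) q x"
    unfolding phi21_zero_fun[OF x] by (simp add: qpoch_def)
  moreover have "zero_fun 0 0 0 x = phi21 a b c q x"
    unfolding phi21_zero_fun[OF x] by simp
  ultimately have main: "phi21 (a * q powi k) (b * q powi l) (c * q powi m) q x =
      N * QA * ((1 - a) * (1 - b) / (1 - c)) * phi21 (a * q) (b * q) (c * q) q x + N * QB * phi21 a b c q x"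
    unfolding z by (simp add: algebra_simps)
  have Q: "N * QA * ((1 - a) * (1 - b) / (1 - c)) = Q_expr k l m a b c q x"
  proof -
    have "Q_expr k l m a b c q x = (- lambda_Q k l m a b c q * (c / (q - c))) * ((1 - a) * (1 - b) / (1 - c)) *
      (x powi (1 - max m 0) * inverse (qpoch q (a * b * q * x / c) (M - 1))) * P"
      unfolding Q_expr_def M_def P_def by (simp add: divide_inverse mult_ac)
    also have "\<dots> = N * QA * ((1 - a) * (1 - b) / (1 - c))"
      unfolding norm_factor_Q N_def [symmetric] QA_def by (simp add: mult_ac)
    finally show ?thesis ..
  qed
  have R: "N * QB = R_expr k l m a b c q x"
  proof -
    have u: "d * q * x \<notin> qpowers q"
    proof
      assume "d * q * x \<in> qpowers q"
      then obtain j where "d * q * x = q powi j" by (auto simp: qpowers_def)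
      hence "d * q powi (1 - j) * x = 1" using q0 by (simp add: power_int_diff field_simps)
      thus False using dx[of "1 - j"] by simp
    qed
    have e: "a * q * (b * q) * q * x / (c * q) = d * q * x * q" "a * b * q * x / c = d * q * x"
      using q0 by (simp_all add: d_def)
    have qp: "qpoch q (d * q * x) M' = (1 - d * q * x) * qpoch q (d * q * x * q) (M' - 1)"
      using qpoch_add[OF q0 u, of 1 "M' - 1"] by (simp add: qpoch_def)
    have xp: "x powi (1 - max (m - 1) 0) * inverse x = x powi (- max (m - 1) 0)"
      using x0 by (simp add: power_int_diff power_int_minus divide_inverse)
    have "R_expr k l m a b c q x = (N * ((1 - a) * (1 - b) / c) * s.kappa (k - 1) (l - 1) (m - 1)) *
       (x powi (1 - max (m - 1) 0) * inverse x / ((1 - d * q * x) * qpoch q (d * q * x * q) (M' - 1))) * P'"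
      unfolding R_expr_def norm_factor_R M'_def [symmetric] P'_def [symmetric] N_def [symmetric] e xp qp ..
    also have "\<dots> = N * QB"
      unfolding QB_def QA'_def e by (simp add: divide_inverse mult_ac)
    finally show ?thesis ..
  qed
  show ?thesis using main unfolding Q R .
qed

end

section \<open>Independence over the rational functions of \<open>x\<close>\<close>

lemma coeff_mult_top:
  assumes "degree p \<le> m" "degree r \<le> n"
  shows "coeff (p * r) (m + n) = coeff p m * coeff (r :: complex poly) n"
proof -
  have "coeff (p * r) (m + n) = (\<Sum>i\<le>m + n. coeff p i * coeff r (m + n - i))" by (rule coeff_mult)
  also have "\<dots> = (\<Sum>i\<le>m + n. if i = m then coeff p m * coeff r n else 0)"
  proof (rule sum.cong[OF refl])
    fix i assume "i \<in> {..m + n}"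
    show "coeff p i * coeff r (m + n - i) = (if i = m then coeff p m * coeff r n else 0)"
    proof (cases i m rule: linorder_cases)
      case less
      hence "coeff r (m + n - i) = 0" using assms(2) by (intro coeff_eq_0) simp
      thus ?thesis using less by simp
    next
      case greater
      hence "coeff p i = 0" using assms(1) by (intro coeff_eq_0) simp
      thus ?thesis using greater by simp
    qed simp
  qed
  finally show ?thesis by simp
qed

lemma infinite_disc:
  assumes "\<epsilon> > 0" shows "infinite {x :: complex. norm x < \<epsilon>}"
proof -
  have "{x :: complex. norm x < \<epsilon>} = ball 0 \<epsilon>" by (auto simp: dist_norm)
  thus ?thesis using uncountable_ball[OF assms, of "0 :: complex"] countable_finite by metis
qed

context heine_params
begin

text \<open>Heine's \<open>q\<close>-difference equation.\<close>

lemma zero_fun_q_difference: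
  assumes x: "norm x < 1"
  shows "(1 - x) * zero_fun 0 0 0 x - (1 + c / q - (a + b) * x) * zero_fun 0 0 0 (q * x)
    + (c / q - a * b * x) * zero_fun 0 0 0 (q * (q * x)) = 0"
proof -
  let ?z = "zero_coeff 0 0 0" and ?f = "zero_fun 0 0 0"
  have q1: "norm q < 1" using q by (simp add: unit_disc_def)
  have qx: "norm (q * x) < 1"
    using norm_mult_less[OF q1 x] by simp
  have qqx: "norm (q * (q * x)) < 1"
    using norm_mult_less[OF q1 qx] by simp
  have s: "(\<lambda>n. ?z n * y ^ n) sums ?f y" if "norm y < 1" for y
    unfolding zero_fun_def by (rule summable_sums) (rule summable_zero_coeff[OF that])
  define L where "L = (\<lambda>n. ?z n * x ^ n - (1 + c / q) * (?z n * (q * x) ^ n) + c / q * (?z n * (q * (q * x)) ^ n))"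
  define R where "R = (\<lambda>n. x * (?z n * x ^ n - (a + b) * (?z n * (q * x) ^ n) + a * b * (?z n * (q * (q * x)) ^ n)))"
  have L: "L sums (?f x - (1 + c / q) * ?f (q * x) + c / q * ?f (q * (q * x)))"
    unfolding L_def by (intro sums_add sums_diff sums_mult s x qx qqx)
  have R: "R sums (x * (?f x - (a + b) * ?f (q * x) + a * b * ?f (q * (q * x))))"
    unfolding R_def by (intro sums_add sums_diff sums_mult s x qx qqx)
  have "L (Suc n) = R n" for n
  proof -
    have 1: "(1 - q ^ Suc n) * ?z (Suc n) = (1 - a * q ^ n) * (1 - b * q ^ n) * zero_coeff 0 0 1 n"
      using zero_coeff_klm[of 0 0 0 n] zero_coeff_k[of 0 1 1 n] zero_coeff_l[of 0 0 1 n] by simp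
    have 2: "?z n = (1 - c * q ^ n) * zero_coeff 0 0 1 n"
      using zero_coeff_m[of 0 0 0 n] by simp
    have "L (Suc n) = ((1 - q ^ Suc n) * ?z (Suc n)) * (1 - c * q ^ n) * x ^ Suc n"
    proof -
      have alg: "z * X - (1 + g) * (z * (Q * X)) + g * (z * (Q * (Q * X))) = (1 - Q) * z * (1 - g * Q) * X"
        for z X g Q :: complex
        by (simp add: algebra_simps)
      have "c * q ^ n = c / q * q ^ Suc n" using q0 by simp
      thus ?thesis unfolding L_def power_mult_distrib by (simp only: alg)
    qed
    also have "\<dots> = (1 - a * q ^ n) * (1 - b * q ^ n) * ?z n * x ^ Suc n"
      unfolding 1 2 by (simp only: mult_ac)
    also have "\<dots> = R n" unfolding R_def by (simp add: power_mult_distrib algebra_simps)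
    finally show ?thesis .
  qed
  moreover have "L 0 = 0" by (simp add: L_def algebra_simps)
  ultimately have "R sums (?f x - (1 + c / q) * ?f (q * x) + c / q * ?f (q * (q * x)))"
    using L sums_Suc_iff[of L] by (metis (no_types, lifting) add.right_neutral ext)
  from sums_unique2[OF this R] show ?thesis by (simp add: algebra_simps)
qed

lemma zero_fun_at_0: "zero_fun 0 0 0 0 = 1"
proof -
  have "zero_fun 0 0 0 0 = zero_coeff 0 0 0 0" unfolding zero_fun_def by (rule powser_zero)
  thus ?thesis by (simp add: zero_coeff_def qpoch_def)
qed

lemma zero_fun_111:
  assumes x: "norm x < 1"
  shows "x * zero_fun 1 1 1 x = zero_fun 0 0 0 x - zero_fun 0 0 0 (q * x)"
proof -
  have q1: "norm q < 1" using q by (simp add: unit_disc_def)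
  have qx: "norm (q * x) < 1" using norm_mult_less[OF q1 x] by simp
  note S = summable_zero_coeff
  have "x * zero_fun 1 1 1 x = (\<Sum>n. zero_coeff 0 0 0 n * x ^ n - zero_coeff 0 0 0 n * (q * x) ^ n)"
    using zero_fun_shift(1)[OF x, of 0 0 0] by (simp add: power_mult_distrib algebra_simps)
  also have "\<dots> = zero_fun 0 0 0 x - zero_fun 0 0 0 (q * x)"
    unfolding zero_fun_def by (rule suminf_diff [symmetric]) (intro S x qx)+
  finally show ?thesis .
qed

lemma zero_fun_nonzero_near_0:
  obtains \<epsilon> where "\<epsilon> > 0" "\<epsilon> \<le> 1" "\<And>x. norm x < \<epsilon> \<Longrightarrow> zero_fun 0 0 0 x \<noteq> 0"
proof -
  have "isCont (zero_fun 0 0 0) 0" by (rule isCont_zero_fun) simp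
  hence "(zero_fun 0 0 0 \<longlongrightarrow> 1) (at 0)" unfolding isCont_def zero_fun_at_0 .
  hence "\<forall>\<^sub>F x in at 0. zero_fun 0 0 0 x \<noteq> 0" by (rule tendsto_imp_eventually_ne) simp
  then obtain e where e: "e > 0" "\<And>x. x \<noteq> 0 \<Longrightarrow> dist x 0 < e \<Longrightarrow> zero_fun 0 0 0 x \<noteq> 0"
    unfolding eventually_at by auto
  show ?thesis
  proof (rule that[of "min e 1"])
    show "zero_fun 0 0 0 x \<noteq> 0" if "norm x < min e 1" for x
      using e(2)[of x] that zero_fun_at_0 by (cases "x = 0") auto
  qed (use e in auto)
qed

text \<open>If \<open>f(x)/f(qx)\<close> is a rational function \<open>v/u\<close>, Heine's equation becomes the Riccati equation
  \<open>eq\<close>. As \<open>u\<close> and \<open>v\<close> are coprime, the equation gives \<open>u \<bar> (1 - x) v(qx)\<close> and \<open>v(qx) \<bar> (c/q - abx) u\<close>; so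
  \<open>u\<close> and \<open>v(qx)\<close> are equal up to one linear factor on each side, and there are two cases.
  The leading coefficients show that \<open>v/u\<close> is \<open>a\<close> or \<open>b\<close> at infinity, the value at \<open>0\<close> is \<open>1\<close>, and
  in each case this makes one of \<open>a\<close>, \<open>b\<close>, \<open>c/a\<close>, \<open>c/b\<close> a power of \<open>q\<close>.\<close>

lemma riccati_no_rational_solution:
  fixes u v :: "complex poly"
  defines "dl \<equiv> (\<lambda>p :: complex poly. p \<circ>\<^sub>p [:0, q:])"
  assumes eq: "[:1, -1:] * v * dl v - [:1 + c / q, - (a + b):] * u * dl v + [:c / q, - (a * b):] * u * dl u = 0"
    and cop: "coprime u v" and at0: "poly u 0 = poly v 0"
  shows False
proof -
  have dl_coeff: "coeff (dl p) n = q ^ n * coeff p n" for p n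
    unfolding dl_def by (rule coeff_pcompose_linear)
  have dl_deg: "degree (dl p) = degree p" for p
    unfolding dl_def using q0 by (simp add: degree_pcompose)
  have dl_mult: "dl (p * r) = dl p * dl r" "dl (p + r) = dl p + dl r" "dl 1 = 1" for p r
    unfolding dl_def by (simp_all add: pcompose_mult pcompose_add one_pCons)
  have dl_0: "poly (dl p) 0 = poly p 0" for p
    unfolding dl_def by (simp add: poly_pcompose)
  have cop': "coprime (dl u) (dl v)"
  proof -
    obtain s t where "s * u + t * v = 1" using cop by (metis bezout_coefficients_fst_snd coprime_iff_gcd_eq_1)
    hence "dl s * dl u + dl t * dl v = 1" using dl_mult by metis
    thus ?thesis
      by (metis coprimeI dvd_add dvd_mult)
  qed
  define K where "K = max (degree u) (degree v)"
  have dk: "degree u \<le> K" "degree v \<le> K" by (simp_all add: K_def)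
  have "u \<noteq> 0 \<or> v \<noteq> 0" using cop by auto
  hence top: "coeff u K \<noteq> 0 \<or> coeff v K \<noteq> 0"
  proof (cases "degree u \<ge> degree v")
    case True
    hence "K = degree u" by (simp add: K_def)
    thus ?thesis using \<open>u \<noteq> 0 \<or> v \<noteq> 0\<close> True by (metis degree_0 leading_coeff_0_iff le_zero_eq)
  next
    case False
    hence "K = degree v" "v \<noteq> 0" by (auto simp: K_def)
    thus ?thesis by simp
  qed
  \<comment> \<open>The top coefficient of the equation, in degree \<open>2K + 1\<close>, factors as in the characteristic equation at infinity.\<close>
  have c3: "coeff ([:s, t:] * p * dl r) (1 + K + K) = t * coeff p K * (q ^ K * coeff r K)"
    if "degree p \<le> K" "degree r \<le> K" for s t p r
  proof -
    have "degree ([:s, t:] * p) \<le> 1 + K"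
      using degree_mult_le[of "[:s, t:]" p] that(1) by (auto split: if_splits)
    moreover have "coeff ([:s, t:] * p) (1 + K) = t * coeff p K"
      using coeff_mult_top[of "[:s, t:]" 1 p K] that(1) by simp
    ultimately show ?thesis
      using coeff_mult_top[of "[:s, t:] * p" "1 + K" "dl r" K] that(2) by (simp add: dl_deg dl_coeff)
  qed
  have "- 1 * coeff v K * (q ^ K * coeff v K) - - (a + b) * coeff u K * (q ^ K * coeff v K) + - (a * b) * coeff u K * (q ^ K * coeff u K) = 0"
    using arg_cong[OF eq, of "\<lambda>p. coeff p (1 + K + K)"]
    unfolding coeff_add coeff_diff c3[OF dk(2) dk(2)] c3[OF dk(1) dk(2)] c3[OF dk(1) dk(1)] coeff_0 .
  hence "q ^ K * ((coeff v K - a * coeff u K) * (coeff v K - b * coeff u K)) = 0"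
    by (simp add: algebra_simps)
  hence lc: "coeff v K = a * coeff u K \<or> coeff v K = b * coeff u K" using q0 by auto
  hence nz: "coeff u K \<noteq> 0" "coeff v K \<noteq> 0" using top a0 b0 by auto
  have u0: "u \<noteq> 0" "dl v \<noteq> 0" using nz dl_coeff[of v K] q0 by auto
  have alg: "L1 * v * v' = u * (L2 * v' - L3 * u')" "L3 * u * u' = v' * (L2 * u - L1 * v)"
    if "L1 * v * v' - L2 * u * v' + L3 * u * u' = 0" for L1 L2 L3 u v u' v' :: "complex poly"
    using that by algebra+
  have "u dvd [:1, -1:] * dl v * v"
  proof -
    have "[:1, -1:] * v * dl v = u * ([:1 + c / q, - (a + b):] * dl v - [:c / q, - (a * b):] * dl u)"
      by (rule alg(1)[OF eq])
    thus ?thesis by (metis dvd_triv_left mult.assoc mult.commute)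
  qed
  hence "u dvd [:1, -1:] * dl v" using cop by (simp add: coprime_dvd_mult_left_iff)
  then obtain e1 where e1: "[:1, -1:] * dl v = u * e1" by (rule dvdE)
  have "dl v dvd [:c / q, - (a * b):] * u * dl u"
  proof -
    have "[:c / q, - (a * b):] * u * dl u = dl v * ([:1 + c / q, - (a + b):] * u - [:1, -1:] * v)"
      by (rule alg(2)[OF eq])
    thus ?thesis by (metis dvd_triv_left)
  qed
  hence "dl v dvd [:c / q, - (a * b):] * u"
    using cop' by (simp add: coprime_dvd_mult_left_iff coprime_commute)
  then obtain e2 where e2: "[:c / q, - (a * b):] * u = dl v * e2" by (rule dvdE)
  have "u * (e1 * e2) = ([:1, -1:] * dl v) * e2" unfolding e1 by (simp only: mult_ac)
  also have "\<dots> = [:1, -1:] * ([:c / q, - (a * b):] * u)" unfolding e2 by (simp only: mult_ac)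
  finally have e12: "e1 * e2 = [:1, -1:] * [:c / q, - (a * b):]"
    using u0(1) by (metis mult.assoc mult.commute mult_left_cancel)
  have degu: "degree u = K" "degree v = K"
    using nz le_degree[of u K] le_degree[of v K] by (auto simp: K_def)
  have dp: "degree e = 1" if "L * p = p' * e" "degree L = 1" "p \<noteq> 0" "degree p = K" "degree p' = K"
    for L p p' e :: "complex poly"
  proof -
    have "L \<noteq> 0" using that(2) by auto
    hence "degree (L * p) = 1 + K" "L * p \<noteq> 0" using degree_mult_eq[of L p] that by auto
    moreover from this have "p' \<noteq> 0" "e \<noteq> 0" unfolding that(1) by auto
    ultimately show ?thesis using degree_mult_eq[of p' e] that(5) unfolding that(1) by simp
  qed
  have d1: "degree e1 = 1" "degree e2 = 1"
    using dp[OF e1] dp[OF e2] u0 degu dl_deg a0 b0 by simp_all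
  have v0: "poly v 0 \<noteq> 0"
  proof
    assume "poly v 0 = 0"
    hence "[:0, 1:] dvd u" "[:0, 1:] dvd v" using at0 by (auto simp: poly_eq_0_iff_dvd)
    hence "is_unit ([:0, 1:] :: complex poly)" using cop by (meson coprime_common_divisor)
    thus False by (simp add: is_unit_iff_degree)
  qed
  have lin: "\<exists>t. e = smult t [:1, -1:]" if "degree e = 1" "poly e 1 = 0" for e :: "complex poly"
  proof -
    have "[:-1, 1:] dvd e" using that(2) by (simp add: poly_eq_0_iff_dvd)
    then obtain w where w: "e = [:-1, 1:] * w" by (rule dvdE)
    have "w \<noteq> 0" using that(1) w by auto
    hence "degree w = 0" using that(1) degree_mult_eq[of "[:-1, 1:]" w] unfolding w by simp
    then obtain t where "w = [:t:]" by (rule degree_eq_zeroE)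
    hence "e = smult (- t) [:1, -1:]" using w by simp
    thus ?thesis ..
  qed
  have "poly e1 1 * poly e2 1 = 0" using arg_cong[OF e12, of "\<lambda>p. poly p 1"] by simp
  moreover have False if z: "poly e1 1 = 0"
  proof -
    obtain t where t: "e1 = smult t [:1, -1:]" using lin[OF d1(1) z] by blast
    have "[:1, -1:] * dl v = [:1, -1:] * smult t u"
      using e1 unfolding t mult_smult_right by (simp only: mult.commute)
    moreover have "([:1, -1:] :: complex poly) \<noteq> 0" by simp
    ultimately have vu: "dl v = smult t u" by (metis mult_left_cancel)
    have "t = 1" using arg_cong[OF vu, of "\<lambda>p. poly p 0"] at0 v0 by (simp add: dl_0)
    hence "q ^ K * coeff v K = coeff u K" using arg_cong[OF vu, of "\<lambda>p. coeff p K"] by (simp add: dl_coeff)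
    hence "a * q powi int K = 1 \<or> b * q powi int K = 1" using lc nz by (auto simp: mult.commute)
    thus False using one_minus_neq_0(1,2)[of "int K"] by auto
  qed
  moreover have False if z: "poly e2 1 = 0"
  proof -
    obtain t where t: "e2 = smult t [:1, -1:]" using lin[OF d1(2) z] by blast
    have uv: "[:c / q, - (a * b):] * u = [:1, -1:] * smult t (dl v)"
      using e2 unfolding t mult_smult_right by (simp only: mult.commute)
    have "c / q * poly v 0 = t * poly v 0" using arg_cong[OF uv, of "\<lambda>p. poly p 0"] at0 by (simp add: dl_0)
    hence "t = c / q" using v0 by (metis mult_right_cancel)
    moreover have "- (a * b) * coeff u K = - 1 * (t * (q ^ K * coeff v K))"
    proof -
      have s1: "coeff ([:c / q, - (a * b):] * u) (1 + K) = coeff [:c / q, - (a * b):] 1 * coeff u K"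
        by (rule coeff_mult_top) (use degu in simp_all)
      have s2: "coeff ([:1, -1:] * smult t (dl v)) (1 + K) = coeff [:1, -1:] 1 * coeff (smult t (dl v)) K"
        by (rule coeff_mult_top) (use degu degree_smult_le[of t "dl v"] in \<open>simp_all add: dl_deg\<close>)
      have "coeff [:c / q, - (a * b):] 1 * coeff u K = coeff [:1, -1:] 1 * coeff (smult t (dl v)) K"
        unfolding s1 [symmetric] s2 [symmetric] uv ..
      thus ?thesis by (simp add: dl_coeff)
    qed
    ultimately have "a * b * coeff u K = c / q * q ^ K * coeff v K" by simp
    hence "c / b * q powi (int K - 1) = 1 \<or> c / a * q powi (int K - 1) = 1"
      using lc nz a0 b0 q0 by (auto simp: power_int_diff field_simps)
    thus False using one_minus_qpow_nonzero[OF q0 notin(5), of "int K - 1"] one_minus_qpow_nonzero[OF q0 notin(6), of "int K - 1"]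
      by auto
  qed
  ultimately show False by auto
qed

text \<open>Since \<open>x G 1 1 1 = f(x) - f(qx)\<close> for \<open>f = G 0 0 0\<close>, a linear relation makes \<open>f(x)/f(qx)\<close> rational.\<close>

theorem phi21_independent:
  assumes rel: "\<And>x. norm x < 1 \<Longrightarrow> poly p1 x * phi21 (a * q) (b * q) (c * q) q x + poly p2 x * phi21 a b c q x = 0"
  shows "p1 = 0 \<and> p2 = 0"
proof (rule ccontr)
  assume ne: "\<not> (p1 = 0 \<and> p2 = 0)"
  let ?f = "zero_fun 0 0 0"
  obtain \<epsilon> where e: "\<epsilon> > 0" "\<epsilon> \<le> 1" "\<And>x. norm x < \<epsilon> \<Longrightarrow> ?f x \<noteq> 0"
    by (rule zero_fun_nonzero_near_0) blast
  have q1: "norm q < 1" using q by (simp add: unit_disc_def)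
  have qe: "norm (q * x) < \<epsilon>" if "norm x < \<epsilon>" for x
    using norm_mult_less[OF q1 that] by simp
  define t where "t = (1 - a) * (1 - b) / (1 - c)"
  have t0: "t \<noteq> 0" using one_minus_neq_0[of 0] by (simp add: t_def)
  define U where "U = p1 + smult t ([:0, 1:] * p2)"
  have f1: "?f x = phi21 a b c q x" "zero_fun 1 1 1 x = t * phi21 (a * q) (b * q) (c * q) q x" if "norm x < 1" for x
    unfolding phi21_zero_fun[OF that] t_def by (simp_all add: qpoch_def)
  have UV: "poly U x * ?f x = poly p1 x * ?f (q * x)" if "norm x < \<epsilon>" for x
  proof -
    have x: "norm x < 1" using that e by simp
    have "poly p1 x * (t * phi21 (a * q) (b * q) (c * q) q x) * x + t * x * poly p2 x * phi21 a b c q x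
       = t * x * (poly p1 x * phi21 (a * q) (b * q) (c * q) q x + poly p2 x * phi21 a b c q x)"
      by (simp add: algebra_simps)
    also have "\<dots> = 0" using rel[OF x] by simp
    finally have "poly p1 x * (x * zero_fun 1 1 1 x) + t * x * poly p2 x * ?f x = 0"
      unfolding f1(1)[OF x] f1(2)[OF x] by (simp add: algebra_simps)
    thus ?thesis unfolding zero_fun_111[OF x] U_def by (simp add: algebra_simps)
  qed
  have ne': "\<not> (U = 0 \<and> p1 = 0)" using ne t0 by (auto simp: U_def)
  \<comment> \<open>The relation \<open>U f(x) = p1 f(qx)\<close> in lowest terms; it then holds only off the zeros of the common factor.\<close>
  define g where "g = gcd U p1"
  have g0: "g \<noteq> 0" using ne' by (auto simp: g_def)
  obtain u v where uv: "U = u * g" "p1 = v * g" and cop: "coprime u v"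
    using gcd_coprime_exists[OF g0[unfolded g_def]] unfolding g_def by blast
  have off: "poly u x * ?f x = poly v x * ?f (q * x)" if "norm x < \<epsilon>" "poly g x \<noteq> 0" for x
    using UV[OF that(1)] that(2) unfolding uv by simp
  have fin: "finite {x. poly g x = 0}" using g0 by (rule poly_roots_finite)
  define h where "h = (\<lambda>x. poly u x * ?f x - poly v x * ?f (q * x))"
  have at0: "poly u 0 = poly v 0"
  proof -
    have c1: "isCont ?f 0" by (rule isCont_zero_fun) simp
    have c2: "isCont (\<lambda>x. ?f (q * x)) 0"
      by (rule isCont_o2[where g = ?f]) (auto intro!: isCont_zero_fun continuous_intros)
    have "isCont h 0" unfolding h_def by (intro continuous_intros c1 c2)
    hence lim: "(h \<longlongrightarrow> h 0) (at 0)" by (simp add: isCont_def)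
    have "\<forall>\<^sub>F x in at 0. x \<notin> {x. poly g x = 0} - {0}"
    proof -
      have "open (- ({x. poly g x = 0} - {0}))"
        using fin by (intro open_Compl finite_imp_closed) simp
      from eventually_nhds_in_open[OF this, of 0] show ?thesis
        unfolding eventually_at_filter by (auto elim: eventually_mono)
    qed
    moreover have "\<forall>\<^sub>F x in at (0 :: complex). norm x < \<epsilon>"
      unfolding eventually_at using e(1) by (auto simp: dist_norm)
    moreover have "\<forall>\<^sub>F x in at (0 :: complex). x \<noteq> 0" by (simp add: eventually_at_filter)
    ultimately have "\<forall>\<^sub>F x in at 0. h x = 0"
      by eventually_elim (use off in \<open>auto simp: h_def\<close>)
    hence "(h \<longlongrightarrow> 0) (at 0)" by (rule tendsto_eventually)
    from tendsto_unique[OF _ lim this] have "h 0 = 0" by simp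
    thus ?thesis by (simp add: h_def zero_fun_at_0)
  qed
  let ?dl = "\<lambda>p. p \<circ>\<^sub>p [:0, q:]"
  define E where "E = [:1, -1:] * v * ?dl v - [:1 + c / q, - (a + b):] * u * ?dl v + [:c / q, - (a * b):] * u * ?dl u"
  have "E = 0"
  proof (rule ccontr)
    assume "E \<noteq> 0"
    hence "finite ({x. poly E x = 0} \<union> {x. poly g x = 0} \<union> (\<lambda>x. x / q) ` {x. poly g x = 0})"
      using fin poly_roots_finite by blast
    hence "\<not> {x. norm x < \<epsilon>} \<subseteq> {x. poly E x = 0} \<union> {x. poly g x = 0} \<union> (\<lambda>x. x / q) ` {x. poly g x = 0}"
      using infinite_disc[OF e(1)] finite_subset by blast
    then obtain x where x: "norm x < \<epsilon>" "poly E x \<noteq> 0" "poly g x \<noteq> 0" "x \<notin> (\<lambda>x. x / q) ` {x. poly g x = 0}"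
      by blast
    have gq: "poly g (q * x) \<noteq> 0"
      using x(4) q0 by (auto simp: image_iff)
    have x1: "norm x < 1" using x(1) e(2) by simp
    have 1: "poly u x * ?f x = poly v x * ?f (q * x)" by (rule off[OF x(1,3)])
    have 2: "poly u (q * x) * ?f (q * x) = poly v (q * x) * ?f (q * (q * x))" by (rule off[OF qe[OF x(1)] gq])
    have "poly E x * ?f (q * x) = (1 - x) * poly v (q * x) * (poly v x * ?f (q * x))
       - (1 + c / q - (a + b) * x) * poly u x * poly v (q * x) * ?f (q * x)
       + (c / q - a * b * x) * poly u x * (poly u (q * x) * ?f (q * x))"
      by (simp add: E_def poly_pcompose algebra_simps)
    also have "\<dots> = poly u x * poly v (q * x) * ((1 - x) * ?f x - (1 + c / q - (a + b) * x) * ?f (q * x)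
       + (c / q - a * b * x) * ?f (q * (q * x)))"
      unfolding 1 [symmetric] 2 by (simp add: algebra_simps)
    also have "\<dots> = 0" using zero_fun_q_difference[OF x1] by simp
    finally show False using x(2) e(3)[OF qe[OF x(1)]] by simp
  qed
  thus False using riccati_no_rational_solution[of v u, OF _ cop at0] unfolding E_def by simp
qed

end

section \<open>Evaluation of polynomials in five variables\<close>

definition semiring_map :: "('a :: comm_ring_1 \<Rightarrow> 'b :: comm_ring_1) \<Rightarrow> bool" where
  "semiring_map f \<longleftrightarrow> f 0 = 0 \<and> f 1 = 1 \<and> (\<forall>x y. f (x + y) = f x + f y) \<and> (\<forall>x y. f (x * y) = f x * f y)"

text \<open>Extends a ring homomorphism from the coefficients to polynomials by a value for the variable; \<open>eval5\<close>
  is its fivefold iteration.\<close>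

definition poly_ext :: "('a :: comm_ring_1 \<Rightarrow> complex) \<Rightarrow> complex \<Rightarrow> 'a poly \<Rightarrow> complex" where
  "poly_ext f x p = poly (map_poly f p) x"

lemma poly_ext_pCons:
  assumes "f 0 = 0" shows "poly_ext f x (pCons t p) = f t + x * poly_ext f x p"
  by (cases "pCons t p = 0") (auto simp: poly_ext_def map_poly_pCons assms)

lemma poly_ext_0: "poly_ext f x 0 = 0"
  by (simp add: poly_ext_def)

lemma poly_ext_const: "f 0 = 0 \<Longrightarrow> poly_ext f x [:t:] = f t"
  using poly_ext_pCons[of f x t 0] by (simp add: poly_ext_0)

lemma semiring_map_poly_ext:
  assumes "semiring_map f" shows "semiring_map (poly_ext f x)"
proof -
  have f: "f 0 = 0" "f 1 = 1" "\<And>x y. f (x + y) = f x + f y" "\<And>x y. f (x * y) = f x * f y"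
    using assms by (auto simp: semiring_map_def)
  note s = poly_ext_pCons[of f, OF f(1)]
  have add: "poly_ext f x (p + r) = poly_ext f x p + poly_ext f x r" for p r
    by (induction p r rule: poly_induct2) (simp_all add: s f poly_ext_0 algebra_simps)
  have smult: "poly_ext f x (smult t p) = f t * poly_ext f x p" for t p
    by (induction p) (simp_all add: s f poly_ext_0 algebra_simps)
  have "poly_ext f x (p * r) = poly_ext f x p * poly_ext f x r" for p r
    by (induction p) (simp_all add: s f poly_ext_0 add smult algebra_simps)
  moreover have "poly_ext f x 1 = 1" using poly_ext_const[of f x 1] f by (simp add: one_pCons)
  ultimately show ?thesis unfolding semiring_map_def by (simp add: add poly_ext_0)
qed

lemma semiring_map_of_rat: "semiring_map (of_rat :: rat \<Rightarrow> complex)"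
  by (simp add: semiring_map_def of_rat_add of_rat_mult)

lemma eval5_poly_ext:
  "eval5 p a b c q x = poly_ext (poly_ext (poly_ext (poly_ext (poly_ext of_rat a) b) c) q) x p"
  unfolding eval5_def poly_ext_def [abs_def] ..

lemma semiring_map_eval5: "semiring_map (\<lambda>p. eval5 p a b c q x)"
  unfolding eval5_poly_ext by (intro semiring_map_poly_ext semiring_map_of_rat)

lemma eval5_simps [simp]:
  "eval5 0 a b c q x = 0" "eval5 1 a b c q x = 1"
  "eval5 (p + r) a b c q x = eval5 p a b c q x + eval5 r a b c q x"
  "eval5 (p * r) a b c q x = eval5 p a b c q x * eval5 r a b c q x"
  using semiring_map_eval5[of a b c q x] by (auto simp: semiring_map_def)

lemma eval5_minus [simp]:
  "eval5 (- p) a b c q x = - eval5 p a b c q x"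
  "eval5 (p - r) a b c q x = eval5 p a b c q x - eval5 r a b c q x"
proof -
  have 1: "eval5 (- p) a b c q x = - eval5 p a b c q x" for p
    using eval5_simps(3)[of "- p" p a b c q x] by (simp add: eq_neg_iff_add_eq_0)
  show "eval5 (- p) a b c q x = - eval5 p a b c q x" by (rule 1)
  show "eval5 (p - r) a b c q x = eval5 p a b c q x - eval5 r a b c q x"
    using eval5_simps(3)[of p "- r" a b c q x] 1[of r] by simp
qed

text \<open>The parameters \<open>a, b, c, q\<close> receive values, \<open>x\<close> remains a variable.\<close>

definition specialize :: "complex \<Rightarrow> complex \<Rightarrow> complex \<Rightarrow> complex \<Rightarrow> poly5 \<Rightarrow> complex poly" where
  "specialize a b c q p = map_poly (poly_ext (poly_ext (poly_ext (poly_ext of_rat a) b) c) q) p"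

lemma eval5_specialize: "eval5 p a b c q x = poly (specialize a b c q p) x"
  by (simp add: eval5_poly_ext specialize_def poly_ext_def)

lemma eval5_vars:
  "eval5 [:[:[:[:[:0, 1:]:]:]:]:] a b c q x = a"
  "eval5 [:[:[:[:0, 1:]:]:]:] a b c q x = b"
  "eval5 [:[:[:0, 1:]:]:] a b c q x = c"
  "eval5 [:[:0, 1:]:] a b c q x = q"
  "eval5 [:0, 1:] a b c q x = x"
  by (simp_all add: eval5_poly_ext poly_ext_pCons poly_ext_0)
     (simp_all add: poly_ext_pCons poly_ext_0 one_pCons)

lemma finite_roots_poly_ext:
  assumes "f 0 = 0" "f (lead_coeff p) \<noteq> 0"
  shows "finite {x. poly_ext f x p = 0}"
proof -
  have "coeff (map_poly f p) (degree p) \<noteq> 0" using assms by (simp add: coeff_map_poly)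
  hence "map_poly f p \<noteq> 0" by auto
  thus ?thesis unfolding poly_ext_def by (rule poly_roots_finite)
qed

lemma countable_qpowers_preimage:
  assumes "w \<noteq> 1" "w \<noteq> 0"
  shows "countable {q :: complex. w \<in> qpowers q}"
proof -
  have fin: "finite {q :: complex. q ^ n = v}" if "n > 0" for n v
  proof -
    have "coeff (monom (1 :: complex) n - [:v:]) n = 1" using that by (simp add: coeff_pCons split: nat.splits)
    hence "monom (1 :: complex) n - [:v:] \<noteq> 0" by (metis coeff_0 zero_neq_one)
    from poly_roots_finite[OF this] show ?thesis by (simp add: poly_monom)
  qed
  have "{q :: complex. w \<in> qpowers q} \<subseteq> (\<Union>n\<in>{0<..}. {q. q ^ n = w}) \<union> (\<Union>n\<in>{0<..}. {q. q ^ n = inverse w})"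
  proof
    fix q :: complex assume "q \<in> {q. w \<in> qpowers q}"
    then obtain n where n: "w = q powi n" by (auto simp: qpowers_def)
    show "q \<in> (\<Union>n\<in>{0<..}. {q. q ^ n = w}) \<union> (\<Union>n\<in>{0<..}. {q. q ^ n = inverse w})"
    proof (cases n "0 :: int" rule: linorder_cases)
      case equal
      thus ?thesis using n assms by simp
    next
      case greater
      hence "q ^ nat n = w" "0 < nat n" using n by (simp_all add: power_int_def)
      thus ?thesis by blast
    next
      case less
      hence "q ^ nat (- n) = inverse w" "0 < nat (- n)" using n by (simp_all add: power_int_def power_inverse)
      thus ?thesis by blast
    qed
  qed
  moreover have "countable ((\<Union>n\<in>{0<..}. {q :: complex. q ^ n = w}) \<union> (\<Union>n\<in>{0<..}. {q. q ^ n = inverse w}))"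
    using fin by (intro countable_Un countable_UN) (auto intro: countable_finite)
  ultimately show ?thesis by (rule countable_subset)
qed

text \<open>The admissible parameters are Zariski dense. The values are chosen one after the other, each avoiding
  the roots of the leading coefficient that remains. As \<open>q\<close> follows \<open>a, b, c\<close>, admissibility excludes only
  the countably many \<open>q\<close> of which some of the six given numbers is a power.\<close>

lemma eval5_nonzero_somewhere:
  assumes "p \<noteq> 0"
  obtains a b c q x where "admissible a b c q" "eval5 p a b c q x \<noteq> 0"
proof -
  define p4 where "p4 = lead_coeff p"
  define p3 where "p3 = lead_coeff p4"
  define p2 where "p2 = lead_coeff p3"
  define p1 where "p1 = lead_coeff p2"
  have nz: "p4 \<noteq> 0" "p3 \<noteq> 0" "p2 \<noteq> 0" "p1 \<noteq> 0"
    using assms by (simp_all add: p4_def p3_def p2_def p1_def)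
  note inf = infinite_UNIV_char_0[where 'a = complex]
  have "finite {x. poly_ext of_rat x p1 = 0}"
    by (rule finite_roots_poly_ext) (use nz in simp_all)
  hence "finite ({x. poly_ext of_rat x p1 = 0} \<union> {0, 1})" by simp
  then obtain a where a: "a \<notin> {x. poly_ext of_rat x p1 = 0} \<union> {0, 1}"
    using ex_new_if_finite[OF inf] by blast
  let ?f1 = "poly_ext of_rat a"
  have "finite {x. poly_ext ?f1 x p2 = 0}"
    by (rule finite_roots_poly_ext) (use a in \<open>simp_all add: p1_def poly_ext_0\<close>)
  hence "finite ({x. poly_ext ?f1 x p2 = 0} \<union> {0, 1, a})" by simp
  then obtain b where b: "b \<notin> {x. poly_ext ?f1 x p2 = 0} \<union> {0, 1, a}"
    using ex_new_if_finite[OF inf] by blast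
  let ?f2 = "poly_ext ?f1 b"
  have "finite {x. poly_ext ?f2 x p3 = 0}"
    by (rule finite_roots_poly_ext) (use b in \<open>simp_all add: p2_def poly_ext_0\<close>)
  hence "finite ({x. poly_ext ?f2 x p3 = 0} \<union> {0, 1, a, b})" by simp
  then obtain c where c: "c \<notin> {x. poly_ext ?f2 x p3 = 0} \<union> {0, 1, a, b}"
    using ex_new_if_finite[OF inf] by blast
  let ?f3 = "poly_ext ?f2 c"
  let ?W = "{c, a / b, a, b, c / a, c / b}"
  define F where "F = {x. poly_ext ?f3 x p4 = 0}"
  define W where "W = (\<Union>w\<in>?W. {q :: complex. w \<in> qpowers q})"
  define Bad where "Bad = F \<union> {0} \<union> W"
  have "finite F"
    unfolding F_def by (rule finite_roots_poly_ext) (use c in \<open>simp_all add: p3_def poly_ext_0\<close>)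
  moreover have "countable W"
    unfolding W_def by (intro countable_UN countable_qpowers_preimage) (use a b c in auto)
  ultimately have "countable Bad" by (simp add: Bad_def countable_finite)
  hence "\<not> ball 0 1 \<subseteq> Bad"
    using uncountable_ball[of 1 "0 :: complex"] countable_subset[of "ball 0 1" Bad] by auto
  then obtain q where q: "q \<in> ball 0 1" "q \<notin> F \<union> {0} \<union> W"
    unfolding Bad_def by blast
  let ?f4 = "poly_ext ?f3 q"
  have "finite {x. poly_ext ?f4 x p = 0}"
    by (rule finite_roots_poly_ext) (use q in \<open>simp_all add: F_def p4_def poly_ext_0\<close>)
  then obtain x where x: "x \<notin> {x. poly_ext ?f4 x p = 0}"
    using ex_new_if_finite[OF inf] by blast
  show ?thesis
  proof (rule that)
    show "eval5 p a b c q x \<noteq> 0" using x by (simp add: eval5_poly_ext)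
    show "admissible a b c q" using a b c q by (auto simp: admissible_def W_def)
  qed
qed

section \<open>Generic arguments are dense\<close>

lemma generic_dense:
  assumes "q \<noteq> 0" "d \<noteq> 0" "\<epsilon> > 0"
  obtains y where "dist y x < \<epsilon>" "generic d q (fls_const y)"
proof -
  have "countable ({0} \<union> range (\<lambda>j::int. inverse (d * q powi j)))" by simp
  hence "\<not> ball x \<epsilon> \<subseteq> {0} \<union> range (\<lambda>j::int. inverse (d * q powi j))"
    using uncountable_ball[OF assms(3), of x] countable_subset by blast
  then obtain y where y: "y \<in> ball x \<epsilon>" "y \<noteq> 0" "\<And>j::int. y \<noteq> inverse (d * q powi j)" by blast
  have "1 - fls_const (d * q powi j) * fls_const y \<noteq> 0" for j
  proof
    assume "1 - fls_const (d * q powi j) * fls_const y = 0"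
    hence "fls_const (1 - d * q powi j * y) = 0" by (simp add: fls_const_diff)
    hence "d * q powi j * y = 1" by simp
    hence "y = inverse (d * q powi j)" by (metis inverse_unique)
    thus False using y(3) by blast
  qed
  hence "generic d q (fls_const y)" using y(2) by (simp add: generic_def)
  thus ?thesis using that y(1) by (simp add: dist_commute)
qed

text \<open>Identities that hold at generic arguments extend to the points at which \<open>generic\<close> fails.\<close>

lemma eq_0_by_density:
  fixes h :: "complex \<Rightarrow> complex"
  assumes "isCont h x" "\<And>\<epsilon>. \<epsilon> > 0 \<Longrightarrow> \<exists>y. dist y x < \<epsilon> \<and> h y = 0"
  shows "h x = 0"
proof (rule ccontr)
  assume "h x \<noteq> 0"
  from continuous_at_avoid[OF assms(1) this] obtain e where "e > 0" "\<And>y. dist x y < e \<Longrightarrow> h y \<noteq> 0" by blast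
  thus False using assms(2)[of e] by (metis dist_commute)
qed

section \<open>Expressions that are rational functions of the parameters\<close>

type_synonym point = "complex \<times> complex \<times> complex \<times> complex \<times> complex"

definition eval_at :: "poly5 \<Rightarrow> point \<Rightarrow> complex" where
  "eval_at p = (\<lambda>(a, b, c, q, x). eval5 p a b c q x)"

lemma eval_at_simps [simp]:
  "eval_at 0 \<pi> = 0" "eval_at 1 \<pi> = 1"
  "eval_at (p + r) \<pi> = eval_at p \<pi> + eval_at r \<pi>"
  "eval_at (p * r) \<pi> = eval_at p \<pi> * eval_at r \<pi>"
  "eval_at (- p) \<pi> = - eval_at p \<pi>"
  "eval_at (p - r) \<pi> = eval_at p \<pi> - eval_at r \<pi>"
  by (cases \<pi>; simp add: eval_at_def)+

text \<open>A single quotient of polynomials with rational coefficients has to serve for all points of \<open>S\<close>: this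
  is what it means that an expression in complex numbers is an element of \<open>\<rat>(a, b, c, q, x)\<close>.\<close>

definition regular :: "point set \<Rightarrow> (point \<Rightarrow> complex) \<Rightarrow> bool" where
  "regular S F \<longleftrightarrow> (\<exists>n d. \<forall>\<pi>\<in>S. eval_at d \<pi> \<noteq> 0 \<and> F \<pi> = eval_at n \<pi> / eval_at d \<pi>)"

lemma regularI:
  "(\<And>\<pi>. \<pi> \<in> S \<Longrightarrow> eval_at d \<pi> \<noteq> 0) \<Longrightarrow> (\<And>\<pi>. \<pi> \<in> S \<Longrightarrow> F \<pi> = eval_at n \<pi> / eval_at d \<pi>) \<Longrightarrow> regular S F"
  unfolding regular_def by blast

lemma regularE:
  assumes "regular S F"
  obtains d n where "\<And>\<pi>. \<pi> \<in> S \<Longrightarrow> eval_at d \<pi> \<noteq> 0" "\<And>\<pi>. \<pi> \<in> S \<Longrightarrow> F \<pi> = eval_at n \<pi> / eval_at d \<pi>"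
  using assms unfolding regular_def by blast

lemma regular_cong: "regular S F \<Longrightarrow> (\<And>\<pi>. \<pi> \<in> S \<Longrightarrow> G \<pi> = F \<pi>) \<Longrightarrow> regular S G"
  unfolding regular_def by metis

lemma regular_0: "regular S (\<lambda>\<pi>. 0)" and regular_1: "regular S (\<lambda>\<pi>. 1)"
  by (rule regularI[of _ 1 _ 0]; simp) (rule regularI[of _ 1 _ 1]; simp)

lemma regular_uminus:
  assumes "regular S F" shows "regular S (\<lambda>\<pi>. - F \<pi>)"
proof -
  obtain n d where *: "\<And>\<pi>. \<pi> \<in> S \<Longrightarrow> eval_at d \<pi> \<noteq> 0" "\<And>\<pi>. \<pi> \<in> S \<Longrightarrow> F \<pi> = eval_at n \<pi> / eval_at d \<pi>"
    using assms by (rule regularE) (rule that)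
  show ?thesis by (rule regularI[of _ d _ "- n"]) (simp_all add: *)
qed

lemma regular_add:
  assumes "regular S F" "regular S G" shows "regular S (\<lambda>\<pi>. F \<pi> + G \<pi>)"
proof -
  obtain n d where *: "\<And>\<pi>. \<pi> \<in> S \<Longrightarrow> eval_at d \<pi> \<noteq> 0" "\<And>\<pi>. \<pi> \<in> S \<Longrightarrow> F \<pi> = eval_at n \<pi> / eval_at d \<pi>"
    using assms(1) by (rule regularE) (rule that)
  obtain n' d' where **: "\<And>\<pi>. \<pi> \<in> S \<Longrightarrow> eval_at d' \<pi> \<noteq> 0" "\<And>\<pi>. \<pi> \<in> S \<Longrightarrow> G \<pi> = eval_at n' \<pi> / eval_at d' \<pi>"
    using assms(2) by (rule regularE) (rule that)
  show ?thesis
  proof (rule regularI[of _ "d * d'" _ "n * d' + n' * d"])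
    show "eval_at (d * d') \<pi> \<noteq> 0" "F \<pi> + G \<pi> = eval_at (n * d' + n' * d) \<pi> / eval_at (d * d') \<pi>" if "\<pi> \<in> S" for \<pi>
      using *[OF that] **[OF that] by (simp_all add: add_frac_eq)
  qed
qed

lemma regular_diff: "regular S F \<Longrightarrow> regular S G \<Longrightarrow> regular S (\<lambda>\<pi>. F \<pi> - G \<pi>)"
  using regular_add[of S F "\<lambda>\<pi>. - G \<pi>"] regular_uminus[of S G] by simp

lemma regular_mult:
  assumes "regular S F" "regular S G" shows "regular S (\<lambda>\<pi>. F \<pi> * G \<pi>)"
proof -
  obtain n d where *: "\<And>\<pi>. \<pi> \<in> S \<Longrightarrow> eval_at d \<pi> \<noteq> 0" "\<And>\<pi>. \<pi> \<in> S \<Longrightarrow> F \<pi> = eval_at n \<pi> / eval_at d \<pi>"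
    using assms(1) by (rule regularE) (rule that)
  obtain n' d' where **: "\<And>\<pi>. \<pi> \<in> S \<Longrightarrow> eval_at d' \<pi> \<noteq> 0" "\<And>\<pi>. \<pi> \<in> S \<Longrightarrow> G \<pi> = eval_at n' \<pi> / eval_at d' \<pi>"
    using assms(2) by (rule regularE) (rule that)
  show ?thesis by (rule regularI[of _ "d * d'" _ "n * n'"]) (simp_all add: * **)
qed

lemma regular_inverse:
  assumes "regular S F" "\<And>\<pi>. \<pi> \<in> S \<Longrightarrow> F \<pi> \<noteq> 0" shows "regular S (\<lambda>\<pi>. inverse (F \<pi>))"
proof -
  obtain n d where *: "\<And>\<pi>. \<pi> \<in> S \<Longrightarrow> eval_at d \<pi> \<noteq> 0" "\<And>\<pi>. \<pi> \<in> S \<Longrightarrow> F \<pi> = eval_at n \<pi> / eval_at d \<pi>"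
    using assms(1) by (rule regularE) (rule that)
  show ?thesis
  proof (rule regularI[of _ n _ d])
    show "eval_at n \<pi> \<noteq> 0" "inverse (F \<pi>) = eval_at d \<pi> / eval_at n \<pi>" if "\<pi> \<in> S" for \<pi>
      using *[OF that] assms(2)[OF that] by auto
  qed
qed

lemma regular_divide:
  "regular S F \<Longrightarrow> regular S G \<Longrightarrow> (\<And>\<pi>. \<pi> \<in> S \<Longrightarrow> G \<pi> \<noteq> 0) \<Longrightarrow> regular S (\<lambda>\<pi>. F \<pi> / G \<pi>)"
  unfolding divide_inverse by (intro regular_mult regular_inverse)

lemma regular_power: "regular S F \<Longrightarrow> regular S (\<lambda>\<pi>. F \<pi> ^ n)"
  by (induction n) (auto intro: regular_1 regular_mult)

lemma regular_powi:
  assumes "regular S F" "\<And>\<pi>. \<pi> \<in> S \<Longrightarrow> F \<pi> \<noteq> 0" shows "regular S (\<lambda>\<pi>. F \<pi> powi i)"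
proof (cases "i \<ge> 0")
  case True
  thus ?thesis unfolding power_int_def using assms by (simp add: regular_power)
next
  case False
  have "regular S (\<lambda>\<pi>. inverse (F \<pi>) ^ nat (- i))" by (intro regular_power regular_inverse assms)
  thus ?thesis unfolding power_int_def using False by simp
qed

lemma regular_sum: "(\<And>i. i \<in> I \<Longrightarrow> regular S (F i)) \<Longrightarrow> regular S (\<lambda>\<pi>. \<Sum>i\<in>I. F i \<pi>)"
  by (induction I rule: infinite_finite_induct) (auto intro: regular_0 regular_add)

lemma regular_prod: "(\<And>i. i \<in> I \<Longrightarrow> regular S (F i)) \<Longrightarrow> regular S (\<lambda>\<pi>. \<Prod>i\<in>I. F i \<pi>)"
  by (induction I rule: infinite_finite_induct) (auto intro: regular_1 regular_mult)

lemma regular_qpoch_nonneg: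
  assumes "n \<ge> 0" "regular S Q" "regular S U" shows "regular S (\<lambda>\<pi>. qpoch (Q \<pi>) (U \<pi>) n)"
  unfolding qpoch_def using assms(1) by (auto intro!: regular_prod regular_diff regular_1 regular_mult regular_power assms)

lemma regular_qpoch:
  assumes "regular S Q" "regular S U" "\<And>\<pi>. \<pi> \<in> S \<Longrightarrow> Q \<pi> \<noteq> 0" "\<And>\<pi>. \<pi> \<in> S \<Longrightarrow> U \<pi> \<notin> qpowers (Q \<pi>)"
  shows "regular S (\<lambda>\<pi>. qpoch (Q \<pi>) (U \<pi>) n)"
proof (cases "n \<ge> 0")
  case True
  thus ?thesis using assms by (intro regular_qpoch_nonneg)
next
  case False
  have "regular S (\<lambda>\<pi>. \<Prod>j=1..nat (- n). inverse (1 - U \<pi> * Q \<pi> powi (- int j)))"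
    by (intro regular_prod regular_inverse regular_diff regular_1 regular_mult regular_powi assms one_minus_qpow_nonzero)
  thus ?thesis using False by (simp add: qpoch_def)
qed

text \<open>The parameters are functions of the point rather than its coordinates, so that the locale also covers
  \<open>aq, bq, cq\<close>.\<close>

locale regular_params =
  fixes S :: "point set" and A B C Q :: "point \<Rightarrow> complex"
  assumes regA: "regular S A" and regB: "regular S B" and regC: "regular S C" and regQ: "regular S Q"
    and hp: "\<And>\<pi>. \<pi> \<in> S \<Longrightarrow> heine_params (A \<pi>) (B \<pi>) (C \<pi>) (Q \<pi>)"
begin

lemmas nzA = heine_params.a0[OF hp] and nzB = heine_params.b0[OF hp] and nzC = heine_params.c0[OF hp]
  and nzQ = heine_params.q0[OF hp] and udQ = heine_params.q[OF hp]

lemmas notin_rules = heine_params.notin(1-3)[OF hp] heine_params.notin'[OF hp] heine_params.shift_notin(1,2)[OF hp]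
  heine_params.notin_shift[OF hp]

lemma nz_qpoch: "\<pi> \<in> S \<Longrightarrow> u \<notin> qpowers (Q \<pi>) \<Longrightarrow> qpoch (Q \<pi>) u n \<noteq> 0"
  using qpoch_nonzero[OF nzQ] by blast

lemma nz_qpoch_q: "\<pi> \<in> S \<Longrightarrow> n \<ge> 0 \<Longrightarrow> qpoch (Q \<pi>) (Q \<pi>) n \<noteq> 0"
  using qpoch_q_nonzero[OF udQ, of \<pi> "nat n"] by simp

lemma nz_powi: "x \<noteq> 0 \<Longrightarrow> x powi i \<noteq> (0 :: complex)" by simp

lemma nz_divide: "x \<noteq> 0 \<Longrightarrow> y \<noteq> 0 \<Longrightarrow> x / y \<noteq> (0 :: complex)" by simp

lemmas nz_rules = no_zero_divisors nz_divide nz_powi nz_qpoch_q nz_qpoch nzA nzB nzC nzQ notin_rules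

lemma regular_phi43:
  assumes "n \<ge> 0" "regular S A1" "regular S A2" "regular S A3" "regular S B1" "regular S B2" "regular S B3" "regular S Z"
    and "\<And>\<pi>. \<pi> \<in> S \<Longrightarrow> B1 \<pi> \<notin> qpowers (Q \<pi>)" "\<And>\<pi>. \<pi> \<in> S \<Longrightarrow> B2 \<pi> \<notin> qpowers (Q \<pi>)"
      "\<And>\<pi>. \<pi> \<in> S \<Longrightarrow> B3 \<pi> \<notin> qpowers (Q \<pi>)"
  shows "regular S (\<lambda>\<pi>. phi43 (Q \<pi> powi (- n)) (A1 \<pi>) (A2 \<pi>) (A3 \<pi>) (B1 \<pi>) (B2 \<pi>) (B3 \<pi>) (Q \<pi>) (Z \<pi>))"
proof -
  obtain N where n: "n = int N" using assms(1) nonneg_eq_int by blast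
  have "regular S (\<lambda>\<pi>. \<Sum>i\<le>N. qpoch (Q \<pi>) (Q \<pi> powi (- int N)) (int i) * qpoch (Q \<pi>) (A1 \<pi>) (int i) *
      qpoch (Q \<pi>) (A2 \<pi>) (int i) * qpoch (Q \<pi>) (A3 \<pi>) (int i) /
           (qpoch (Q \<pi>) (Q \<pi>) (int i) * qpoch (Q \<pi>) (B1 \<pi>) (int i) * qpoch (Q \<pi>) (B2 \<pi>) (int i) * qpoch (Q \<pi>) (B3 \<pi>) (int i)) * Z \<pi> ^ i)"
    by (intro regular_sum regular_mult regular_divide regular_qpoch_nonneg regular_power regular_powi assms regQ
        nz_rules) simp_all
  thus ?thesis by (rule regular_cong) (simp add: n phi43_terminating[OF nzQ])
qed

lemma regular_mu: "regular S (\<lambda>\<pi>. mu1 k l m (A \<pi>) (B \<pi>) (C \<pi>) (Q \<pi>))" "regular S (\<lambda>\<pi>. mu2 k l m (A \<pi>) (B \<pi>) (C \<pi>) (Q \<pi>))"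
  unfolding mu1_def mu2_def
  by (intro regular_mult regular_divide regular_powi regular_qpoch regA regB regC regQ nz_rules; assumption)+

lemma regular_C:
  assumes "n \<ge> 0" shows "regular S (\<lambda>\<pi>. C_coeff k l m (A \<pi>) (B \<pi>) (C \<pi>) (Q \<pi>) n)"
  unfolding C_coeff_def
  by (intro regular_mu regular_mult regular_divide regular_powi regular_phi43 regular_qpoch_nonneg assms regular_1 regA regB regC regQ nz_rules; assumption)

lemma regular_C':
  assumes "n \<ge> 0" shows "regular S (\<lambda>\<pi>. C'_coeff k l m (A \<pi>) (B \<pi>) (C \<pi>) (Q \<pi>) n)"
  unfolding C'_coeff_def
  by (intro regular_mu regular_mult regular_divide regular_powi regular_phi43 regular_qpoch_nonneg assms regular_1 regA regB regC regQ nz_rules; assumption)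

lemma regular_D: "regular S (\<lambda>\<pi>. D_coeff k l m (A \<pi>) (B \<pi>) (C \<pi>) (Q \<pi>) n)"
proof (cases "n < 0")
  case False
  hence n: "n \<ge> 0" by simp
  show ?thesis unfolding D_coeff_def if_not_P[OF False]
    by (intro regular_mu regular_mult regular_divide regular_powi regular_phi43 regular_qpoch_nonneg n regular_1 regA regB regC regQ nz_rules; assumption)
qed (simp add: D_coeff_def regular_0)

lemma regular_D': "regular S (\<lambda>\<pi>. D'_coeff k l m (A \<pi>) (B \<pi>) (C \<pi>) (Q \<pi>) n)"
proof (cases "n < 0")
  case False
  hence n: "n \<ge> 0" by simp
  show ?thesis unfolding D'_coeff_def if_not_P[OF False]
    by (intro regular_mu regular_mult regular_divide regular_powi regular_phi43 regular_qpoch_nonneg n regular_1 regA regB regC regQ nz_rules; assumption)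
qed (simp add: D'_coeff_def regular_0)

lemma regular_P_poly:
  assumes X: "regular S X"
  shows "regular S (\<lambda>\<pi>. P_poly k l m (A \<pi>) (B \<pi>) (C \<pi>) (Q \<pi>) (X \<pi>))"
proof -
  have 1: "regular S (\<lambda>\<pi>. \<Sum>n\<in>{0..t}. (C_coeff k l m (A \<pi>) (B \<pi>) (C \<pi>) (Q \<pi>) n -
      D_coeff k l m (A \<pi>) (B \<pi>) (C \<pi>) (Q \<pi>) (n + k - l)) * X \<pi> ^ nat (t - n))" for t
    by (intro regular_sum regular_mult regular_diff regular_C regular_D regular_power X) simp
  have 2: "regular S (\<lambda>\<pi>. \<Sum>n\<in>{0..t}. (C'_coeff k l m (A \<pi>) (B \<pi>) (C \<pi>) (Q \<pi>) n -
      D'_coeff k l m (A \<pi>) (B \<pi>) (C \<pi>) (Q \<pi>) (n + k - l)) * X \<pi> ^ nat (t - n))" for t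
    by (intro regular_sum regular_mult regular_diff regular_C' regular_D' regular_power X) simp
  show ?thesis unfolding P_poly_def
    by (cases "m \<ge> 0"; cases "k + l - m \<ge> 0") (simp_all add: 1 2)
qed

lemma nz_diffs: "\<pi> \<in> S \<Longrightarrow> B \<pi> - A \<pi> \<noteq> 0" "\<pi> \<in> S \<Longrightarrow> Q \<pi> - C \<pi> \<noteq> 0" "\<pi> \<in> S \<Longrightarrow> 1 - C \<pi> \<noteq> 0"
proof -
  assume p: "\<pi> \<in> S"
  interpret heine_params "A \<pi>" "B \<pi>" "C \<pi>" "Q \<pi>" by (rule hp[OF p])
  show "B \<pi> - A \<pi> \<noteq> 0" using a_neq_b by simp
  show "Q \<pi> - C \<pi> \<noteq> 0" using notin(3) qpowersI[of "Q \<pi>" 1] by auto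
  show "1 - C \<pi> \<noteq> 0" using one_minus_neq_0(3)[of 0] by simp
qed

lemma regular_minus_1_powi: "regular S (\<lambda>\<pi>. (- 1) powi i)"
  by (intro regular_powi regular_uminus regular_1) simp

lemma regular_lambda_Q: "regular S (\<lambda>\<pi>. lambda_Q k l m (A \<pi>) (B \<pi>) (C \<pi>) (Q \<pi>))"
  unfolding lambda_Q_def Let_def
  by (intro regular_minus_1_powi regular_mult regular_divide regular_diff regular_powi regular_qpoch regA regB regC regQ nz_diffs nz_rules; assumption)

lemma shifted_notin: "\<pi> \<in> S \<Longrightarrow> A \<pi> * Q \<pi> \<notin> qpowers (Q \<pi>)" "\<pi> \<in> S \<Longrightarrow> B \<pi> * Q \<pi> \<notin> qpowers (Q \<pi>)"
  using heine_params.shift_notin(1,2)[OF hp, of \<pi> 1] by simp_all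

lemma regular_lambda_R: "regular S (\<lambda>\<pi>. lambda_R k l m (A \<pi>) (B \<pi>) (C \<pi>) (Q \<pi>))"
  unfolding lambda_R_def Let_def
  by (intro regular_minus_1_powi regular_mult regular_divide regular_diff regular_powi regular_qpoch regA regB regC regQ nz_diffs shifted_notin nz_rules; assumption)

lemma regular_shifted: "regular_params S (\<lambda>\<pi>. A \<pi> * Q \<pi>) (\<lambda>\<pi>. B \<pi> * Q \<pi>) (\<lambda>\<pi>. C \<pi> * Q \<pi>) Q"
  by unfold_locales (intro regular_mult regA regB regC regQ heine_params.adm[OF heine_params.shifted[OF hp]]; assumption)+

lemma regular_x_powi:
  assumes X: "regular S X" and "\<And>\<pi>. \<pi> \<in> S \<Longrightarrow> X \<pi> \<noteq> 0 \<or> i \<ge> 0"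
  shows "regular S (\<lambda>\<pi>. X \<pi> powi i)"
proof (cases "i \<ge> 0")
  case True
  thus ?thesis by (simp add: power_int_def regular_power X)
next
  case False
  thus ?thesis using assms by (intro regular_powi) auto
qed

text \<open>For the index \<open>-1\<close> the shifted factorial is an inverse, and the convention \<open>inverse 0 = 0\<close> makes it nonzero
  only where it is defined.\<close>

lemma regular_qpoch_denominator:
  assumes U: "regular S U" and n: "n \<ge> -1" and nz: "\<And>\<pi>. \<pi> \<in> S \<Longrightarrow> qpoch (Q \<pi>) (U \<pi>) n \<noteq> 0"
  shows "regular S (\<lambda>\<pi>. qpoch (Q \<pi>) (U \<pi>) n)"
proof (cases "n \<ge> 0")
  case True
  thus ?thesis by (rule regular_qpoch_nonneg[OF _ regQ U])
next
  case False
  hence n1: "n = - int 1" using n by simp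
  have e: "qpoch (Q \<pi>) (U \<pi>) n = inverse (1 - U \<pi> * Q \<pi> powi (- int 1))" for \<pi>
    unfolding n1 qpoch_neg by simp
  show ?thesis using nz unfolding e
    by (intro regular_inverse regular_diff regular_1 regular_mult U regular_powi regQ nzQ) auto
qed

lemma regular_Q_expr:
  assumes X: "regular S X" and d: "\<And>\<pi>. \<pi> \<in> S \<Longrightarrow> Q_expr_defined k l m (A \<pi>) (B \<pi>) (C \<pi>) (Q \<pi>) (X \<pi>)"
  shows "regular S (\<lambda>\<pi>. Q_expr k l m (A \<pi>) (B \<pi>) (C \<pi>) (Q \<pi>) (X \<pi>))"
proof -
  have nz: "qpoch (Q \<pi>) (A \<pi> * B \<pi> * Q \<pi> * X \<pi> / C \<pi>) (max (k + l - m) 0 - 1) \<noteq> 0" if "\<pi> \<in> S" for \<pi>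
    using d[OF that] by (simp add: Q_expr_defined_def)
  have x: "regular S (\<lambda>\<pi>. X \<pi> powi (1 - max m 0))"
    using d by (intro regular_x_powi X) (auto simp: Q_expr_defined_def)
  have U: "regular S (\<lambda>\<pi>. A \<pi> * B \<pi> * Q \<pi> * X \<pi> / C \<pi>)"
    by (intro regular_divide regular_mult regA regB regQ regC X nzC)
  have den: "regular S (\<lambda>\<pi>. qpoch (Q \<pi>) (A \<pi> * B \<pi> * Q \<pi> * X \<pi> / C \<pi>) (max (k + l - m) 0 - 1))"
    by (rule regular_qpoch_denominator[OF U _ nz]) simp_all
  show ?thesis unfolding Q_expr_def
    by (intro regular_mult regular_divide[OF x den nz] regular_uminus regular_lambda_Q regular_divide regular_diff
        regular_1 regA regB regC regQ regular_P_poly X no_zero_divisors nz_diffs; assumption)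
qed

lemma regular_R_expr:
  assumes X: "regular S X" and d: "\<And>\<pi>. \<pi> \<in> S \<Longrightarrow> R_expr_defined k l m (A \<pi>) (B \<pi>) (C \<pi>) (Q \<pi>) (X \<pi>)"
  shows "regular S (\<lambda>\<pi>. R_expr k l m (A \<pi>) (B \<pi>) (C \<pi>) (Q \<pi>) (X \<pi>))"
proof -
  interpret s: regular_params S "\<lambda>\<pi>. A \<pi> * Q \<pi>" "\<lambda>\<pi>. B \<pi> * Q \<pi>" "\<lambda>\<pi>. C \<pi> * Q \<pi>" Q by (rule regular_shifted)
  have nz: "qpoch (Q \<pi>) (A \<pi> * B \<pi> * Q \<pi> * X \<pi> / C \<pi>) (max (k + l - m - 1) 0) \<noteq> 0" if "\<pi> \<in> S" for \<pi>
    using d[OF that] by (simp add: R_expr_defined_def)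
  have x: "regular S (\<lambda>\<pi>. X \<pi> powi (- max (m - 1) 0))"
    using d by (intro regular_x_powi X) (auto simp: R_expr_defined_def)
  have U: "regular S (\<lambda>\<pi>. A \<pi> * B \<pi> * Q \<pi> * X \<pi> / C \<pi>)"
    by (intro regular_divide regular_mult regA regB regQ regC X nzC)
  have den: "regular S (\<lambda>\<pi>. qpoch (Q \<pi>) (A \<pi> * B \<pi> * Q \<pi> * X \<pi> / C \<pi>) (max (k + l - m - 1) 0))"
    by (rule regular_qpoch_denominator[OF U _ nz]) simp_all
  show ?thesis unfolding R_expr_def
    by (intro regular_mult[OF regular_mult[OF regular_uminus[OF regular_lambda_R] regular_divide[OF x den nz]] s.regular_P_poly[OF X]]) assumption
qed

end

section \<open>The three term relation for rational functions\<close>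

context heine_params
begin

text \<open>At generic \<open>x\<close> the argument \<open>abqx/c\<close> is not a power of \<open>q\<close>.\<close>

lemma generic_defined:
  assumes "generic (a * b / c) q (fls_const x)"
  shows "Q_expr_defined k l m a b c q x" "R_expr_defined k l m a b c q x"
proof -
  define d where "d = a * b / c"
  have x0: "x \<noteq> 0" using genericD(1)[OF assms] by simp
  have u: "a * b * q * x / c \<notin> qpowers q"
  proof
    assume "a * b * q * x / c \<in> qpowers q"
    then obtain j where j: "a * b * q * x / c = q powi j" by (auto simp: qpowers_def)
    have "a * b * q * x / c = d * q * x" by (simp add: d_def)
    hence "d * q powi (1 - j) * x = 1" using j q0 by (simp add: power_int_diff field_simps)
    hence "1 - fls_const (d * q powi (1 - j)) * fls_const x = 0" by simp
    thus False using genericD(2)[OF assms, of "1 - j"] by (simp only: d_def)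
  qed
  show "Q_expr_defined k l m a b c q x" "R_expr_defined k l m a b c q x"
    unfolding Q_expr_defined_def R_expr_defined_def using x0 qpoch_nonzero[OF q0 u] by blast+
qed

text \<open>The same function as \<open>phi21\<close> with shifted parameters on the unit disc, in a form whose continuity is
  known.\<close>

definition phi_shifted :: "int \<Rightarrow> int \<Rightarrow> int \<Rightarrow> complex \<Rightarrow> complex" where
  "phi_shifted k l m x = qpoch q c m / (qpoch q a k * qpoch q b l) * zero_fun k l m x"

lemma phi_shifted:
  assumes "norm x < 1"
  shows "phi21 (a * q powi k) (b * q powi l) (c * q powi m) q x = phi_shifted k l m x"
  using qpoch_nonzero[OF q0 notin(1), of k] qpoch_nonzero[OF q0 notin(2), of l] qpoch_nonzero[OF q0 notin(3), of m]
  unfolding phi_shifted_def phi21_zero_fun[OF assms] by simp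

lemma phi_shifted_1: "norm x < 1 \<Longrightarrow> phi21 (a * q) (b * q) (c * q) q x = phi_shifted 1 1 1 x"
  and phi_shifted_0: "norm x < 1 \<Longrightarrow> phi21 a b c q x = phi_shifted 0 0 0 x"
  using phi_shifted[of x 1 1 1] phi_shifted[of x 0 0 0] by simp_all

lemma isCont_phi_shifted: "norm x < 1 \<Longrightarrow> isCont (phi_shifted k l m) x"
  unfolding phi_shifted_def by (intro continuous_intros isCont_zero_fun)

lemma generic_dense_in_disc:
  assumes "norm x < 1" "\<epsilon> > 0"
  obtains y where "dist y x < \<epsilon>" "norm y < 1" "generic (a * b / c) q (fls_const y)"
proof -
  have "a * b / c \<noteq> 0" using a0 b0 c0 by simp
  moreover have "min \<epsilon> (1 - norm x) > 0" using assms by simp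
  ultimately obtain y where y: "dist y x < min \<epsilon> (1 - norm x)" "generic (a * b / c) q (fls_const y)"
    using generic_dense[OF q0] by blast
  have "norm y \<le> norm (y - x) + norm x" using norm_triangle_ineq[of "y - x" x] by simp
  hence "norm y < 1" using y(1) by (simp add: dist_norm)
  thus ?thesis using that[of y] y by simp
qed

end

text \<open>The fractions come from the regularity of \<open>Q_expr\<close> and \<open>R_expr\<close>. The three term relation is obtained at
  generic \<open>x\<close>. To reach the other points, it is multiplied by the denominators of the given
  representations; both sides are then continuous in \<open>x\<close>. In the same way a second solution leads to a
  relation with polynomial coefficients on the whole disc.\<close>

theorem theorem3:
  fixes k l m :: int
  assumes "k \<le> l"
  shows "\<exists>Q R :: ratfun.
    three_term k l m Q R \<and>
    (\<forall>Q' R'. three_term k l m Q' R' \<longrightarrow> Q' = Q \<and> R' = R) \<and>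
    (\<forall>a b c q x. admissible a b c q \<longrightarrow>
      (Q_expr_defined k l m a b c q x \<longrightarrow> has_value Q a b c q x (Q_expr k l m a b c q x)) \<and>
      (R_expr_defined k l m a b c q x \<longrightarrow> has_value R a b c q x (R_expr k l m a b c q x)))"
proof -
  define SQ where "SQ = {(a, b, c, q, x). admissible a b c q \<and> Q_expr_defined k l m a b c q x}"
  define SR where "SR = {(a, b, c, q, x). admissible a b c q \<and> R_expr_defined k l m a b c q x}"
  define va vb vc vq vx :: "point \<Rightarrow> complex" where "va = (\<lambda>(a, b, c, q, x). a)" and "vb = (\<lambda>(a, b, c, q, x). b)"
    and "vc = (\<lambda>(a, b, c, q, x). c)" and "vq = (\<lambda>(a, b, c, q, x). q)" and "vx = (\<lambda>(a, b, c, q, x). x)"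
  note v_defs = va_def vb_def vc_def vq_def vx_def
  have vars: "regular S va" "regular S vb" "regular S vc" "regular S vq" "regular S vx" for S
  proof -
    have "regular S F" if "\<And>a b c q x. F (a, b, c, q, x) = eval5 p a b c q x" for F p
      by (rule regularI[of _ 1 _ p]) (auto simp: eval_at_def that)
    note var = this
    show "regular S va" "regular S vb" "regular S vc" "regular S vq" "regular S vx"
      by (rule var, unfold v_defs split_conv, rule eval5_vars(1) [symmetric])
         (rule var, unfold v_defs split_conv, rule eval5_vars(2-) [symmetric])+
  qed
  have params: "regular_params S va vb vc vq" if "\<And>\<pi>. \<pi> \<in> S \<Longrightarrow> admissible (va \<pi>) (vb \<pi>) (vc \<pi>) (vq \<pi>)" for S
    by unfold_locales (use vars that in auto)
  have "regular SQ (\<lambda>\<pi>. Q_expr k l m (va \<pi>) (vb \<pi>) (vc \<pi>) (vq \<pi>) (vx \<pi>))"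
    by (rule regular_params.regular_Q_expr[OF params vars(5)]) (auto simp: SQ_def v_defs)
  then obtain dQ nQ where Q0: "\<And>\<pi>. \<pi> \<in> SQ \<Longrightarrow> eval_at dQ \<pi> \<noteq> 0"
    "\<And>\<pi>. \<pi> \<in> SQ \<Longrightarrow> Q_expr k l m (va \<pi>) (vb \<pi>) (vc \<pi>) (vq \<pi>) (vx \<pi>) = eval_at nQ \<pi> / eval_at dQ \<pi>"
    by (rule regularE) (rule that)
  have Q: "eval5 dQ a b c q x \<noteq> 0 \<and> Q_expr k l m a b c q x = eval5 nQ a b c q x / eval5 dQ a b c q x"
    if "admissible a b c q" "Q_expr_defined k l m a b c q x" for a b c q x
    using Q0[of "(a, b, c, q, x)"] that by (simp add: SQ_def eval_at_def v_defs)
  have "regular SR (\<lambda>\<pi>. R_expr k l m (va \<pi>) (vb \<pi>) (vc \<pi>) (vq \<pi>) (vx \<pi>))"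
    by (rule regular_params.regular_R_expr[OF params vars(5)]) (auto simp: SR_def v_defs)
  then obtain dR nR where R0: "\<And>\<pi>. \<pi> \<in> SR \<Longrightarrow> eval_at dR \<pi> \<noteq> 0"
    "\<And>\<pi>. \<pi> \<in> SR \<Longrightarrow> R_expr k l m (va \<pi>) (vb \<pi>) (vc \<pi>) (vq \<pi>) (vx \<pi>) = eval_at nR \<pi> / eval_at dR \<pi>"
    by (rule regularE) (rule that)
  have R: "eval5 dR a b c q x \<noteq> 0 \<and> R_expr k l m a b c q x = eval5 nR a b c q x / eval5 dR a b c q x"
    if "admissible a b c q" "R_expr_defined k l m a b c q x" for a b c q x
    using R0[of "(a, b, c, q, x)"] that by (simp add: SR_def eval_at_def v_defs)
  \<comment> \<open>The denominators could only be \<open>0\<close> if no point were covered, so one such point has to be exhibited.\<close>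
  have dnz: "dQ \<noteq> 0" "dR \<noteq> 0"
  proof -
    obtain a b c q where adm: "admissible a b c q"
      by (rule eval5_nonzero_somewhere[of 1]) (simp, blast)
    interpret heine_params a b c q by unfold_locales (rule adm)
    have "norm (0 :: complex) < 1" "(1 :: real) > 0" by simp_all
    then obtain y where "generic (a * b / c) q (fls_const y)"
      using generic_dense_in_disc by blast
    from generic_defined[OF this] show "dQ \<noteq> 0" "dR \<noteq> 0" using Q[OF adm] R[OF adm] by force+
  qed
  have generic_values: "eval5 dQ a b c q y \<noteq> 0 \<and> eval5 dR a b c q y \<noteq> 0 \<and>
      phi21 (a * q powi k) (b * q powi l) (c * q powi m) q y =
      eval5 nQ a b c q y / eval5 dQ a b c q y * phi21 (a * q) (b * q) (c * q) q y +
      eval5 nR a b c q y / eval5 dR a b c q y * phi21 a b c q y"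
    if adm: "admissible a b c q" and y: "norm y < 1" "generic (a * b / c) q (fls_const y)" for a b c q y
  proof -
    interpret heine_params a b c q by unfold_locales (rule adm)
    show ?thesis
      using Q[OF adm generic_defined(1)[OF y(2)]] R[OF adm generic_defined(2)[OF y(2)]]
        three_term_at_generic_point[OF assms y] by simp
  qed
  have exists: "three_term k l m (Fract nQ dQ) (Fract nR dR)"
    unfolding three_term_def
  proof (intro allI impI)
    fix a b c q x u v
    assume adm: "admissible a b c q" and x: "norm x < 1"
      and hQ: "has_value (Fract nQ dQ) a b c q x u" and hR: "has_value (Fract nR dR) a b c q x v"
    interpret heine_params a b c q by unfold_locales (rule adm)
    obtain n d where 1: "Fract nQ dQ = Fract n d" "eval5 d a b c q x \<noteq> 0" "u = eval5 n a b c q x / eval5 d a b c q x"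
      using hQ unfolding has_value_def by blast
    obtain n' d' where 2: "Fract nR dR = Fract n' d'" "eval5 d' a b c q x \<noteq> 0" "v = eval5 n' a b c q x / eval5 d' a b c q x"
      using hR unfolding has_value_def by blast
    have "d \<noteq> 0" "d' \<noteq> 0" using 1(2) 2(2) by auto
    hence e: "nQ * d = n * dQ" "nR * d' = n' * dR"
      using 1(1) 2(1) dnz by (simp_all add: eq_fract)
    define s where "s = specialize a b c q"
    have s: "eval5 p a b c q y = poly (s p) y" for p y by (simp add: s_def eval5_specialize)
    define h where "h = (\<lambda>y. poly (s d) y * poly (s d') y * phi_shifted k l m y
       - poly (s n) y * poly (s d') y * phi_shifted 1 1 1 y - poly (s n') y * poly (s d) y * phi_shifted 0 0 0 y)"
    have "isCont h x" unfolding h_def by (intro continuous_intros isCont_phi_shifted x)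
    moreover have "\<exists>y. dist y x < \<epsilon> \<and> h y = 0" if e0: "\<epsilon> > 0" for \<epsilon>
    proof -
      obtain y where y: "dist y x < \<epsilon>" "norm y < 1" "generic (a * b / c) q (fls_const y)"
        using generic_dense_in_disc[OF x e0] by blast
      define U V where "U = poly (s nQ) y / poly (s dQ) y" and "V = poly (s nR) y / poly (s dR) y"
      have g: "poly (s dQ) y \<noteq> 0" "poly (s dR) y \<noteq> 0"
        "phi_shifted k l m y = U * phi_shifted 1 1 1 y + V * phi_shifted 0 0 0 y"
        using generic_values[OF adm y(2,3)] unfolding s U_def V_def
          phi_shifted[OF y(2)] phi_shifted_1[OF y(2)] phi_shifted_0[OF y(2)] by blast+
      have "poly (s nQ) y * poly (s d) y = poly (s n) y * poly (s dQ) y"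
        "poly (s nR) y * poly (s d') y = poly (s n') y * poly (s dR) y"
        using arg_cong[OF e(1), of "\<lambda>p. eval5 p a b c q y"] arg_cong[OF e(2), of "\<lambda>p. eval5 p a b c q y"]
        by (simp_all flip: s)
      hence E: "poly (s d) y * U = poly (s n) y" "poly (s d') y * V = poly (s n') y"
        unfolding U_def V_def using g(1,2) by (simp_all add: field_simps)
      have "h y = poly (s d') y * phi_shifted 1 1 1 y * (poly (s d) y * U - poly (s n) y)
         + poly (s d) y * phi_shifted 0 0 0 y * (poly (s d') y * V - poly (s n') y)"
        unfolding h_def g(3) by (simp only: algebra_simps)
      hence "h y = 0" unfolding E by simp
      thus ?thesis using y(1) by blast
    qed
    ultimately have hx: "h x = 0" by (rule eq_0_by_density)
    have n: "poly (s n) x = u * poly (s d) x" "poly (s n') x = v * poly (s d') x"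
      using 1(2,3) 2(2,3) unfolding s by simp_all
    have "poly (s d) x * poly (s d') x * (phi_shifted k l m x - (u * phi_shifted 1 1 1 x + v * phi_shifted 0 0 0 x)) = 0"
      using hx unfolding h_def n by (simp only: algebra_simps)
    hence "phi_shifted k l m x = u * phi_shifted 1 1 1 x + v * phi_shifted 0 0 0 x"
      using 1(2) 2(2) unfolding s by simp
    thus "phi21 (a * q powi k) (b * q powi l) (c * q powi m) q x = u * phi21 (a * q) (b * q) (c * q) q x + v * phi21 a b c q x"
      unfolding phi_shifted[OF x] phi_shifted_1[OF x] phi_shifted_0[OF x] .
  qed
  have unique: "Q' = Fract nQ dQ \<and> R' = Fract nR dR" if tt: "three_term k l m Q' R'" for Q' R'
  proof -
    obtain n1 d1 :: poly5 where Q': "Q' = Fract n1 d1" "d1 \<noteq> 0" by (rule Fract_cases)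
    obtain n2 d2 :: poly5 where R': "R' = Fract n2 d2" "d2 \<noteq> 0" by (rule Fract_cases)
    \<comment> \<open>The differences of the two solutions, cleared of denominators. The factor \<open>d1 * d2\<close> makes the relation true where \<open>d1\<close> or \<open>d2\<close> vanishes.\<close>
    define P1 where "P1 = (n1 * dQ - nQ * d1) * (d2 * dR) * (d1 * d2)"
    define P2 where "P2 = (n2 * dR - nR * d2) * (d1 * dQ) * (d1 * d2)"
    have zero: "specialize a b c q P1 = 0 \<and> specialize a b c q P2 = 0" if adm: "admissible a b c q" for a b c q
    proof -
      interpret heine_params a b c q by unfold_locales (rule adm)
      define s where "s = specialize a b c q"
      have s: "eval5 p a b c q y = poly (s p) y" for p y by (simp add: s_def eval5_specialize)
      show ?thesis
      proof (rule phi21_independent)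
        fix x :: complex assume x: "norm x < 1"
        define h where "h = (\<lambda>y. poly (s P1) y * phi_shifted 1 1 1 y + poly (s P2) y * phi_shifted 0 0 0 y)"
        have "isCont h x" unfolding h_def by (intro continuous_intros isCont_phi_shifted x)
        moreover have "\<exists>y. dist y x < \<epsilon> \<and> h y = 0" if e0: "\<epsilon> > 0" for \<epsilon>
        proof -
          obtain y where y: "dist y x < \<epsilon>" "norm y < 1" "generic (a * b / c) q (fls_const y)"
            using generic_dense_in_disc[OF x e0] by blast
          define w where "w = (\<lambda>p. eval5 p a b c q y)"
          have w: "w (p * r) = w p * w r" "w (p - r) = w p - w r" for p r by (simp_all add: w_def)
          define f g where "f = phi_shifted 1 1 1 y" and "g = phi_shifted 0 0 0 y"
          have 1: "w dQ \<noteq> 0" "w dR \<noteq> 0" "phi_shifted k l m y = w nQ / w dQ * f + w nR / w dR * g"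
            using generic_values[OF adm y(2,3)] unfolding w_def f_def g_def
              phi_shifted[OF y(2)] phi_shifted_1[OF y(2)] phi_shifted_0[OF y(2)] by auto
          have "w P1 * f + w P2 * g = 0"
          proof (cases "w d1 = 0 \<or> w d2 = 0")
            case True
            thus ?thesis by (auto simp: P1_def P2_def w)
          next
            case False
            hence v: "has_value Q' a b c q y (w n1 / w d1)" "has_value R' a b c q y (w n2 / w d2)"
              unfolding has_value_def Q' R' w_def by blast+
            define \<alpha> \<beta> where "\<alpha> = w n1 / w d1 - w nQ / w dQ" and "\<beta> = w n2 / w d2 - w nR / w dR"
            have "phi_shifted k l m y = w n1 / w d1 * f + w n2 / w d2 * g"
              using tt[unfolded three_term_def, rule_format, OF adm y(2) v]
              unfolding f_def g_def phi_shifted[OF y(2)] phi_shifted_1[OF y(2)] phi_shifted_0[OF y(2)] .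
            hence 2: "\<alpha> * f + \<beta> * g = 0"
              unfolding 1(3) \<alpha>_def \<beta>_def by (simp add: algebra_simps)
            have 3: "w n1 * w dQ - w nQ * w d1 = \<alpha> * (w d1 * w dQ)" "w n2 * w dR - w nR * w d2 = \<beta> * (w d2 * w dR)"
              using False 1(1,2) by (simp_all add: \<alpha>_def \<beta>_def field_simps)
            have "w P1 * f + w P2 * g = (w d1 * w dQ) * (w d2 * w dR) * (w d1 * w d2) * (\<alpha> * f + \<beta> * g)"
              unfolding P1_def P2_def w 3 by (simp only: algebra_simps)
            thus ?thesis unfolding 2 by simp
          qed
          hence "h y = 0" by (simp only: h_def w_def f_def g_def s)
          thus ?thesis using y(1) by blast
        qed
        ultimately have "h x = 0" by (rule eq_0_by_density)
        thus "poly (specialize a b c q P1) x * phi21 (a * q) (b * q) (c * q) q x + poly (specialize a b c q P2) x * phi21 a b c q x = 0"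
          unfolding phi_shifted_1[OF x] phi_shifted_0[OF x] h_def s_def .
      qed
    qed
    have "P1 = 0" "P2 = 0"
      using eval5_nonzero_somewhere[of P1] eval5_nonzero_somewhere[of P2] zero
      by (metis eval5_specialize poly_0)+
    hence "n1 * dQ = nQ * d1" "n2 * dR = nR * d2"
      using dnz Q'(2) R'(2) by (auto simp: P1_def P2_def)
    thus ?thesis unfolding Q'(1) R'(1) using dnz Q'(2) R'(2) by (simp add: eq_fract)
  qed
  show ?thesis
  proof (intro exI conjI allI impI)
    show "three_term k l m (Fract nQ dQ) (Fract nR dR)" by (rule exists)
    show "Q' = Fract nQ dQ" "R' = Fract nR dR" if "three_term k l m Q' R'" for Q' R'
      using unique[OF that] by blast+
    show "has_value (Fract nQ dQ) a b c q x (Q_expr k l m a b c q x)"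
      if "admissible a b c q" "Q_expr_defined k l m a b c q x" for a b c q x
      using Q[OF that] unfolding has_value_def by blast
    show "has_value (Fract nR dR) a b c q x (R_expr k l m a b c q x)"
      if "admissible a b c q" "R_expr_defined k l m a b c q x" for a b c q x
      using R[OF that] unfolding has_value_def by blast
  qed
qed

end
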